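(* Let $n$ be a $2$-wide positive integer and let $q$ be its largest or second largest prime factor. Then $\mathsf{K}_1(C_n)=\mathsf{K}_1^{*}(C_n)$ and $\mathsf{K}_1(C_n\oplus C_q)=\mathsf{K}_1^{*}(C_n\oplus C_q)$.
   Context: Groups are finite abelian, written additively; $C_m$ is the cyclic group of order $m$; $\mathbb{N}=\mathbb{Z}_{\ge 0}$; $G^{\bullet}=G\setminus\{0\}$. "Second largest prime factor" refers to the ordering of the distinct primes dividing $n$. An indexed sequence over $G$ is an element of the free abelian monoid (written multiplicatively, identity $1$) on $G^{\bullet}\times\mathbb{N}$; all indexed sequences are assumed squarefree, i.e. every pair $(g,n)$ occurs with multiplicity at most one, so an indexed sequence is a finite set of labelled nonzero elements of $G$ (the same $g$ may occur with several labels). For an indexed sequence $S$, $\overline{v}_g(S)$ is the number of terms of $S$ with first coordinate $g$, and $\overline{\sigma}(S)=\sum_{g\in G^\bullet}\overline{v}_g(S)\,g\in G$. A subsequence of $S$ is a divisor of $S$ in the monoid. $S$ is zero-sum if $\overline{\sigma}(S)=0$, and irreducible if $S\ne 1$, $S$ is zero-sum, and $S$ has no nontrivial proper zero-sum subsequence. An irreducible factorization of a zero-sum indexed sequence $S$ is a way of writing $S=\prod_{i\le m}S_i$ with all $S_i$ irreducible, up to the order of the factors. $S$ is a unique factorization indexed sequence (UFIS) if it is zero-sum and has exactly one irreducible factorization. The cross number of $S$ is $\mathsf{k}(S)=\sum_{g\in G^\bullet}\overline{v}_g(S)/\mathrm{ord}(g)$, and $$\mathsf{K}_1(G)=\max\{\mathsf{k}(S):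 S \text{ a UFIS over } G\}.$$ Writing $G\cong\bigoplus_{i=1}^{r}C_{p_i^{\alpha_i}}$ as a direct sum of cyclic groups of prime power order ($p_i$ not necessarily distinct), define $$\mathsf{K}_1^{*}(G)=\sum_{i=1}^{r}\frac{p_i^{\alpha_i}-1}{p_i^{\alpha_i}-p_i^{\alpha_i-1}}.$$ A prime $p$ is $2$-wide with respect to a positive integer $n$, written $p\prec_2 n$, if $p\nmid n$ and, with prime factorization $n=q_1^{\alpha_1}\cdots q_r^{\alpha_r}$, $$\frac{p^{2}+2p-2}{p^{2}}\ge\prod_{j=1}^{r}\frac{q_j^{\alpha_j+1}-1}{q_j^{\alpha_j+1}-q_j^{\alpha_j}},$$ the empty product being $1$. A positive integer $n=q_1^{\alpha_1}\cdots q_r^{\alpha_r}$ with primes $q_1<\cdots<q_r$ is $2$-wide if $q_i\prec_2\prod_{j=i+1}^{r}q_j^{\alpha_j}$ for each $i$ with $1\le i\le r-1$. *)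

theory Defs
  imports
    "HOL-Algebra.Product_Groups"
    "HOL-Algebra.Multiplicative_Group"
    "HOL-Library.Multiset"
    "HOL-Computational_Algebra.Primes"
begin

text \<open>
  Groups are the (multiplicatively written) monoid records of HOL-Algebra; the group operation,
  neutral element and multiples \<open>m g\<close> of an additively written group appear below as
  \<open>\<otimes>\<close>, \<open>\<one>\<close> and \<open>g [^] m\<close>.
  The definitions are intended for finite abelian groups only.
\<close>

definition nonzero :: "('a, 'b) monoid_scheme \<Rightarrow> 'a set" where
  "nonzero G = carrier G - {\<one>\<^bsub>G\<^esub>}"

text \<open>
  The free abelian monoid on a set is the monoid of finite multisets over it: its product is
  \<open>+\<close>, its identity is \<open>{#}\<close> and divisibility is \<open>\<subseteq>#\<close>.
\<close>

definition indexed_sequence :: "('a, 'b) monoid_scheme \<Rightarrow> ('a \<times> nat) multiset \<Rightarrow> bool" where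
  "indexed_sequence G S \<longleftrightarrow> set_mset S \<subseteq> nonzero G \<times> UNIV \<and> (\<forall>x. count S x \<le> 1)"

definition vbar :: "'a \<Rightarrow> ('a \<times> nat) multiset \<Rightarrow> nat" where
  "vbar g S = size {#x \<in># S. fst x = g#}"

definition sigma_bar :: "('a, 'b) monoid_scheme \<Rightarrow> ('a \<times> nat) multiset \<Rightarrow> 'a" where
  "sigma_bar G S = (\<Otimes>\<^bsub>G\<^esub>g\<in>nonzero G. g [^]\<^bsub>G\<^esub> vbar g S)"

definition zero_sum :: "('a, 'b) monoid_scheme \<Rightarrow> ('a \<times> nat) multiset \<Rightarrow> bool" where
  "zero_sum G S \<longleftrightarrow> indexed_sequence G S \<and> sigma_bar G S = \<one>\<^bsub>G\<^esub>"

definition irreducible_seq :: "('a, 'b) monoid_scheme \<Rightarrow> ('a \<times> nat) multiset \<Rightarrow> bool" where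
  "irreducible_seq G S \<longleftrightarrow>
     S \<noteq> {#} \<and> zero_sum G S \<and> (\<forall>T. T \<subset># S \<and> T \<noteq> {#} \<longrightarrow> \<not> zero_sum G T)"

text \<open>Factorizations are multisets of factors, so the order of the factors is disregarded.\<close>

definition irreducible_factorization ::
    "('a, 'b) monoid_scheme \<Rightarrow> ('a \<times> nat) multiset \<Rightarrow> ('a \<times> nat) multiset multiset \<Rightarrow> bool" where
  "irreducible_factorization G S F \<longleftrightarrow> (\<forall>T\<in>#F. irreducible_seq G T) \<and> sum_mset F = S"

definition UFIS :: "('a, 'b) monoid_scheme \<Rightarrow> ('a \<times> nat) multiset \<Rightarrow> bool" where
  "UFIS G S \<longleftrightarrow> zero_sum G S \<and> (\<exists>!F. irreducible_factorization G S F)"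

definition cross_number :: "('a, 'b) monoid_scheme \<Rightarrow> ('a \<times> nat) multiset \<Rightarrow> real" where
  "cross_number G S = (\<Sum>g\<in>nonzero G. real (vbar g S) / real (group.ord G g))"

definition K1 :: "('a, 'b) monoid_scheme \<Rightarrow> real" where
  "K1 G = Max {cross_number G S | S. UFIS G S}"

definition prime_power_decomposition ::
    "('a, 'b) monoid_scheme \<Rightarrow> nat \<Rightarrow> (nat \<Rightarrow> nat) \<Rightarrow> (nat \<Rightarrow> nat) \<Rightarrow> bool" where
  "prime_power_decomposition G r p \<alpha> \<longleftrightarrow>
     (\<forall>i<r. prime (p i) \<and> 0 < \<alpha> i) \<and>
     G \<cong> sum_group {..<r} (\<lambda>i. integer_mod_group (p i ^ \<alpha> i))"

text \<open>The value does not depend on the decomposition, by uniqueness of the elementary divisors.\<close>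

definition K1_star :: "('a, 'b) monoid_scheme \<Rightarrow> real" where
  "K1_star G = (THE x. \<exists>r p \<alpha>. prime_power_decomposition G r p \<alpha> \<and>
     x = (\<Sum>i<r. (real (p i) ^ \<alpha> i - 1) / (real (p i) ^ \<alpha> i - real (p i) ^ (\<alpha> i - 1))))"

definition two_wide_wrt :: "nat \<Rightarrow> nat \<Rightarrow> bool" (infix \<open>\<prec>\<^sub>2\<close> 50) where
  "p \<prec>\<^sub>2 n \<longleftrightarrow> prime p \<and> 0 < n \<and> \<not> p dvd n \<and>
     (real p ^ 2 + 2 * real p - 2) / real p ^ 2 \<ge>
     (\<Prod>q\<in>prime_factors n.
        (real q ^ (multiplicity q n + 1) - 1) /
        (real q ^ (multiplicity q n + 1) - real q ^ multiplicity q n))"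

definition two_wide :: "nat \<Rightarrow> bool" where
  "two_wide n \<longleftrightarrow> 0 < n \<and>
     (\<forall>q\<in>prime_factors n. q \<noteq> Max (prime_factors n) \<longrightarrow>
        q \<prec>\<^sub>2 (\<Prod>q'\<in>{q'\<in>prime_factors n. q < q'}. q' ^ multiplicity q' n))"

definition largest_prime_factor :: "nat \<Rightarrow> nat \<Rightarrow> bool" where
  "largest_prime_factor n q \<longleftrightarrow> q \<in> prime_factors n \<and> q = Max (prime_factors n)"

definition second_largest_prime_factor :: "nat \<Rightarrow> nat \<Rightarrow> bool" where
  "second_largest_prime_factor n q \<longleftrightarrow>
     q \<in> prime_factors n - {Max (prime_factors n)} \<and>
     q = Max (prime_factors n - {Max (prime_factors n)})"

end

theory Submission
  imports Defs "HOL-Number_Theory.Number_Theory"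
begin

section \<open>Families modulo a pair of integers\<close>

text \<open>
  A zero-sum sequence is a UFIS if and only if the intersection of any two of its zero-sum
  subsequences has sum zero. This property is inherited by subsequences; it is preserved when a
  subsequence is merged into its sum, and when minus the total sum is adjoined.

  If some order \<open>p M\<close> (\<open>p\<close> prime) such that multiplication by \<open>M\<close> maps the elements of order
  dividing \<open>p M\<close> to a group of order \<open>p\<close> occurs more than \<open>p\<close> times, then at most \<open>p\<close> of these terms
  can be merged into a nonzero term of order dividing \<open>M\<close>, which does not decrease the cross number.
  So one may assume that there are at most \<open>p\<close> terms of each such order. If there are at least
  \<open>N - 1\<close> terms of order \<open>p\<close>, where \<open>N\<close> is the maximal length of a UFIS over the \<open>p\<close>-torsion, then the
  other terms form a UFIS modulo \<open>p\<close>-torsion, and induction applies. Otherwise one sums the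
  contributions of the individual orders; the terms of order \<open>p\<close> that are missing compensate for the
  terms of order \<open>p\<^sup>j d\<close> with \<open>d > 1\<close>, and this compensation is what being \<open>2\<close>-wide says.

  The values of \<open>N\<close> are \<open>p\<close> for \<open>C\<^sub>p\<close> and \<open>2p\<close> for \<open>C\<^sub>p \<oplus> C\<^sub>p\<close>. The latter is obtained from
  the rank method of Croot, Lev and Pach over the prime field.
\<close>

text \<open>The constant in \<open>2\<close>-wide is the price of the orders that mix
  \<open>p\<close> with larger primes. Merging allows \<open>p\<close> terms of each order, and the
  passage to the quotient handles \<open>p - 1\<close> or more terms of order \<open>p\<close>.
  Otherwise at least two are missing, a deficit of \<open>2 / p\<close>. The orders
  \<open>p^j d\<close>, with \<open>d > 1\<close> prime to \<open>p\<close>, contribute at most a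
  geometric series, bounded by \<open>p / (p - 1)\<close>, times the sum of the
  \<open>1 / d\<close>. The deficit pays for them if that sum is at most
  \<open>2 (p - 1) / p^2\<close>. Adding \<open>d = 1\<close> on both sides gives
  \<open>(p^2 + 2 p - 2) / p^2\<close> and the product in the definition. The summand
  \<open>C_q\<close> obstructs merging: the \<open>q\<close>-torsion now has rank two, so the order
  \<open>q\<close> itself has only the weaker bound with \<open>N = 2 q\<close>. The direct count
  then has to deal with \<open>q\<close> and the larger primes together. With at most one larger
  prime it closes for all primes, and this is where the restriction on \<open>q\<close> enters.
  Equality needs families that reach the bound; they are built by raising the order by one prime
  factor at a time.\<close>

text \<open>
  A pair of integers stands for an element of \<open>C\<^sub>n \<oplus> C\<^sub>q\<close>, so that passing to the quotient by
  torsion changes only the moduli. The cyclic group \<open>C\<^sub>n\<close> is the case \<open>q = 1\<close>.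
\<close>

definition zmod :: "nat \<Rightarrow> nat \<Rightarrow> int \<Rightarrow> int \<Rightarrow> bool" where
  "zmod n q a b \<longleftrightarrow> int n dvd a \<and> int q dvd b"

lemma zmod_0 [simp]: "zmod n q 0 0"
  by (simp add: zmod_def)

lemma zmod_add: "zmod n q a b \<Longrightarrow> zmod n q a' b' \<Longrightarrow> zmod n q (a + a') (b + b')"
  by (simp add: zmod_def)

lemma zmod_diff: "zmod n q a b \<Longrightarrow> zmod n q a' b' \<Longrightarrow> zmod n q (a - a') (b - b')"
  by (simp add: zmod_def)

lemma zmod_minus [simp]: "zmod n q (- a) (- b) \<longleftrightarrow> zmod n q a b"
  by (simp add: zmod_def)

lemma zmod_mult: "zmod n q a b \<Longrightarrow> zmod n q (k * a) (k * b)"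
  by (simp add: zmod_def)

abbreviation zsum :: "nat \<Rightarrow> nat \<Rightarrow> ('i \<Rightarrow> int) \<Rightarrow> ('i \<Rightarrow> int) \<Rightarrow> 'i set \<Rightarrow> bool" where
  "zsum n q x y S \<equiv> zmod n q (sum x S) (sum y S)"

text \<open>
  Unlike in a UFIS, zero terms are allowed and the total sum is arbitrary.
\<close>

definition ufam :: "nat \<Rightarrow> nat \<Rightarrow> 'i set \<Rightarrow> ('i \<Rightarrow> int) \<Rightarrow> ('i \<Rightarrow> int) \<Rightarrow> bool" where
  "ufam n q I x y \<longleftrightarrow> finite I \<and>
     (\<forall>S T. S \<subseteq> I \<longrightarrow> T \<subseteq> I \<longrightarrow> zsum n q x y S \<longrightarrow> zsum n q x y T \<longrightarrow>
        zsum n q x y (S \<inter> T))"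

lemma ufamI:
  assumes "finite I"
    and "\<And>S T. S \<subseteq> I \<Longrightarrow> T \<subseteq> I \<Longrightarrow> zsum n q x y S \<Longrightarrow> zsum n q x y T \<Longrightarrow>
        zsum n q x y (S \<inter> T)"
  shows "ufam n q I x y"
  using assms by (auto simp: ufam_def)

lemma ufam_finite: "ufam n q I x y \<Longrightarrow> finite I"
  by (simp add: ufam_def)

lemma ufam_Int:
  "ufam n q I x y \<Longrightarrow> S \<subseteq> I \<Longrightarrow> T \<subseteq> I \<Longrightarrow> zsum n q x y S \<Longrightarrow> zsum n q x y T \<Longrightarrow>
        zsum n q x y (S \<inter> T)"
  by (simp add: ufam_def)

text \<open>The sum over \<open>S - T\<close> is the sum over \<open>S\<close> minus that over
  \<open>S \<inter> T\<close>. Together with \<open>ufam_Un\<close> the zero-sum subsets form a ring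
  of sets.\<close>

lemma ufam_Diff:
  assumes "ufam n q I x y" "S \<subseteq> I" "T \<subseteq> I" "zsum n q x y S" "zsum n q x y T"
  shows "zsum n q x y (S - T)"
proof -
  have "finite S"
    using assms ufam_finite finite_subset by blast
  then have "sum h (S - T) = sum h S - sum h (S \<inter> T)" for h :: "'a \<Rightarrow> int"
    by (subst sum.Int_Diff[of S h T]) auto
  then show ?thesis
    using zmod_diff[OF assms(4) ufam_Int[OF assms]] by simp
qed

lemma ufam_Un:
  assumes "ufam n q I x y" "S \<subseteq> I" "T \<subseteq> I" "zsum n q x y S" "zsum n q x y T"
  shows "zsum n q x y (S \<union> T)"
proof -
  have "finite S" "finite T"
    using assms ufam_finite finite_subset by blast+
  then have "sum h (S \<union> T) = sum h (S - T) + sum h T" for h :: "'a \<Rightarrow> int"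
    by (metis Un_Diff_cancel2 Diff_disjoint Int_commute sum.union_disjoint finite_Diff)
  then show ?thesis
    using zmod_add[OF ufam_Diff[OF assms] assms(5)] by simp
qed

lemma ufam_subset: "ufam n q I x y \<Longrightarrow> J \<subseteq> I \<Longrightarrow> ufam n q J x y"
  by (rule ufamI) (auto intro: finite_subset ufam_finite ufam_Int)

lemma ufam_image:
  assumes "ufam n q I x y" "\<phi> ` J \<subseteq> I" "inj_on \<phi> J"
  shows "ufam n q J (\<lambda>j. x (\<phi> j)) (\<lambda>j. y (\<phi> j))"
proof (rule ufamI)
  show "finite J"
    using assms ufam_finite finite_imageD finite_subset by metis
next
  fix S T
  assume a: "S \<subseteq> J" "T \<subseteq> J" "zmod n q (\<Sum>j\<in>S. x (\<phi> j)) (\<Sum>j\<in>S. y (\<phi> j))"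
    "zmod n q (\<Sum>j\<in>T. x (\<phi> j)) (\<Sum>j\<in>T. y (\<phi> j))"
  have eq: "(\<Sum>j\<in>U. h (\<phi> j)) = sum h (\<phi> ` U)" if "U \<subseteq> J" for U and h :: "_ \<Rightarrow> int"
    using that inj_on_subset[OF assms(3)] by (simp add: sum.reindex)
  have "\<phi> ` S \<inter> \<phi> ` T = \<phi> ` (S \<inter> T)"
    using inj_on_image_Int[OF assms(3) a(1,2)] by simp
  moreover have "S \<inter> T \<subseteq> J" "\<phi> ` S \<subseteq> I" "\<phi> ` T \<subseteq> I" using a assms(2) by auto
  ultimately show "zmod n q (\<Sum>j\<in>S\<inter>T. x (\<phi> j)) (\<Sum>j\<in>S\<inter>T. y (\<phi> j))"
    using ufam_Int[OF assms(1), of "\<phi> ` S" "\<phi> ` T"] a by (simp add: eq)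
qed

text \<open>A set containing the new index is zero-sum if and only if its complement in
  \<open>I\<close> is. The four cases below thus amount to unions, differences and intersections of
  zero-sum subsets of \<open>I\<close>.\<close>

lemma ufam_complete:
  assumes "ufam n q I x y" "e \<notin> I"
  shows "ufam n q (insert e I) (x(e := - sum x I)) (y(e := - sum y I))"
proof (rule ufamI)
  show "finite (insert e I)" using assms(1) by (simp add: ufam_finite)
next
  let ?x = "x(e := - sum x I)" and ?y = "y(e := - sum y I)"
  let ?z = "\<lambda>T. zsum n q x y T"
  have fin: "finite I" using assms(1) by (rule ufam_finite)
  have out: "sum (h(e := c)) U = sum h U" if "U \<subseteq> I" for U c and h :: "_ \<Rightarrow> int"
    using that assms(2) by (intro sum.cong) auto
  have inn: "sum (h(e := - sum h I)) U = - sum h (I - U)"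
    if "e \<in> U" "U \<subseteq> insert e I" for U and h :: "_ \<Rightarrow> int"
  proof -
    have 1: "sum (h(e := - sum h I)) U = - sum h I + sum (h(e := - sum h I)) (U - {e})"
      using that fin finite_subset[OF that(2)] by (subst sum.remove[of U e]) auto
    have 2: "sum (h(e := - sum h I)) (U - {e}) = sum h (U - {e})"
      using that by (intro out) auto
    have "sum h I = sum h (I - (U - {e})) + sum h (U - {e})"
      using that fin by (intro sum.subset_diff) auto
    moreover have "I - (U - {e}) = I - U" using assms(2) by auto
    ultimately show ?thesis using 1 2 by simp
  qed
  fix S T
  assume a: "S \<subseteq> insert e I" "T \<subseteq> insert e I"
    and zS: "zsum n q ?x ?y S" and zT: "zsum n q ?x ?y T"
  have *: "zsum n q ?x ?y U \<longleftrightarrow> (if e \<in> U then ?z (I - U) else ?z U)"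
    if "U \<subseteq> insert e I" for U
  proof (cases "e \<in> U")
    case True
    then show ?thesis using that inn by (simp del: fun_upd_apply)
  next
    case False
    then have "U \<subseteq> I" using that by auto
    then show ?thesis using False out by simp
  qed
  have sub: "S \<inter> T \<subseteq> insert e I" using a by auto
  have zS': "if e \<in> S then ?z (I - S) else ?z S" using zS unfolding *[OF a(1)] .
  have zT': "if e \<in> T then ?z (I - T) else ?z T" using zT unfolding *[OF a(2)] .
  consider "e \<in> S" "e \<in> T" | "e \<in> S" "e \<notin> T" | "e \<notin> S" "e \<in> T" | "e \<notin> S" "e \<notin> T" by blast
  then show "zsum n q ?x ?y (S \<inter> T)"
  proof cases
    case 1
    then have "?z ((I - S) \<union> (I - T))"
      using zS' zT' a by - (rule ufam_Un[OF assms(1)], auto split: if_splits)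
    moreover have "(I - S) \<union> (I - T) = I - (S \<inter> T)" by auto
    ultimately show ?thesis using 1 unfolding *[OF sub] by simp
  next
    case 2
    then have "?z (T - (I - S))"
      using zS' zT' a by - (rule ufam_Diff[OF assms(1)], auto split: if_splits)
    moreover have "T - (I - S) = S \<inter> T" using a 2 by auto
    ultimately show ?thesis using 2 unfolding *[OF sub] by simp
  next
    case 3
    then have "?z (S - (I - T))"
      using zS' zT' a by - (rule ufam_Diff[OF assms(1)], auto split: if_splits)
    moreover have "S - (I - T) = S \<inter> T" using a 3 by auto
    ultimately show ?thesis using 3 unfolding *[OF sub] by simp
  next
    case 4
    then have "?z (S \<inter> T)"
      using zS' zT' a by - (rule ufam_Int[OF assms(1)], auto split: if_splits)
    then show ?thesis using 4 unfolding *[OF sub] by simp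
  qed
qed

text \<open>The index \<open>t\<close> is reused for the merged term. Expanding it back to
  \<open>T\<close> commutes with intersections, because the other remaining indices avoid
  \<open>T\<close>.\<close>

lemma ufam_merge:
  assumes "ufam n q I x y" "T \<subseteq> I" "t \<in> T"
  shows "ufam n q (insert t (I - T)) (x(t := sum x T)) (y(t := sum y T))"
proof (rule ufamI)
  show "finite (insert t (I - T))" using assms(1) by (simp add: ufam_finite)
next
  let ?x = "x(t := sum x T)" and ?y = "y(t := sum y T)"
  let ?e = "\<lambda>U. if t \<in> U then U \<union> T else U"
  have fin: "finite I" "finite T"
    using assms ufam_finite finite_subset by blast+
  have eq: "sum (h(t := sum h T)) U = sum h (?e U)" if "U \<subseteq> insert t (I - T)" for U and h :: "_ \<Rightarrow> int"
  proof (cases "t \<in> U")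
    case True
    have "finite U" using that fin finite_subset by (metis finite_Diff finite_insert)
    have "sum (h(t := sum h T)) U = sum h T + sum (h(t := sum h T)) (U - {t})"
      using True \<open>finite U\<close> by (subst sum.remove[of U t]) auto
    also have "sum (h(t := sum h T)) (U - {t}) = sum h (U - {t})"
      by (intro sum.cong) auto
    also have "sum h T + sum h (U - {t}) = sum h (T \<union> (U - {t}))"
      using that assms fin \<open>finite U\<close> by (subst sum.union_disjoint) auto
    also have "T \<union> (U - {t}) = U \<union> T" using assms(3) by auto
    finally show ?thesis using True by simp
  next
    case False
    then show ?thesis by (auto intro!: sum.cong)
  qed
  fix S U
  assume a: "S \<subseteq> insert t (I - T)" "U \<subseteq> insert t (I - T)"
    "zsum n q ?x ?y S" "zsum n q ?x ?y U"
  have sub: "S \<inter> U \<subseteq> insert t (I - T)" using a by auto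
  have sub': "?e V \<subseteq> I" if "V \<subseteq> insert t (I - T)" for V
    using that assms by (auto split: if_splits)
  have "?e S \<inter> ?e U = ?e (S \<inter> U)"
    using a assms by auto
  moreover have "zsum n q x y (?e S \<inter> ?e U)"
    using a by (intro ufam_Int[OF assms(1)] sub') (auto simp only: eq)
  ultimately show "zsum n q ?x ?y (S \<inter> U)"
    by (simp only: eq[OF sub])
qed

section \<open>Unique factorization over elementary groups of rank at most two\<close>

text \<open>Polynomial functions of total degree below \<open>n\<close>. The strict bound puts the
  zero function, and only it, at \<open>n = 0\<close>, so that the truncated \<open>n - 1\<close> in
  \<open>deg_lt_difference\<close> is right for constants and for zero.\<close>

inductive deg_lt :: "nat \<Rightarrow> (int \<Rightarrow> int \<Rightarrow> int) \<Rightarrow> bool" where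
  zero: "deg_lt n (\<lambda>u v. 0)"
| const: "deg_lt (Suc n) (\<lambda>u v. c)"
| add: "deg_lt n f \<Longrightarrow> deg_lt n g \<Longrightarrow> deg_lt n (\<lambda>u v. f u v + g u v)"
| mult1: "deg_lt n f \<Longrightarrow> deg_lt (Suc n) (\<lambda>u v. u * f u v)"
| mult2: "deg_lt n f \<Longrightarrow> deg_lt (Suc n) (\<lambda>u v. v * f u v)"

lemma deg_lt_Suc: "deg_lt n f \<Longrightarrow> deg_lt (Suc n) f"
  by (induction rule: deg_lt.induct) (auto intro: deg_lt.intros)

lemma deg_lt_mono: "deg_lt n f \<Longrightarrow> n \<le> m \<Longrightarrow> deg_lt m f"
  by (induction m) (auto simp: le_Suc_eq intro: deg_lt_Suc)

lemma deg_lt_0: "deg_lt n f \<Longrightarrow> n = 0 \<Longrightarrow> f = (\<lambda>u v. 0)"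
  by (induction rule: deg_lt.induct) auto

lemma deg_lt_scale: "deg_lt n f \<Longrightarrow> deg_lt n (\<lambda>u v. c * f u v)"
proof (induction rule: deg_lt.induct)
  case (add n f g)
  then show ?case using deg_lt.add[of n "\<lambda>u v. c * f u v" "\<lambda>u v. c * g u v"] by (simp add: distrib_left)
next
  case (mult1 n f)
  then show ?case using deg_lt.mult1[of n "\<lambda>u v. c * f u v"] by (simp add: ac_simps)
next
  case (mult2 n f)
  then show ?case using deg_lt.mult2[of n "\<lambda>u v. c * f u v"] by (simp add: ac_simps)
qed (auto intro: deg_lt.intros)

lemma deg_lt_diff: "deg_lt n f \<Longrightarrow> deg_lt n g \<Longrightarrow> deg_lt n (\<lambda>u v. f u v - g u v)"
  using deg_lt.add[of n f "\<lambda>u v. (-1) * g u v"] deg_lt_scale[of n g "-1"] by simp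

lemma deg_lt_shift: "deg_lt n f \<Longrightarrow> deg_lt n (\<lambda>u v. f (u + a) (v + b))"
proof (induction rule: deg_lt.induct)
  case (mult1 n f)
  have "deg_lt (Suc n) (\<lambda>u v. u * f (u + a) (v + b) + a * f (u + a) (v + b))"
    using mult1 by (intro deg_lt.add deg_lt.mult1 deg_lt_Suc[OF deg_lt_scale])
  then show ?case by (simp add: distrib_right)
next
  case (mult2 n f)
  have "deg_lt (Suc n) (\<lambda>u v. v * f (u + a) (v + b) + b * f (u + a) (v + b))"
    using mult2 by (intro deg_lt.add deg_lt.mult2 deg_lt_Suc[OF deg_lt_scale])
  then show ?case by (simp add: distrib_right)
qed (auto intro: deg_lt.intros)

text \<open>If \<open>f'\<close> is the shifted \<open>f\<close>, then
  \<open>u f - (u + a) f' = u (f - f') - a f'\<close>, so the induction loses one degree throughout.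
  The case \<open>n = 0\<close> is separate because \<open>Suc (n - 1)\<close> is then not
  \<open>n\<close>.\<close>

lemma deg_lt_difference: "deg_lt n f \<Longrightarrow> deg_lt (n - 1) (\<lambda>u v. f u v - f (u + a) (v + b))"
proof (induction rule: deg_lt.induct)
  case (zero n)
  then show ?case using deg_lt.zero by simp
next
  case (const n c)
  then show ?case using deg_lt.zero by simp
next
  case (add n f g)
  then show ?case using deg_lt.add[OF add.IH] by (simp add: algebra_simps)
next
  case (mult1 n f)
  show ?case
  proof (cases n)
    case 0
    then have "f = (\<lambda>u v. 0)" using mult1 deg_lt_0 by blast
    then show ?thesis using deg_lt.zero by simp
  next
    case (Suc k)
    have "deg_lt n (\<lambda>u v. u * (f u v - f (u + a) (v + b)) - a * f (u + a) (v + b))"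
      using mult1 Suc by (intro deg_lt_diff deg_lt_scale deg_lt_shift) (auto intro: deg_lt.mult1)
    then show ?thesis by (simp add: algebra_simps)
  qed
next
  case (mult2 n f)
  show ?case
  proof (cases n)
    case 0
    then have "f = (\<lambda>u v. 0)" using mult2 deg_lt_0 by blast
    then show ?thesis using deg_lt.zero by simp
  next
    case (Suc k)
    have "deg_lt n (\<lambda>u v. v * (f u v - f (u + a) (v + b)) - b * f (u + a) (v + b))"
      using mult2 Suc by (intro deg_lt_diff deg_lt_scale deg_lt_shift) (auto intro: deg_lt.mult2)
    then show ?thesis by (simp add: algebra_simps)
  qed
qed

lemma deg_lt_power1: "deg_lt n f \<Longrightarrow> deg_lt (n + k) (\<lambda>u v. u ^ k * f u v)"
proof (induction k)
  case (Suc k)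
  then show ?case using deg_lt.mult1[of "n + k" "\<lambda>u v. u ^ k * f u v"] by (simp add: mult.assoc)
qed auto

lemma deg_lt_power2: "deg_lt n f \<Longrightarrow> deg_lt (n + k) (\<lambda>u v. v ^ k * f u v)"
proof (induction k)
  case (Suc k)
  then show ?case using deg_lt.mult2[of "n + k" "\<lambda>u v. v ^ k * f u v"] by (simp add: mult.assoc)
qed auto

text \<open>For \<open>k = p - 1\<close> this polynomial is modulo \<open>p\<close> the indicator
  function of zero.\<close>

lemma deg_lt_delta: "deg_lt (Suc (2 * k)) (\<lambda>u v. (1 - u ^ k) * (1 - v ^ k))"
proof -
  have 1: "deg_lt (Suc (2 * k)) (\<lambda>u v. 1)" by (rule deg_lt.const)
  have 2: "deg_lt (Suc (2 * k)) (\<lambda>u v. u ^ k * 1)"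
    by (rule deg_lt_mono[OF deg_lt_power1[OF deg_lt.const[of 0]]]) auto
  have 3: "deg_lt (Suc (2 * k)) (\<lambda>u v. v ^ k * 1)"
    by (rule deg_lt_mono[OF deg_lt_power2[OF deg_lt.const[of 0]]]) auto
  have 4: "deg_lt (Suc (2 * k)) (\<lambda>u v. u ^ k * (v ^ k * 1))"
    by (rule deg_lt_mono[OF deg_lt_power1[OF deg_lt_power2[OF deg_lt.const[of 0]]]]) auto
  show ?thesis
    using deg_lt.add[OF deg_lt_diff[OF deg_lt_diff[OF 1 2] 3] 4] by (simp add: algebra_simps)
qed

section \<open>Products of difference operators\<close>

definition alt_shift :: "'i set \<Rightarrow> ('i \<Rightarrow> int) \<Rightarrow> ('i \<Rightarrow> int) \<Rightarrow> (int \<Rightarrow> int \<Rightarrow> int) \<Rightarrow> int \<Rightarrow> int \<Rightarrow> int" where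
  "alt_shift A x y f u v = (\<Sum>C\<in>Pow A. (-1) ^ card C * f (u + sum x C) (v + sum y C))"

lemma alt_shift_insert:
  assumes "finite A" "a \<notin> A"
  shows "alt_shift (insert a A) x y f u v = alt_shift A x y f u v - alt_shift A x y f (u + x a) (v + y a)"
proof -
  have inj: "inj_on (insert a) (Pow A)"
    using assms by (auto simp: inj_on_def)
  have disj: "Pow A \<inter> insert a ` Pow A = {}" using assms by auto
  have "alt_shift (insert a A) x y f u v = alt_shift A x y f u v +
      (\<Sum>C\<in>insert a ` Pow A. (-1) ^ card C * f (u + sum x C) (v + sum y C))"
    unfolding alt_shift_def Pow_insert using assms disj by (subst sum.union_disjoint) auto
  also have "(\<Sum>C\<in>insert a ` Pow A. (-1) ^ card C * f (u + sum x C) (v + sum y C)) =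
      (\<Sum>C\<in>Pow A. (-1) ^ card (insert a C) * f (u + sum x (insert a C)) (v + sum y (insert a C)))"
    by (subst sum.reindex[OF inj]) auto
  also have "\<dots> = (\<Sum>C\<in>Pow A. - ((-1) ^ card C * f (u + x a + sum x C) (v + y a + sum y C)))"
  proof (intro sum.cong refl)
    fix C assume "C \<in> Pow A"
    then have "finite C" "a \<notin> C" using assms finite_subset by auto
    then show "(-1) ^ card (insert a C) * f (u + sum x (insert a C)) (v + sum y (insert a C)) =
        - ((-1) ^ card C * f (u + x a + sum x C) (v + y a + sum y C))"
      by (simp add: add.assoc)
  qed
  also have "\<dots> = - alt_shift A x y f (u + x a) (v + y a)"
    by (simp add: alt_shift_def sum_negf)
  finally show ?thesis by simp
qed

text \<open>By \<open>alt_shift_insert\<close> each index of \<open>A\<close> acts as one difference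
  operator and costs one degree.\<close>

lemma deg_lt_alt_shift: "finite A \<Longrightarrow> deg_lt n f \<Longrightarrow> deg_lt (n - card A) (alt_shift A x y f)"
proof (induction rule: finite_induct)
  case empty
  have "alt_shift {} x y f = f" by (rule ext)+ (simp add: alt_shift_def)
  then show ?case using empty by simp
next
  case (insert a A)
  have "alt_shift (insert a A) x y f = (\<lambda>u v. alt_shift A x y f u v - alt_shift A x y f (u + x a) (v + y a))"
    by (rule ext)+ (simp add: alt_shift_insert insert)
  then show ?case
    using deg_lt_difference[OF insert.IH[OF insert.prems], of "x a" "y a"] insert by simp
qed

section \<open>The Croot-Lev-Pach splitting of a polynomial in \<open>u + u'\<close> and
  \<open>v + v'\<close>\<close>

definition monoms :: "nat \<Rightarrow> (nat \<times> nat) set" where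
  "monoms E = {(i, j). i + j < E}"

lemma monoms_Suc: "monoms (Suc E) = monoms E \<union> (\<lambda>i. (i, E - i)) ` {..E}"
  by (auto simp: monoms_def image_iff)

lemma finite_monoms: "finite (monoms E)"
proof (induction E)
  case 0
  then show ?case by (simp add: monoms_def)
qed (simp add: monoms_Suc)

lemma card_monoms: "2 * card (monoms E) = E * (E + 1)"
proof (induction E)
  case 0
  then show ?case by (simp add: monoms_def)
next
  case (Suc E)
  have "card (monoms (Suc E)) = card (monoms E) + card ((\<lambda>i. (i, E - i)) ` {..E})"
    unfolding monoms_Suc by (rule card_Un_disjoint[OF finite_monoms]) (auto simp: monoms_def)
  also have "card ((\<lambda>i. (i, E - i)) ` {..E}) = Suc E"
    by (subst card_image) (auto simp: inj_on_def)
  finally show ?case using Suc by (simp add: algebra_simps)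
qed

text \<open>A rank bound in disguise: as a matrix with rows \<open>(u, v)\<close> and columns
  \<open>(u', v')\<close>, \<open>F\<close> is a sum of \<open>2 * card (monoms E)\<close> products
  of a function of the row and a function of the column.\<close>

definition split_form :: "nat \<Rightarrow> (int \<Rightarrow> int \<Rightarrow> int \<Rightarrow> int \<Rightarrow> int) \<Rightarrow> bool" where
  "split_form E F \<longleftrightarrow> (\<exists>P Q. \<forall>u v u' v'. F u v u' v' =
     (\<Sum>(i, j)\<in>monoms E. u ^ i * v ^ j * P (i, j) u' v') + (\<Sum>(i, j)\<in>monoms E. Q (i, j) u v * (u' ^ i * v' ^ j)))"

lemma split_form_add:
  assumes "split_form E F" "split_form E G"
  shows "split_form E (\<lambda>u v u' v'. F u v u' v' + G u v u' v')"
proof -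
  obtain P Q where 1: "\<And>u v u' v'. F u v u' v' =
     (\<Sum>(i, j)\<in>monoms E. u ^ i * v ^ j * P (i, j) u' v') + (\<Sum>(i, j)\<in>monoms E. Q (i, j) u v * (u' ^ i * v' ^ j))"
    using assms(1) unfolding split_form_def by blast
  obtain P' Q' where 2: "\<And>u v u' v'. G u v u' v' =
     (\<Sum>(i, j)\<in>monoms E. u ^ i * v ^ j * P' (i, j) u' v') + (\<Sum>(i, j)\<in>monoms E. Q' (i, j) u v * (u' ^ i * v' ^ j))"
    using assms(2) unfolding split_form_def by blast
  show ?thesis
    unfolding split_form_def
    by (rule exI[of _ "\<lambda>a u v. P a u v + P' a u v"], rule exI[of _ "\<lambda>a u v. Q a u v + Q' a u v"])
      (simp add: 1 2 algebra_simps sum.distrib case_prod_beta)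
qed

lemma split_form_0: "split_form E (\<lambda>u v u' v'. 0)"
  unfolding split_form_def
  by (rule exI[of _ "\<lambda>_ _ _. 0"], rule exI[of _ "\<lambda>_ _ _. 0"]) simp

text \<open>The row part and the column part cannot both have degree at least \<open>E\<close>, so
  one of them is among the listed monomials.\<close>

lemma split_form_monomial:
  assumes "a + b + c + d < 2 * E"
  shows "split_form E (\<lambda>u v u' v'. k * (u ^ a * v ^ b * (u' ^ c * v' ^ d)))"
proof (cases "a + b < E")
  case True
  then have mem: "(a, b) \<in> monoms E" by (simp add: monoms_def)
  have *: "(\<Sum>(i, j)\<in>monoms E. u ^ i * v ^ j * (if (i, j) = (a, b) then z else 0)) = u ^ a * v ^ b * z"
    for u v z :: int
  proof -
    have "(\<Sum>(i, j)\<in>monoms E. u ^ i * v ^ j * (if (i, j) = (a, b) then z else 0)) =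
        (\<Sum>s\<in>monoms E. if s = (a, b) then u ^ a * v ^ b * z else 0)"
      by (intro sum.cong) (auto split: if_splits)
    then show ?thesis using mem by (simp add: finite_monoms)
  qed
  show ?thesis
    unfolding split_form_def
    by (rule exI[of _ "\<lambda>s u' v'. if s = (a, b) then k * (u' ^ c * v' ^ d) else 0"], rule exI[of _ "\<lambda>_ _ _. 0"])
      (simp only: *, simp)
next
  case False
  then have "c + d < E" using assms by linarith
  then have mem: "(c, d) \<in> monoms E" by (simp add: monoms_def)
  have *: "(\<Sum>(i, j)\<in>monoms E. (if (i, j) = (c, d) then z else 0) * (u ^ i * v ^ j)) = z * (u ^ c * v ^ d)"
    for u v z :: int
  proof -
    have "(\<Sum>(i, j)\<in>monoms E. (if (i, j) = (c, d) then z else 0) * (u ^ i * v ^ j)) =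
        (\<Sum>s\<in>monoms E. if s = (c, d) then z * (u ^ c * v ^ d) else 0)"
      by (intro sum.cong) (auto split: if_splits)
    then show ?thesis using mem by (simp add: finite_monoms)
  qed
  show ?thesis
    unfolding split_form_def
    by (rule exI[of _ "\<lambda>_ _ _. 0"], rule exI[of _ "\<lambda>s u v. if s = (c, d) then k * (u ^ a * v ^ b) else 0"])
      (simp only: *, simp)
qed

text \<open>The exponents \<open>a b c d\<close> absorb the factors \<open>u + u'\<close> and
  \<open>v + v'\<close> that the induction splits off, so that no power of a sum has to be
  expanded.\<close>

lemma deg_lt_split_aux:
  "deg_lt n f \<Longrightarrow> n + a + b + c + d \<le> 2 * E \<Longrightarrow>
    split_form E (\<lambda>u v u' v'. u ^ a * v ^ b * (u' ^ c * v' ^ d) * f (u + u') (v + v'))"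
proof (induction arbitrary: a b c d rule: deg_lt.induct)
  case (zero n)
  then show ?case using split_form_0 by simp
next
  case (const n k)
  then show ?case using split_form_monomial[of a b c d E k] by (simp add: mult.commute)
next
  case (add n f g)
  then show ?case using split_form_add[OF add.IH(1)[of a b c d] add.IH(2)[of a b c d]]
    by (simp add: distrib_left)
next
  case (mult1 n f)
  then show ?case using split_form_add[OF mult1.IH[of "Suc a" b c d] mult1.IH[of a b "Suc c" d]]
    by (simp add: algebra_simps)
next
  case (mult2 n f)
  then show ?case using split_form_add[OF mult2.IH[of a "Suc b" c d] mult2.IH[of a b c "Suc d"]]
    by (simp add: algebra_simps)
qed

lemma deg_lt_split: "deg_lt (2 * E) f \<Longrightarrow> split_form E (\<lambda>u v u' v'. f (u + u') (v + v'))"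
  using deg_lt_split_aux[of "2 * E" f 0 0 0 0 E] by simp

text \<open>For prime \<open>p\<close> this says that an invertible diagonal matrix cannot have rank
  below its size. Counting replaces linear algebra: if \<open>R\<close> were smaller, two of the
  \<open>p ^ card W\<close> coefficient vectors would give the same combinations of all
  \<open>U l\<close> modulo \<open>p\<close>, and their difference would annihilate every column of
  \<open>D\<close>.\<close>

lemma rank_pigeonhole:
  fixes D :: "'w \<Rightarrow> 'w \<Rightarrow> int"
  assumes "finite W" "finite R" "p > 1"
    and off: "\<And>X Y. X \<in> W \<Longrightarrow> Y \<in> W \<Longrightarrow> X \<noteq> Y \<Longrightarrow> int p dvd D X Y"
    and diag: "\<And>X. X \<in> W \<Longrightarrow> \<exists>s. [D X X = (-1) ^ s] (mod int p)"
    and dec: "\<And>X Y. X \<in> W \<Longrightarrow> Y \<in> W \<Longrightarrow> D X Y = (\<Sum>l\<in>R. U l X * V l Y)"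
  shows "card W \<le> card R"
proof (rule ccontr)
  assume "\<not> card W \<le> card R"
  then have less: "p ^ card R < p ^ card W" using assms(3) by simp
  let ?A = "W \<rightarrow>\<^sub>E {0..<int p}" and ?B = "R \<rightarrow>\<^sub>E {0..<int p}"
  let ?F = "\<lambda>c. \<lambda>l\<in>R. (\<Sum>X\<in>W. c X * U l X) mod int p"
  have "card ?B < card ?A"
    using less assms by (simp add: card_PiE)
  moreover have "?F ` ?A \<subseteq> ?B" using assms(3) by (auto simp: restrict_def PiE_def extensional_def)
  moreover have "finite ?B" using assms by (intro finite_PiE) auto
  ultimately have "\<not> inj_on ?F ?A"
    using card_inj_on_le[of ?F ?A ?B] by linarith
  then obtain c c' where c: "c \<in> ?A" "c' \<in> ?A" "c \<noteq> c'" "?F c = ?F c'"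
    by (auto simp: inj_on_def)
  then obtain Y where Y: "Y \<in> W" "c Y \<noteq> c' Y"
    using PiE_ext[OF c(1,2)] c(3) by blast
  let ?d = "\<lambda>X. c X - c' X"
  have l: "int p dvd (\<Sum>X\<in>W. ?d X * U l X)" if "l \<in> R" for l
  proof -
    have "(\<Sum>X\<in>W. c X * U l X) mod int p = (\<Sum>X\<in>W. c' X * U l X) mod int p"
      using fun_cong[OF c(4), of l] that by simp
    then show ?thesis
      by (simp add: mod_eq_dvd_iff left_diff_distrib sum_subtractf)
  qed
  have "(\<Sum>X\<in>W. ?d X * D X Y) = (\<Sum>X\<in>W. \<Sum>l\<in>R. ?d X * U l X * V l Y)"
    using Y by (intro sum.cong) (auto simp: dec sum_distrib_left ac_simps)
  also have "\<dots> = (\<Sum>l\<in>R. (\<Sum>X\<in>W. ?d X * U l X) * V l Y)"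
    by (subst sum.swap) (simp add: sum_distrib_right)
  finally have "int p dvd (\<Sum>X\<in>W. ?d X * D X Y)"
    using dvd_sum[OF dvd_mult2[OF l]] by simp
  \<comment> \<open>In column \<open>Y\<close> only the diagonal entry survives, a unit modulo
    \<open>p\<close>, so \<open>c\<close> and \<open>c'\<close> would agree at \<open>Y\<close>
    after all.\<close>
  moreover have "(\<Sum>X\<in>W. ?d X * D X Y) = ?d Y * D Y Y + (\<Sum>X\<in>W-{Y}. ?d X * D X Y)"
    using Y assms(1) by (subst sum.remove[of W Y]) auto
  moreover have "int p dvd (\<Sum>X\<in>W-{Y}. ?d X * D X Y)"
    using off Y by (intro dvd_sum dvd_mult) auto
  ultimately have *: "int p dvd ?d Y * D Y Y"
    by (simp add: dvd_add_left_iff)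
  obtain s where "[D Y Y = (-1) ^ s] (mod int p)" using diag Y by blast
  then have "[?d Y * D Y Y = ?d Y * (-1) ^ s] (mod int p)" by (rule cong_scalar_left)
  then have "int p dvd ?d Y * (-1) ^ s" using * cong_dvd_iff by blast
  then have "int p dvd ?d Y"
    by (cases "even s") (auto simp: dvd_diff_commute)
  moreover have "c Y \<in> {0..<int p}" "c' Y \<in> {0..<int p}" using c Y by auto
  ultimately show False using Y(2)
    by (metis atLeastLessThan_iff mod_eq_dvd_iff mod_pos_pos_trivial)
qed

section \<open>The indicator polynomial of zero modulo a prime\<close>

lemma fermat_int:
  assumes "prime (p::nat)" "\<not> int p dvd a"
  shows "[a ^ (p - 1) = 1] (mod int p)"
proof -
  have p: "p > 0" using assms(1) prime_gt_0_nat by blast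
  define b where "b = nat (a mod int p)"
  have b: "[a = int b] (mod int p)"
    using p by (simp add: b_def cong_def)
  then have "\<not> p dvd b"
    using assms(2) by (metis cong_dvd_iff int_dvd_int_iff cong_0_iff cong_sym cong_trans)
  then have "[b ^ (p - 1) = 1] (mod p)"
    using assms(1) fermat_theorem by blast
  then have "[int b ^ (p - 1) = 1] (mod int p)"
    by (metis cong_int_iff of_nat_1 of_nat_power)
  then show ?thesis
    using cong_pow[OF b] cong_trans by blast
qed

lemma delta_cong:
  assumes "prime (p::nat)"
  shows "[(1 - u ^ (p - 1)) * (1 - v ^ (p - 1)) = (if zmod p p u v then 1 else 0)] (mod int p)"
proof -
  have gt: "p > 1" using assms prime_gt_1_nat by blast
  have one: "[1 - w ^ (p - 1) = (if int p dvd w then 1 else 0)] (mod int p)" for w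
  proof (cases "int p dvd w")
    case True
    then have "int p dvd w ^ (p - 1)" using gt by (simp add: dvd_power_same dvd_trans[OF _ dvd_power])
    then show ?thesis using True by (simp add: cong_iff_dvd_diff)
  next
    case False
    then show ?thesis using fermat_int[OF assms False] cong_diff[of 1 1 "int p"] by fastforce
  qed
  show ?thesis
    using cong_mult[OF one[of u] one[of v]] by (auto simp: zmod_def split: if_splits)
qed

text \<open>The rank is at most \<open>(m - 1) m\<close>, the size of the matrix is
  \<open>2 ^ m\<close>; with truncated subtraction the comparison includes
  \<open>m = 0\<close>.\<close>

lemma pred_mult_less_power2: "(m - 1) * m < (2::nat) ^ m"
proof -
  have "k * (k + 1) < (2::nat) ^ (k + 1)" for k
  proof (induction k)
    case (Suc k)
    show ?case
    proof (cases "k < 3")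
      case True
      then have "k = 0 \<or> k = 1 \<or> k = 2" by auto
      then show ?thesis by auto
    next
      case False
      then have "2 * (k + 1) \<le> k * (k + 1)" by (intro mult_right_mono) auto
      then show ?thesis using Suc by (simp add: algebra_simps)
    qed
  qed auto
  from this[of "m - 1"] show ?thesis by (cases m) auto
qed

text \<open>
  Choose distinct elements \<open>g\<close> and \<open>h\<close> of each of the \<open>m\<close> irreducible factors, and apply the difference
  operators of all other terms to the indicator function of \<open>0\<close>. The values of the result at the points
  \<open>g\<^sub>X + h\<^sub>Y\<close>, where \<open>X\<close> and \<open>Y\<close> are sets of factors, form modulo \<open>p\<close> a diagonal matrix of size
  \<open>2\<^sup>m\<close> with entries \<open>\<plusminus>1\<close>, while its degree allows only rank \<open>m (m - 1)\<close>.
\<close>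

lemma ufam_elementary_rank2_total:
  fixes I :: "'i set"
  assumes p: "prime p" and ufam: "ufam p p I x y" and tot: "zsum p p x y I"
    and nz: "\<And>i. i \<in> I \<Longrightarrow> \<not> zmod p p (x i) (y i)"
  shows "card I \<le> 2 * p"
proof (rule ccontr)
  assume "\<not> card I \<le> 2 * p"
  then have big: "card I \<ge> 2 * p + 1" by simp
  have p1: "p > 1" using p prime_gt_1_nat by blast
  have fin: "finite I" using ufam by (rule ufam_finite)
  let ?z = "\<lambda>T. zsum p p x y T"
  \<comment> \<open>The irreducible factor through \<open>i\<close>: a zero-sum set of least size
    containing \<open>i\<close> lies in every other one, because their intersection is again a
    candidate.\<close>
  have "\<forall>i\<in>I. \<exists>T. T \<subseteq> I \<and> ?z T \<and> i \<in> T \<and> (\<forall>U. U \<subseteq> I \<longrightarrow> ?z U \<longrightarrow> i \<in> U \<longrightarrow> T \<subseteq> U)"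
  proof
    fix i assume i: "i \<in> I"
    obtain T where T: "T \<subseteq> I \<and> ?z T \<and> i \<in> T" and
      min: "\<And>U. U \<subseteq> I \<and> ?z U \<and> i \<in> U \<Longrightarrow> card T \<le> card U"
      using ex_has_least_nat[of "\<lambda>T. T \<subseteq> I \<and> ?z T \<and> i \<in> T" I card] tot i by auto
    have "T \<subseteq> U" if U: "U \<subseteq> I" "?z U" "i \<in> U" for U
    proof -
      have "card T \<le> card (T \<inter> U)"
        using T U ufam_Int[OF ufam, of T U] by (intro min) auto
      moreover have "finite T" using T fin finite_subset by blast
      ultimately have "T \<inter> U = T" by (intro card_seteq) auto
      then show ?thesis by auto
    qed
    then show "\<exists>T. T \<subseteq> I \<and> ?z T \<and> i \<in> T \<and> (\<forall>U. U \<subseteq> I \<longrightarrow> ?z U \<longrightarrow> i \<in> U \<longrightarrow> T \<subseteq> U)"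
      using T by blast
  qed
  then obtain atm where at0: "\<forall>i\<in>I. atm i \<subseteq> I \<and> ?z (atm i) \<and> i \<in> atm i \<and>
      (\<forall>U. U \<subseteq> I \<longrightarrow> ?z U \<longrightarrow> i \<in> U \<longrightarrow> atm i \<subseteq> U)"
    by (rule bchoice[THEN exE])
  have at: "atm i \<subseteq> I" "?z (atm i)" "i \<in> atm i" if "i \<in> I" for i
    using at0 that by auto
  have at_min: "atm i \<subseteq> U" if "i \<in> I" "U \<subseteq> I" "?z U" "i \<in> U" for i U
    using at0 that by blast
  \<comment> \<open>The factors partition \<open>I\<close>. If \<open>i\<close> were not in
    \<open>atm j\<close>, then \<open>atm i - atm j\<close> would be a smaller zero-sum set through
    \<open>i\<close>.\<close>
  have at_eq: "atm j = atm i" if "i \<in> I" "j \<in> atm i" for i j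
  proof -
    have j: "j \<in> I" using at that by auto
    have sub: "atm j \<subseteq> atm i" using at_min[OF j at(1,2)] that by auto
    have "i \<in> atm j"
    proof (rule ccontr)
      assume "i \<notin> atm j"
      moreover have "?z (atm i - atm j)" using ufam_Diff[OF ufam at(1) at(1) at(2) at(2)] that j by auto
      moreover have "atm i - atm j \<subseteq> I" using at(1)[OF that(1)] by auto
      ultimately have "atm i \<subseteq> atm i - atm j" using at_min[of i "atm i - atm j"] at(3) that by auto
      then show False using that(2) at(3)[OF j] by auto
    qed
    then show ?thesis using sub at_min[OF that(1) at(1,2)[OF j]] by auto
  qed
  define AA where "AA = atm ` I"
  have AA: "\<alpha> \<subseteq> I" "?z \<alpha>" "\<alpha> \<noteq> {}" if "\<alpha> \<in> AA" for \<alpha>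
    using that at unfolding AA_def by blast+
  have AA_min: "\<alpha> \<subseteq> U" if "\<alpha> \<in> AA" "i \<in> \<alpha>" "U \<subseteq> I" "?z U" "i \<in> U" for \<alpha> i U
  proof -
    have "i \<in> I" using that AA(1) by auto
    moreover have "atm i = \<alpha>" using that(1,2) at_eq by (auto simp: AA_def)
    ultimately show ?thesis using at_min that by auto
  qed
  have AA_eq: "\<alpha> = \<beta>" if "\<alpha> \<in> AA" "\<beta> \<in> AA" "i \<in> \<alpha>" "i \<in> \<beta>" for \<alpha> \<beta> i
    using that at_eq unfolding AA_def by blast
  have finAA: "finite AA" using fin by (simp add: AA_def)
  have finA: "finite \<alpha>" if "\<alpha> \<in> AA" for \<alpha> using AA(1)[OF that] fin finite_subset by blast
  \<comment> \<open>A factor with a single element would be a zero term.\<close>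
  have "\<forall>\<alpha>\<in>AA. \<exists>gh. fst gh \<in> \<alpha> \<and> snd gh \<in> \<alpha> \<and> fst gh \<noteq> snd gh"
  proof
    fix \<alpha> assume a: "\<alpha> \<in> AA"
    obtain i where i: "i \<in> \<alpha>" using AA(3)[OF a] by auto
    have "\<alpha> \<noteq> {i}" using AA(1,2)[OF a] nz i by auto
    then obtain j where "j \<in> \<alpha>" "j \<noteq> i" using i by auto
    then show "\<exists>gh. fst gh \<in> \<alpha> \<and> snd gh \<in> \<alpha> \<and> fst gh \<noteq> snd gh"
      using i by (intro exI[of _ "(i, j)"]) auto
  qed
  then obtain gh where gh: "\<forall>\<alpha>\<in>AA. fst (gh \<alpha>) \<in> \<alpha> \<and> snd (gh \<alpha>) \<in> \<alpha> \<and> fst (gh \<alpha>) \<noteq> snd (gh \<alpha>)"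
    by (rule bchoice[THEN exE])
  define g where "g = fst \<circ> gh"
  define h where "h = snd \<circ> gh"
  have gA: "g \<alpha> \<in> \<alpha>" and hA: "h \<alpha> \<in> \<alpha>" and ghne: "g \<alpha> \<noteq> h \<alpha>" if "\<alpha> \<in> AA" for \<alpha>
    using gh that by (auto simp: g_def h_def)
  have injg: "inj_on g AA"
  proof (rule inj_onI)
    fix \<alpha> \<beta> assume "\<alpha> \<in> AA" "\<beta> \<in> AA" "g \<alpha> = g \<beta>"
    then show "\<alpha> = \<beta>" using AA_eq[of \<alpha> \<beta> "g \<alpha>"] gA[of \<alpha>] gA[of \<beta>] by auto
  qed
  have injh: "inj_on h AA"
  proof (rule inj_onI)
    fix \<alpha> \<beta> assume "\<alpha> \<in> AA" "\<beta> \<in> AA" "h \<alpha> = h \<beta>"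
    then show "\<alpha> = \<beta>" using AA_eq[of \<alpha> \<beta> "h \<alpha>"] hA[of \<alpha>] hA[of \<beta>] by auto
  qed
  have gh_ne: "g \<alpha> \<noteq> h \<beta>" if "\<alpha> \<in> AA" "\<beta> \<in> AA" for \<alpha> \<beta>
    using AA_eq[of \<alpha> \<beta> "g \<alpha>"] gA[of \<alpha>] hA[of \<beta>] ghne[of \<alpha>] that by auto
  then have disj: "g ` AA \<inter> h ` AA = {}" by blast
  define A where "A = I - (g ` AA \<union> h ` AA)"
  have ghI: "g ` AA \<subseteq> I" "h ` AA \<subseteq> I" using gA hA AA(1) by auto
  define m where "m = card AA"
  have "card (g ` AA \<union> h ` AA) = 2 * m"
    using finAA disj injg injh by (simp add: card_Un_disjoint card_image m_def)
  moreover have "card (g ` AA \<union> h ` AA) \<le> card I" "finite (g ` AA \<union> h ` AA)"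
    using fin ghI finAA by (auto intro!: card_mono)
  ultimately have cardA: "card I = card A + 2 * m"
    unfolding A_def using ghI by (subst card_Diff_subset) auto
  have finAset: "finite A" using fin by (simp add: A_def)
  define f where "f = (\<lambda>u v. (1 - u ^ (p - 1)) * (1 - v ^ (p - 1) :: int))"
  define c where "c = alt_shift A x y f"
  have "deg_lt (Suc (2 * (p - 1)) - card A) c"
    unfolding c_def f_def by (intro deg_lt_alt_shift finAset deg_lt_delta)
  \<comment> \<open>Since \<open>A\<close> has at least \<open>2 p + 1 - 2 m\<close> elements, the
    strict bound \<open>2 p - 1\<close> drops to at most \<open>2 m - 2\<close>. This is the point
    at which more than \<open>2 p\<close> terms are used.\<close>
  then have "deg_lt (2 * (m - 1)) c"
    by (rule deg_lt_mono) (use big cardA p1 in linarith)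
  from deg_lt_split[OF this] obtain P Q where PQ: "\<And>u v u' v'. c (u + u') (v + v') =
     (\<Sum>(i, j)\<in>monoms (m - 1). u ^ i * v ^ j * P (i, j) u' v') +
     (\<Sum>(i, j)\<in>monoms (m - 1). Q (i, j) u v * (u' ^ i * v' ^ j))"
    unfolding split_form_def by blast
  define D where "D X Y = c (sum x (g ` X) + sum x (h ` Y)) (sum y (g ` X) + sum y (h ` Y))" for X Y
  \<comment> \<open>A zero-sum set contains each factor entirely or misses it. A factor met by the
    set therefore contributes both of its chosen elements, which forces \<open>X = Y\<close>, and
    \<open>C\<close> has to supply the rest of these factors.\<close>
  have key: "?z (C \<union> (g ` X \<union> h ` Y)) \<longleftrightarrow> X = Y \<and> C = \<Union>X - (g ` X \<union> h ` X)"
    if C: "C \<subseteq> A" and X: "X \<subseteq> AA" and Y: "Y \<subseteq> AA" for C X Y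
  proof
    let ?T = "C \<union> (g ` X \<union> h ` Y)"
    assume zT: "?z ?T"
    have TI: "?T \<subseteq> I"
    proof -
      have "g ` X \<subseteq> I" using image_mono[OF X] ghI(1) by (rule order_trans)
      moreover have "h ` Y \<subseteq> I" using image_mono[OF Y] ghI(2) by (rule order_trans)
      ultimately show ?thesis using C by (simp add: A_def le_infI1 subset_iff)
    qed
    have sub: "\<alpha> \<subseteq> ?T" if "\<alpha> \<in> AA" "i \<in> \<alpha>" "i \<in> ?T" for \<alpha> i
      using AA_min[OF that(1,2) TI zT that(3)] .
    have gT: "\<alpha> \<in> X" if "\<alpha> \<in> AA" "g \<alpha> \<in> ?T" for \<alpha>
      using that C X Y gh_ne[OF that(1)] inj_onD[OF injg _ that(1)] by (auto simp: A_def)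
    have hT: "\<alpha> \<in> Y" if "\<alpha> \<in> AA" "h \<alpha> \<in> ?T" for \<alpha>
      using that C X Y gh_ne[OF _ that(1)] inj_onD[OF injh _ that(1)] by (force simp: A_def)
    have XY: "X = Y"
    proof
      show "X \<subseteq> Y"
      proof
        fix \<alpha> assume a: "\<alpha> \<in> X"
        then have "\<alpha> \<subseteq> ?T" using sub[of \<alpha> "g \<alpha>"] gA X by auto
        then show "\<alpha> \<in> Y" using hT[of \<alpha>] hA[of \<alpha>] a X by auto
      qed
      show "Y \<subseteq> X"
      proof
        fix \<alpha> assume a: "\<alpha> \<in> Y"
        then have "\<alpha> \<subseteq> ?T" using sub[of \<alpha> "h \<alpha>"] hA Y by auto
        then show "\<alpha> \<in> X" using gT[of \<alpha>] gA[of \<alpha>] a Y by auto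
      qed
    qed
    have "i \<in> \<Union>X" if "i \<in> C" for i
    proof -
      have "i \<in> I" using that C by (auto simp: A_def)
      then have "atm i \<in> AA" "i \<in> atm i" using at by (auto simp: AA_def)
      moreover from this have "atm i \<subseteq> ?T" using sub that by blast
      ultimately have "atm i \<in> X" using gT gA by blast
      then show ?thesis using \<open>i \<in> atm i\<close> by auto
    qed
    moreover have "i \<in> C" if "i \<in> \<Union>X - (g ` X \<union> h ` X)" for i
    proof -
      obtain \<alpha> where "\<alpha> \<in> X" "i \<in> \<alpha>" using \<open>i \<in> \<Union>X - (g ` X \<union> h ` X)\<close> by auto
      then have "\<alpha> \<subseteq> ?T" using sub[of \<alpha> "g \<alpha>"] gA X by auto
      then show ?thesis using that \<open>i \<in> \<alpha>\<close> XY by auto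
    qed
    moreover have "C \<inter> (g ` X \<union> h ` X) = {}" using C X by (auto simp: A_def)
    ultimately show "X = Y \<and> C = \<Union>X - (g ` X \<union> h ` X)" using XY by blast
  next
    assume "X = Y \<and> C = \<Union>X - (g ` X \<union> h ` X)"
    then have "C \<union> (g ` X \<union> h ` Y) = \<Union>X"
      using gA hA X by auto
    moreover have "\<alpha> \<inter> \<beta> = {}" if "\<alpha> \<in> X" "\<beta> \<in> X" "\<alpha> \<noteq> \<beta>" for \<alpha> \<beta>
      using AA_eq[of \<alpha> \<beta>] that X by blast
    then have "sum w (\<Union>X) = (\<Sum>\<alpha>\<in>X. sum w \<alpha>)" for w :: "'i \<Rightarrow> int"
      using X finA by (subst sum.Union_disjoint) auto
    moreover have "zmod p p (\<Sum>\<alpha>\<in>X. sum x \<alpha>) (\<Sum>\<alpha>\<in>X. sum y \<alpha>)"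
      unfolding zmod_def using dvd_sum[of X "int p" "sum x"] dvd_sum[of X "int p" "sum y"] AA(2) X
      by (auto simp: zmod_def)
    ultimately show "?z (C \<union> (g ` X \<union> h ` Y))" by simp
  qed
  have Dval: "[D X Y = (\<Sum>C\<in>Pow A. (-1) ^ card C * (if ?z (C \<union> (g ` X \<union> h ` Y)) then 1 else 0))] (mod int p)"
    if X: "X \<subseteq> AA" and Y: "Y \<subseteq> AA" for X Y
    unfolding D_def c_def alt_shift_def
  proof (intro cong_sum cong_scalar_left)
    fix C assume "C \<in> Pow A"
    then have C: "C \<subseteq> A" by simp
    have fins: "finite C" "finite (g ` X)" "finite (h ` Y)"
      using C finAset X Y finAA finite_subset by blast+
    have d: "g ` X \<inter> h ` Y = {}" "C \<inter> (g ` X \<union> h ` Y) = {}"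
    proof -
      have sub: "g ` X \<subseteq> g ` AA" "h ` Y \<subseteq> h ` AA" by (rule image_mono[OF X], rule image_mono[OF Y])
      then show "g ` X \<inter> h ` Y = {}" using disj by (meson disjoint_iff subsetD)
      have "C \<inter> (g ` AA \<union> h ` AA) = {}" using C by (auto simp: A_def)
      then show "C \<inter> (g ` X \<union> h ` Y) = {}" using sub by (meson Un_mono disjoint_iff subsetD)
    qed
    have "sum w (g ` X) + sum w (h ` Y) + sum w C = sum w (C \<union> (g ` X \<union> h ` Y))" for w :: "'i \<Rightarrow> int"
      using d fins by (simp add: sum.union_disjoint)
    then show "[f (sum x (g ` X) + sum x (h ` Y) + sum x C) (sum y (g ` X) + sum y (h ` Y) + sum y C) =
        (if ?z (C \<union> (g ` X \<union> h ` Y)) then 1 else 0)] (mod int p)"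
      using delta_cong[OF p] by (simp add: f_def)
  qed
  \<comment> \<open>One index for each monomial in the row variables and one for each in the column
    variables, \<open>(m - 1) m\<close> in total.\<close>
  let ?R = "monoms (m - 1) <+> monoms (m - 1)"
  let ?U = "\<lambda>l X. case l of Inl s \<Rightarrow> sum x (g ` X) ^ fst s * sum y (g ` X) ^ snd s
      | Inr s \<Rightarrow> Q s (sum x (g ` X)) (sum y (g ` X))"
  let ?V = "\<lambda>l Y. case l of Inl s \<Rightarrow> P s (sum x (h ` Y)) (sum y (h ` Y))
      | Inr s \<Rightarrow> sum x (h ` Y) ^ fst s * sum y (h ` Y) ^ snd s"
  have "card (Pow AA) \<le> card ?R"
  proof (rule rank_pigeonhole[where D = D and U = ?U and V = ?V])
    show "finite (Pow AA)" "finite ?R" using finAA finite_monoms by auto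
    show "p > 1" by (rule p1)
    show "int p dvd D X Y" if "X \<in> Pow AA" "Y \<in> Pow AA" "X \<noteq> Y" for X Y
    proof -
      have "(\<Sum>C\<in>Pow A. (-1) ^ card C * (if ?z (C \<union> (g ` X \<union> h ` Y)) then 1 else (0::int))) = 0"
        using that key by (intro sum.neutral) auto
      then show ?thesis using Dval[of X Y] that by (simp add: cong_0_iff)
    qed
    show "\<exists>s. [D X X = (-1) ^ s] (mod int p)" if "X \<in> Pow AA" for X
    proof -
      let ?C = "\<Union>X - (g ` X \<union> h ` X)"
      have XA: "X \<subseteq> AA" using that by auto
      have sub: "?C \<subseteq> A"
      proof
        fix i assume i: "i \<in> ?C"
        then obtain \<alpha> where a: "\<alpha> \<in> X" "i \<in> \<alpha>" by auto
        have "i \<noteq> g \<beta>" "i \<noteq> h \<beta>" if "\<beta> \<in> AA" for \<beta>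
          using AA_eq[of \<alpha> \<beta> i] gA[OF that] hA[OF that] a XA that i by auto
        moreover have "i \<in> I" using subsetD[OF AA(1)[OF subsetD[OF XA a(1)]] a(2)] .
        ultimately show "i \<in> A" by (auto simp: A_def)
      qed
      have "(\<Sum>C\<in>Pow A. (-1) ^ card C * (if ?z (C \<union> (g ` X \<union> h ` X)) then 1 else (0::int))) =
          (\<Sum>C\<in>Pow A. if C = ?C then (-1) ^ card C else 0)"
        using key[OF _ XA XA] by (intro sum.cong) auto
      also have "\<dots> = (-1) ^ card ?C" using sub finAset by simp
      finally show ?thesis using Dval[OF XA XA] by metis
    qed
    show "D X Y = (\<Sum>l\<in>?R. ?U l X * ?V l Y)" for X Y
      unfolding D_def PQ by (subst sum.Plus) (auto simp: finite_monoms case_prod_beta)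
  qed
  moreover have "card ?R = (m - 1) * m"
    using card_monoms[of "m - 1"] by (cases m) (auto simp: card_Plus finite_monoms)
  ultimately show False
    using pred_mult_less_power2[of m] finAA by (simp add: card_Pow m_def)
qed

text \<open>If the total is nonzero, then minus the total is a further nonzero term and completes
  the family to total zero.\<close>

lemma ufam_elementary_rank2:
  fixes I :: "nat set"
  assumes p: "prime p" and ufam: "ufam p p I x y" and nz: "\<And>i. i \<in> I \<Longrightarrow> \<not> zmod p p (x i) (y i)"
  shows "card I + (if zsum p p x y I then 0 else 1) \<le> 2 * p"
proof (cases "zsum p p x y I")
  case True
  then show ?thesis using ufam_elementary_rank2_total[OF p ufam True nz] by simp
next
  case False
  have fin: "finite I" using ufam by (rule ufam_finite)
  obtain e where e: "e \<notin> I" using ex_new_if_finite[OF infinite_UNIV_nat fin] by blast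
  have out: "sum (h(e := c)) I = sum h I" for c and h :: "nat \<Rightarrow> int"
    using e by (intro sum.cong) auto
  have "card (insert e I) \<le> 2 * p"
  proof (rule ufam_elementary_rank2_total[OF p ufam_complete[OF ufam e]])
    show "zsum p p (x(e := - sum x I)) (y(e := - sum y I)) (insert e I)"
      using e fin by (simp add: out del: fun_upd_apply) simp
    show "\<not> zmod p p ((x(e := - sum x I)) i) ((y(e := - sum y I)) i)" if "i \<in> insert e I" for i
      using that nz False e by auto
  qed
  then show ?thesis using False e fin by simp
qed

text \<open>Adjoining \<open>p\<close> copies of \<open>(0, 1)\<close> reduces rank one to rank two.\<close>

lemma ufam_elementary_rank1:
  fixes I :: "nat set"
  assumes p: "prime p" and ufam: "ufam p 1 I x y" and nz: "\<And>i. i \<in> I \<Longrightarrow> \<not> zmod p 1 (x i) (y i)"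
  shows "card I + (if zsum p 1 x y I then 0 else 1) \<le> p"
proof -
  have fin: "finite I" using ufam by (rule ufam_finite)
  have p1: "p > 1" using p prime_gt_1_nat by blast
  obtain N where N: "\<forall>i\<in>I. i < N" using fin unfolding finite_nat_set_iff_bounded ..
  define J where "J = {N..<N + p}"
  have J: "finite J" "card J = p" "J \<inter> I = {}" using N by (auto simp: J_def)
  define x' where "x' i = (if i \<in> J then 0 else x i)" for i
  define y' where "y' i = (if i \<in> J then 1 else 0 :: int)" for i
  have sums: "sum x' T = sum x (T - J)" "sum y' T = int (card (T \<inter> J))" if "T \<subseteq> I \<union> J" for T
  proof -
    have finT: "finite T" using that fin J finite_subset by blast
    show "sum x' T = sum x (T - J)"
      unfolding x'_def using finT by (intro sum.mono_neutral_cong_right) auto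
    have "sum y' T = (\<Sum>i\<in>T \<inter> J. 1)"
      unfolding y'_def using finT by (intro sum.mono_neutral_cong_right) auto
    then show "sum y' T = int (card (T \<inter> J))" by simp
  qed
  \<comment> \<open>The second coordinate counts the terms from \<open>J\<close> modulo
    \<open>p\<close>. As there are exactly \<open>p\<close> of them, a zero-sum set takes none or
    all.\<close>
  have zmod_iff: "zsum p p x' y' T \<longleftrightarrow>
      zsum p 1 x y (T - J) \<and> (T \<inter> J = {} \<or> J \<subseteq> T)" if "T \<subseteq> I \<union> J" for T
  proof -
    have "card (T \<inter> J) \<le> p" using card_mono[of J "T \<inter> J"] J by auto
    then have "p dvd card (T \<inter> J) \<longleftrightarrow> card (T \<inter> J) = 0 \<or> card (T \<inter> J) = p"
      using p1 by (auto dest: dvd_imp_le)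
    also have "card (T \<inter> J) = p \<longleftrightarrow> J \<subseteq> T"
      using J card_subset_eq[of J "T \<inter> J"] by (auto simp: Int_absorb1)
    finally show ?thesis
      using J by (simp add: zmod_def sums[OF that])
  qed
  have cl': "ufam p p (I \<union> J) x' y'"
  proof (rule ufamI)
    show "finite (I \<union> J)" using fin J by simp
    fix S T assume a: "S \<subseteq> I \<union> J" "T \<subseteq> I \<union> J" "zsum p p x' y' S" "zsum p p x' y' T"
    have "zsum p 1 x y ((S - J) \<inter> (T - J))"
      using a by (intro ufam_Int[OF ufam]) (auto simp: zmod_iff)
    moreover have "(S - J) \<inter> (T - J) = S \<inter> T - J" by auto
    moreover have "S \<inter> T \<subseteq> I \<union> J" using a by auto
    ultimately show "zsum p p x' y' (S \<inter> T)"
      using a by (auto simp: zmod_iff)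
  qed
  have "card (I \<union> J) + (if zsum p p x' y' (I \<union> J) then 0 else 1) \<le> 2 * p"
  proof (rule ufam_elementary_rank2[OF p cl'])
    fix i assume i: "i \<in> I \<union> J"
    show "\<not> zmod p p (x' i) (y' i)"
    proof (cases "i \<in> J")
      case True
      then show ?thesis using p1 by (simp add: zmod_def y'_def)
    next
      case False
      then show ?thesis using i nz[of i] by (simp add: zmod_def x'_def)
    qed
  qed
  moreover have "card (I \<union> J) = card I + p" using J fin by (subst card_Un_disjoint) auto
  moreover have "I \<union> J - J = I" using J by auto
  ultimately show ?thesis by (auto simp: zmod_iff split: if_splits)
qed

section \<open>Merging and torsion quotients\<close>

definition ord_mod :: "nat \<Rightarrow> nat \<Rightarrow> int \<Rightarrow> int \<Rightarrow> nat" where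
  "ord_mod n q a b = lcm (n div nat (gcd (int n) a)) (q div nat (gcd (int q) b))"

lemma div_gcd_dvd_iff:
  assumes "n > 0"
  shows "(n div nat (gcd (int n) a)) dvd k \<longleftrightarrow> int n dvd int k * a"
proof -
  define g where "g = gcd (int n) a"
  have g: "g > 0" using assms by (simp add: g_def)
  obtain n' a' where na: "int n = n' * g" "a = a' * g" "coprime n' a'"
    using gcd_coprime_exists[of "int n" a] g unfolding g_def by auto
  have "int (n div nat g) = n'"
    using g na by (simp add: zdiv_int)
  then have "(n div nat g) dvd k \<longleftrightarrow> n' dvd int k" by (metis int_dvd_int_iff)
  also have "\<dots> \<longleftrightarrow> n' dvd int k * a'"
    using na(3) by (simp add: coprime_dvd_mult_left_iff)
  also have "\<dots> \<longleftrightarrow> int n dvd int k * a"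
    using g by (simp add: na(1,2) mult.assoc[symmetric])
  finally show ?thesis by (simp add: g_def)
qed

lemma ord_mod_dvd_iff:
  "n > 0 \<Longrightarrow> q > 0 \<Longrightarrow> ord_mod n q a b dvd k \<longleftrightarrow> zmod n q (int k * a) (int k * b)"
  by (simp add: ord_mod_def zmod_def div_gcd_dvd_iff)

lemma ord_mod_unique:
  assumes "n > 0" "q > 0" "\<And>k. m dvd k \<longleftrightarrow> zmod n q (int k * a) (int k * b)"
  shows "ord_mod n q a b = m"
  using assms by (meson dvd_antisym dvd_refl ord_mod_dvd_iff)

lemma ord_mod_eq_1_iff: "n > 0 \<Longrightarrow> q > 0 \<Longrightarrow> ord_mod n q a b = 1 \<longleftrightarrow> zmod n q a b"
  using ord_mod_dvd_iff[of n q a b 1] by simp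

lemma ord_mod_dvd_lcm: "n > 0 \<Longrightarrow> q > 0 \<Longrightarrow> ord_mod n q a b dvd lcm n q"
  by (simp add: ord_mod_dvd_iff zmod_def)

lemma ord_mod_pos: "n > 0 \<Longrightarrow> q > 0 \<Longrightarrow> ord_mod n q a b > 0"
  using ord_mod_dvd_lcm by (metis dvd_0_left_iff gr0I lcm_pos_nat)

lemma zmod_coprime_cancel:
  assumes "n > 0" "q > 0" "zmod n q (int k * a) (int k * b)" "zmod n q (int l * a) (int l * b)" "coprime k l"
  shows "zmod n q a b"
proof -
  have "ord_mod n q a b dvd k" "ord_mod n q a b dvd l" using assms by (auto simp: ord_mod_dvd_iff)
  then have "ord_mod n q a b = 1" using assms(5) by (meson coprime_common_divisor_nat)
  then show ?thesis unfolding ord_mod_eq_1_iff[OF assms(1,2)] .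
qed

text \<open>Zero terms weigh nothing: a family may contain arbitrarily many of them, and at
  \<open>1 / ord_mod = 1\<close> each there would be no bound.\<close>

definition weight :: "nat \<Rightarrow> nat \<Rightarrow> int \<Rightarrow> int \<Rightarrow> real" where
  "weight n q a b = (if zmod n q a b then 0 else 1 / real (ord_mod n q a b))"

definition cross :: "nat \<Rightarrow> nat \<Rightarrow> 'i set \<Rightarrow> ('i \<Rightarrow> int) \<Rightarrow> ('i \<Rightarrow> int) \<Rightarrow> real" where
  "cross n q I x y = (\<Sum>i\<in>I. weight n q (x i) (y i))"

text \<open>Index sets in \<open>nat\<close> suffice, since every finite family can be relabelled by
  \<open>ufam_image\<close>.\<close>

definition cross_bd :: "nat \<Rightarrow> nat \<Rightarrow> real \<Rightarrow> bool" where
  "cross_bd n q B \<longleftrightarrow> (\<forall>I x y. ufam n q (I :: nat set) x y \<longrightarrow> cross n q I x y \<le> B)"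

lemma cross_bdD: "cross_bd n q B \<Longrightarrow> ufam n q (I :: nat set) x y \<Longrightarrow> cross n q I x y \<le> B"
  by (simp add: cross_bd_def)

text \<open>
  Multiplication by \<open>M\<close> maps the elements of order dividing \<open>l M\<close> into the cyclic first component.
\<close>

definition cofactor_dvd :: "nat \<Rightarrow> nat \<Rightarrow> nat \<Rightarrow> bool" where
  "cofactor_dvd q l M \<longleftrightarrow> (\<forall>b. int q dvd int (l * M) * b \<longrightarrow> int q dvd int M * b)"

text \<open>On the class, multiplication by \<open>M\<close> gives a family \<open>u\<close> over a
  group of order \<open>l\<close>. If every subset killed by \<open>u\<close> were zero-sum, then
  \<open>u\<close> would be a \<open>ufam\<close> with more than \<open>l\<close> nonzero terms. So
  there is a smallest exception \<open>T\<close>. It has no proper nonempty subset killed by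
  \<open>u\<close>, hence at most \<open>l\<close> terms, and their weight
  \<open>card T / (l M)\<close> is at most \<open>1 / M\<close>.\<close>

lemma merge_class:
  fixes I :: "nat set"
  assumes l: "prime l" and nq: "n > 0" "q > 0" and ufam: "ufam n q I x y" and cofactor_dvd: "cofactor_dvd q l M"
    and big: "card {i \<in> I. ord_mod n q (x i) (y i) = l * M} > l"
  shows "\<exists>I' x' y'. ufam n q (I' :: nat set) x' y' \<and> card I' < card I \<and> cross n q I x y \<le> cross n q I' x' y'"
proof -
  define X where "X = {i \<in> I. ord_mod n q (x i) (y i) = l * M}"
  have fin: "finite I" using ufam by (rule ufam_finite)
  have XI: "X \<subseteq> I" and finX: "finite X" using fin by (auto simp: X_def)
  have l1: "l > 1" using l prime_gt_1_nat by blast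
  have "card X > l" using big by (simp add: X_def)
  then have "X \<noteq> {}" by auto
  then obtain i0 where "ord_mod n q (x i0) (y i0) = l * M" by (auto simp: X_def)
  then have M: "M > 0" using ord_mod_pos[OF nq, of "x i0" "y i0"] by simp
  \<comment> \<open>On the class, \<open>M x i\<close> is killed by \<open>l\<close> in the first
    component; \<open>u i\<close> is its coordinate there, given by
    \<open>l M x i = n u i\<close>.\<close>
  define u where "u i = (int (l * M) * x i) div int n" for i
  have zX: "zmod n q (int (l * M) * x i) (int (l * M) * y i)" if "i \<in> X" for i
    using that ord_mod_dvd_iff[OF nq, of "x i" "y i" "l * M"] by (simp add: X_def)
  have ux: "int (l * M) * x i = int n * u i" if "i \<in> X" for i
    using zX[OF that] nq by (simp add: u_def zmod_def)
  have u_sum: "int (l * M) * sum x T = int n * sum u T" if "T \<subseteq> X" for T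
    using that ux by (auto simp: sum_distrib_left intro!: sum.cong)
  have psi: "zmod n q (int M * sum x T) (int M * sum y T) \<longleftrightarrow> int l dvd sum u T" if "T \<subseteq> X" for T
  proof -
    have "int n dvd int M * sum x T \<longleftrightarrow> int l * int n dvd int l * (int M * sum x T)"
      using l1 by simp
    also have "int l * (int M * sum x T) = int n * sum u T"
      using u_sum[OF that] by (simp add: mult.assoc)
    also have "int l * int n dvd int n * sum u T \<longleftrightarrow> int l dvd sum u T"
      using nq by (simp add: mult.commute[of "int l"])
    finally have 1: "int n dvd int M * sum x T \<longleftrightarrow> int l dvd sum u T" .
    have "int q dvd int (l * M) * sum y T"
      unfolding sum_distrib_left using that zX by (intro dvd_sum) (auto simp: zmod_def)
    then have "int q dvd int M * sum y T" using cofactor_dvd unfolding cofactor_dvd_def by blast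
    then show ?thesis using 1 by (simp add: zmod_def)
  qed
  have u1: "\<not> zmod l 1 (u i) 0" if "i \<in> X" for i
  proof
    assume "zmod l 1 (u i) 0"
    then have "zmod n q (int M * x i) (int M * y i)"
      using psi[of "{i}"] that by (simp add: zmod_def)
    then have "l * M dvd M" using that nq by (simp add: X_def ord_mod_dvd_iff[symmetric])
    then show False using M l1 by (auto dest!: dvd_imp_le)
  qed
  have sum0: "zsum l 1 u (\<lambda>_. 0) T \<longleftrightarrow> int l dvd sum u T" for T
    by (simp add: zmod_def)
  have "\<exists>T\<subseteq>X. int l dvd sum u T \<and> \<not> zsum n q x y T"
  proof (rule ccontr)
    assume "\<not> ?thesis"
    then have *: "zsum n q x y T" if "T \<subseteq> X" "int l dvd sum u T" for T
      using that by blast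
    have "ufam l 1 X u (\<lambda>_. 0)"
    proof (rule ufamI[OF finX], unfold sum0)
      fix S T assume a: "S \<subseteq> X" "T \<subseteq> X" "int l dvd sum u S" "int l dvd sum u T"
      then have "zsum n q x y (S \<inter> T)"
        using * XI by (intro ufam_Int[OF ufam]) auto
      then have "zmod n q (int M * sum x (S \<inter> T)) (int M * sum y (S \<inter> T))" by (rule zmod_mult)
      moreover have "S \<inter> T \<subseteq> X" using a by auto
      ultimately show "int l dvd sum u (S \<inter> T)" using psi by simp
    qed
    then have "card X \<le> l"
      using ufam_elementary_rank1[OF l, of X u "\<lambda>_. 0"] u1 by simp
    then show False using big by (simp add: X_def)
  qed
  then obtain T0 where T0: "T0 \<subseteq> X \<and> int l dvd sum u T0 \<and> \<not> zsum n q x y T0"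
    by blast
  obtain T where T: "T \<subseteq> X \<and> int l dvd sum u T \<and> \<not> zsum n q x y T"
    and min: "\<And>S. S \<subseteq> X \<and> int l dvd sum u S \<and> \<not> zsum n q x y S \<Longrightarrow> card T \<le> card S"
    using ex_has_least_nat[of "\<lambda>T. T \<subseteq> X \<and> int l dvd sum u T \<and> \<not> zsum n q x y T", OF T0, of card]
    by (elim exE conjE) simp
  have finT: "finite T" using T finX finite_subset by blast
  \<comment> \<open>Otherwise \<open>S\<close> and \<open>T - S\<close> would both be smaller and
    killed by \<open>u\<close>, hence zero-sum, and so would be \<open>T\<close>.\<close>
  have Tmin: "S = {} \<or> S = T" if "S \<subseteq> T" "int l dvd sum u S" for S
  proof (rule ccontr)
    assume ne: "\<not> (S = {} \<or> S = T)"
    have split: "sum w T = sum w S + sum w (T - S)" for w :: "nat \<Rightarrow> int"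
      using sum.subset_diff[OF that(1) finT] by (simp add: add.commute)
    have "card S < card T" using that ne finT by (intro psubset_card_mono) auto
    then have 1: "zsum n q x y S" using min[of S] that T by fastforce
    have "card (T - S) < card T" using that ne finT by (intro psubset_card_mono) auto
    moreover have "int l dvd sum u (T - S)" using T that split[of u] by (simp add: dvd_add_right_iff)
    ultimately have 2: "zsum n q x y (T - S)" using min[of "T - S"] T by fastforce
    show False using zmod_add[OF 1 2] T split by simp
  qed
  have cardT: "card T \<le> l"
  proof -
    have "ufam l 1 T u (\<lambda>_. 0)"
    proof (rule ufamI[OF finT], unfold sum0)
      fix S S' assume "S \<subseteq> T" "S' \<subseteq> T" "int l dvd sum u S" "int l dvd sum u S'"
      then have "S = {} \<or> S = T" "S' = {} \<or> S' = T" using Tmin by auto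
      then show "int l dvd sum u (S \<inter> S')" using T by auto
    qed
    moreover have "\<not> zmod l 1 (u i) 0" if "i \<in> T" for i using u1 T that by blast
    ultimately show ?thesis using ufam_elementary_rank1[OF l, of T u "\<lambda>_. 0"] by simp
  qed
  obtain t where t: "t \<in> T" using T by fastforce
  \<comment> \<open>No single term is killed by \<open>u\<close>. With two or more terms in
    \<open>T\<close>, merging shortens the family strictly, as the induction over its length
    requires.\<close>
  have "T \<noteq> {t}"
  proof
    assume "T = {t}"
    then show False using T u1[of t] by (auto simp: zmod_def)
  qed
  then have "T - {t} \<noteq> {}" using t by auto
  then have "insert t (I - T) \<subset> I" using t T XI by auto
  then have card: "card (insert t (I - T)) < card I" using fin by (intro psubset_card_mono)
  let ?x = "x(t := sum x T)" and ?y = "y(t := sum y T)"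
  have "zmod n q (int M * sum x T) (int M * sum y T)" using psi T by auto
  then have "ord_mod n q (sum x T) (sum y T) dvd M" using nq by (simp add: ord_mod_dvd_iff)
  then have le: "ord_mod n q (sum x T) (sum y T) \<le> M" using M by (simp add: dvd_imp_le)
  have "cross n q I x y = cross n q (I - T) x y + cross n q T x y"
    unfolding cross_def using T XI fin by (intro sum.subset_diff) auto
  also have "cross n q T x y = (\<Sum>i\<in>T. 1 / real (l * M))"
    unfolding cross_def
  proof (intro sum.cong refl)
    fix i assume "i \<in> T"
    then have i: "ord_mod n q (x i) (y i) = l * M" using T by (auto simp: X_def)
    then have "ord_mod n q (x i) (y i) \<noteq> 1" using l1 by auto
    then have "\<not> zmod n q (x i) (y i)" unfolding ord_mod_eq_1_iff[OF nq] .
    then show "weight n q (x i) (y i) = 1 / real (l * M)" using i by (simp add: weight_def)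
  qed
  also have "\<dots> = real (card T) / real l * (1 / real M)" by simp
  also have "\<dots> \<le> 1 * (1 / real M)"
    using cardT l1 by (intro mult_right_mono) (auto simp: field_simps)
  also have "\<dots> \<le> weight n q (sum x T) (sum y T)"
    using T le ord_mod_pos[OF nq, of "sum x T" "sum y T"] by (auto simp: weight_def field_simps)
  also have "cross n q (I - T) x y = (\<Sum>i\<in>I - T. weight n q (?x i) (?y i))"
    unfolding cross_def using t by (intro sum.cong) auto
  also have "(\<Sum>i\<in>I - T. weight n q (?x i) (?y i)) + weight n q (sum x T) (sum y T) = cross n q (insert t (I - T)) ?x ?y"
    unfolding cross_def using t fin by (subst sum.insert) auto
  finally have "cross n q I x y \<le> cross n q (insert t (I - T)) ?x ?y" by simp
  then show ?thesis using ufam_merge[OF ufam _ t] T XI card by blast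
qed

text \<open>Merging terminates because it lowers the number of terms, and a bound for the final
  family is a bound for the original one.\<close>

lemma cross_bd_by_classes:
  assumes nq: "n > 0" "q > 0"
    and *: "\<And>(I :: nat set) x y. ufam n q I x y \<Longrightarrow>
      (\<And>l M. prime l \<Longrightarrow> cofactor_dvd q l M \<Longrightarrow> card {i \<in> I. ord_mod n q (x i) (y i) = l * M} \<le> l) \<Longrightarrow>
      cross n q I x y \<le> B"
  shows "cross_bd n q B"
proof -
  have "ufam n q I x y \<Longrightarrow> cross n q I x y \<le> B" for I :: "nat set" and x y
  proof (induction "card I" arbitrary: I x y rule: less_induct)
    case less
    show ?case
    proof (cases "\<forall>l M. prime l \<longrightarrow> cofactor_dvd q l M \<longrightarrow> card {i \<in> I. ord_mod n q (x i) (y i) = l * M} \<le> l")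
      case True
      then show ?thesis using *[OF less.prems] by blast
    next
      case False
      then obtain l M where "prime l" "cofactor_dvd q l M" "card {i \<in> I. ord_mod n q (x i) (y i) = l * M} > l"
        by (meson not_le)
      then obtain I' x' y' where "ufam n q (I' :: nat set) x' y'" "card I' < card I" "cross n q I x y \<le> cross n q I' x' y'"
        using merge_class[OF _ nq less.prems] by blast
      then show ?thesis using less.hyps by (meson order_trans)
    qed
  qed
  then show ?thesis by (simp add: cross_bd_def)
qed

text \<open>
  A nonzero total sum allows one further term, namely its inverse.
\<close>

definition torsion_bd :: "nat \<Rightarrow> nat \<Rightarrow> nat \<Rightarrow> nat \<Rightarrow> bool" where
  "torsion_bd n q l N \<longleftrightarrow> (\<forall>(J :: nat set) x y. ufam n q J x y \<longrightarrow>
     (\<forall>i\<in>J. zmod n q (int l * x i) (int l * y i) \<and> \<not> zmod n q (x i) (y i)) \<longrightarrow>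
     card J + (if zsum n q x y J then 0 else 1) \<le> N)"

section \<open>Torsion subgroups and quotients in coordinates\<close>

lemma ufam_transfer:
  assumes "ufam n q I x y"
    and "\<And>T. T \<subseteq> I \<Longrightarrow> zsum n' q' x' y' T \<longleftrightarrow> zsum n q x y T"
  shows "ufam n' q' I x' y'"
proof (rule ufamI)
  show "finite I" using assms(1) by (rule ufam_finite)
  fix S T
  assume "S \<subseteq> I" "T \<subseteq> I" "zsum n' q' x' y' S" "zsum n' q' x' y' T"
  then show "zsum n' q' x' y' (S \<inter> T)"
    using ufam_Int[OF assms(1), of S T] assms(2)[of S] assms(2)[of T] assms(2)[of "S \<inter> T"] by auto
qed

text \<open>The elements of \<open>C_n\<close> killed by \<open>l\<close> are the multiples of
  \<open>m = n / l\<close>, and \<open>u\<close> identifies them with \<open>C_l\<close>.\<close>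

lemma torsion_coordinate:
  assumes "n = l * m" "l > 0" "m > 0"
    and "\<And>i. i \<in> J \<Longrightarrow> int n dvd int l * x i"
  shows "\<exists>u. (\<forall>i\<in>J. x i = int m * u i) \<and> (\<forall>T\<subseteq>J. int n dvd sum x T \<longleftrightarrow> int l dvd sum u T)"
proof (intro exI[of _ "\<lambda>i. x i div int m"] conjI ballI allI impI)
  show *: "x i = int m * (x i div int m)" if "i \<in> J" for i
    using assms(4)[OF that] assms(1,2,3) by simp
  fix T assume T: "T \<subseteq> J"
  have "sum x T = int m * (\<Sum>i\<in>T. x i div int m)"
    unfolding sum_distrib_left using T * by (intro sum.cong) auto
  then show "int n dvd sum x T \<longleftrightarrow> int l dvd (\<Sum>i\<in>T. x i div int m)"
    using assms by (simp add: mult.commute[of "int l"])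
qed

text \<open>As \<open>l\<close> is prime to \<open>q\<close>, the second coordinate of an
  \<open>l\<close>-torsion element vanishes, which leaves rank one.\<close>

lemma torsion_bd_cyclic:
  assumes "prime l" "l dvd n" "\<not> l dvd q" "n > 0" "q > 0"
  shows "torsion_bd n q l l"
  unfolding torsion_bd_def
proof (intro allI impI)
  fix J :: "nat set" and x y
  assume ufam: "ufam n q J x y" and J: "\<forall>i\<in>J. zmod n q (int l * x i) (int l * y i) \<and> \<not> zmod n q (x i) (y i)"
  have l: "l > 0" using assms(1) prime_gt_0_nat by blast
  obtain m where m: "n = l * m" using assms(2) by blast
  have "m > 0" using m assms(4) by simp
  then obtain u where u: "\<And>i. i \<in> J \<Longrightarrow> x i = int m * u i"
    "\<And>T. T \<subseteq> J \<Longrightarrow> int n dvd sum x T \<longleftrightarrow> int l dvd sum u T"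
    using torsion_coordinate[OF m l, of J x] J by (auto simp: zmod_def)
  have "coprime (int q) (int l)"
    using assms(1,3) by (simp add: coprime_commute prime_imp_coprime)
  then have "int q dvd y i" if "i \<in> J" for i
    using J that by (simp add: zmod_def coprime_dvd_mult_right_iff)
  then have zy: "int q dvd sum y T" if "T \<subseteq> J" for T using that by (intro dvd_sum) auto
  have iff: "zsum l 1 u (\<lambda>_. 0) T \<longleftrightarrow> zsum n q x y T" if "T \<subseteq> J" for T
    using u(2)[OF that] zy[OF that] by (simp add: zmod_def)
  have "card J + (if zsum l 1 u (\<lambda>_. 0) J then 0 else 1) \<le> l"
  proof (rule ufam_elementary_rank1[OF assms(1) ufam_transfer[OF ufam iff]])
    show "\<not> zmod l 1 (u i) 0" if "i \<in> J" for i using J iff[of "{i}"] that by auto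
  qed
  then show "card J + (if zsum n q x y J then 0 else 1) \<le> l"
    using iff[of J] by simp
qed

lemma torsion_bd_rank2:
  assumes "prime p" "p dvd n" "n > 0"
  shows "torsion_bd n p p (2 * p)"
  unfolding torsion_bd_def
proof (intro allI impI)
  fix J :: "nat set" and x y
  assume ufam: "ufam n p J x y" and J: "\<forall>i\<in>J. zmod n p (int p * x i) (int p * y i) \<and> \<not> zmod n p (x i) (y i)"
  have p: "p > 0" using assms(1) prime_gt_0_nat by blast
  obtain m where m: "n = p * m" using assms(2) by blast
  have "m > 0" using m assms(3) by simp
  then obtain u where u: "\<And>i. i \<in> J \<Longrightarrow> x i = int m * u i"
    "\<And>T. T \<subseteq> J \<Longrightarrow> int n dvd sum x T \<longleftrightarrow> int p dvd sum u T"
    using torsion_coordinate[OF m p, of J x] J by (auto simp: zmod_def)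
  have iff: "zsum p p u y T \<longleftrightarrow> zsum n p x y T" if "T \<subseteq> J" for T
    using u(2)[OF that] by (simp add: zmod_def)
  have "card J + (if zsum p p u y J then 0 else 1) \<le> 2 * p"
  proof (rule ufam_elementary_rank2[OF assms(1) ufam_transfer[OF ufam iff]])
    show "\<not> zmod p p (u i) (y i)" if "i \<in> J" for i using J iff[of "{i}"] that by auto
  qed
  then show "card J + (if zsum n p x y J then 0 else 1) \<le> 2 * p"
    using iff[of J] by simp
qed

text \<open>The kernel of multiplication by \<open>L\<close> is factored out by reading the same
  integers modulo \<open>n'\<close> and \<open>q'\<close>.\<close>

definition quot_mod :: "nat \<Rightarrow> nat \<Rightarrow> nat \<Rightarrow> nat \<Rightarrow> nat \<Rightarrow> bool" where
  "quot_mod n q n' q' L \<longleftrightarrow> (\<forall>a b. zmod n' q' a b \<longleftrightarrow> zmod n q (int L * a) (int L * b))"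

lemma quot_modD: "quot_mod n q n' q' L \<Longrightarrow> zmod n' q' a b \<longleftrightarrow> zmod n q (int L * a) (int L * b)"
  by (simp add: quot_mod_def)

lemma quot_mod_ord_dvd:
  assumes "quot_mod n q n' q' L" "n > 0" "q > 0" "n' > 0" "q' > 0"
  shows "ord_mod n' q' a b dvd k \<longleftrightarrow> ord_mod n q a b dvd L * k"
  using assms by (simp add: ord_mod_dvd_iff quot_modD mult.assoc)

lemma quot_mod_ord_coprime:
  assumes "quot_mod n q n' q' L" "n > 0" "q > 0" "n' > 0" "q' > 0" "coprime L (ord_mod n q a b)"
  shows "ord_mod n' q' a b = ord_mod n q a b"
proof (rule dvd_antisym)
  show "ord_mod n' q' a b dvd ord_mod n q a b" unfolding quot_mod_ord_dvd[OF assms(1-5)] by simp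
  have "ord_mod n q a b dvd L * ord_mod n' q' a b"
    using quot_mod_ord_dvd[OF assms(1-5), of a b "ord_mod n' q' a b"] by simp
  then show "ord_mod n q a b dvd ord_mod n' q' a b"
    using assms(6) by (simp add: coprime_commute coprime_dvd_mult_right_iff)
qed

lemma quot_mod_ord_dvd_prime:
  assumes "quot_mod n q n' q' l" "n > 0" "q > 0" "n' > 0" "q' > 0" "l > 0" "l dvd ord_mod n q a b"
  shows "ord_mod n q a b = l * ord_mod n' q' a b"
proof -
  obtain m where m: "ord_mod n q a b = l * m" using assms(7) by blast
  have iff: "ord_mod n' q' a b dvd k \<longleftrightarrow> m dvd k" for k
    using quot_mod_ord_dvd[OF assms(1-5), of a b k] assms(6) by (simp add: m)
  have "ord_mod n' q' a b = m"
    using iff[of m] iff[of "ord_mod n' q' a b"] by (simp add: dvd_antisym)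
  then show ?thesis using m by simp
qed

text \<open>Elements of order prime to \<open>L\<close> generate a subgroup that meets the
  \<open>L\<close>-torsion only in zero. The quotient map is therefore injective on their sums and
  preserves their orders.\<close>

lemma coprime_part_bound:
  fixes J :: "nat set"
  assumes quot_mod: "quot_mod n q n' q' L" and pos: "n > 0" "q > 0" "n' > 0" "q' > 0" and B: "cross_bd n' q' B"
    and ufam: "ufam n q J x y" and cop: "\<And>i. i \<in> J \<Longrightarrow> coprime L (ord_mod n q (x i) (y i))"
  shows "cross n q J x y \<le> B"
proof -
  have fin: "finite J" using ufam by (rule ufam_finite)
  define M where "M = (\<Prod>i\<in>J. ord_mod n q (x i) (y i))"
  have M: "coprime L M" unfolding M_def using cop by (intro prod_coprime_right) auto
  have zM: "zmod n q (int M * x i) (int M * y i)" if "i \<in> J" for i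
  proof -
    have "ord_mod n q (x i) (y i) dvd M" unfolding M_def using that fin by (intro dvd_prodI) auto
    then show ?thesis using pos by (simp add: ord_mod_dvd_iff)
  qed
  have iff: "zsum n' q' x y T \<longleftrightarrow> zsum n q x y T" if "T \<subseteq> J" for T
  proof
    assume "zsum n q x y T"
    then show "zsum n' q' x y T" unfolding quot_modD[OF quot_mod] by (rule zmod_mult)
  next
    assume a: "zsum n' q' x y T"
    have "zmod n q (int M * sum x T) (int M * sum y T)"
      unfolding sum_distrib_left zmod_def
      using dvd_sum[of T "int n" "\<lambda>i. int M * x i"] dvd_sum[of T "int q" "\<lambda>i. int M * y i"] that zM
      by (auto simp: zmod_def)
    then show "zsum n q x y T"
      using a M zmod_coprime_cancel[OF pos(1,2)] unfolding quot_modD[OF quot_mod] by blast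
  qed
  have "cross n q J x y = cross n' q' J x y"
    unfolding cross_def
  proof (intro sum.cong refl)
    fix i assume i: "i \<in> J"
    then show "weight n q (x i) (y i) = weight n' q' (x i) (y i)"
      using iff[of "{i}"] quot_mod_ord_coprime[OF quot_mod pos cop[OF i]] by (simp add: weight_def)
  qed
  also have "\<dots> \<le> B" by (rule cross_bdD[OF B ufam_transfer[OF ufam iff]])
  finally show ?thesis .
qed

text \<open>If the terms of order \<open>l\<close> are nearly as many as possible, then every sum killed by \<open>l\<close> of other
  terms can be completed to zero by terms of order \<open>l\<close> (otherwise adjoining that sum would give too
  long a family), so that the other terms form a unique factorization family modulo \<open>l\<close>-torsion.\<close>

lemma quotient_bound:
  fixes I :: "nat set"
  assumes l: "prime l" and quot_mod: "quot_mod n q n' q' l" and pos: "n > 0" "q > 0" "n' > 0" "q' > 0"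
    and torsion_bd: "torsion_bd n q l N" and ufam: "ufam n q I x y"
    and many: "N \<le> card {i \<in> I. ord_mod n q (x i) (y i) = l} + 1"
    and B': "cross_bd n' q' B'" and B'': "cross n q {i \<in> I. \<not> l dvd ord_mod n q (x i) (y i)} x y \<le> B''"
  shows "cross n q I x y \<le> real N / real l + B' / real l + (1 - 1 / real l) * B''"
proof -
  define U where "U = {i \<in> I. ord_mod n q (x i) (y i) = l}"
  have fin: "finite I" using ufam by (rule ufam_finite)
  have l1: "l > 1" using l prime_gt_1_nat by blast
  have UI: "U \<subseteq> I" and finU: "finite U" using fin by (auto simp: U_def)
  have U: "zmod n q (int l * x i) (int l * y i)" "\<not> zmod n q (x i) (y i)" if "i \<in> U" for i
  proof -
    have "ord_mod n q (x i) (y i) = l" using that by (simp add: U_def)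
    then show "zmod n q (int l * x i) (int l * y i)" "\<not> zmod n q (x i) (y i)"
      using ord_mod_dvd_iff[OF pos(1,2), of "x i" "y i" l] ord_mod_eq_1_iff[OF pos(1,2), of "x i" "y i"] l1 by auto
  qed
  have Usum: "zmod n q (int l * sum x C) (int l * sum y C)" if "C \<subseteq> U" for C
    unfolding sum_distrib_left zmod_def
    using dvd_sum[of C "int n" "\<lambda>i. int l * x i"] dvd_sum[of C "int q" "\<lambda>i. int l * y i"] that U(1)
    by (auto simp: zmod_def)
  \<comment> \<open>The sum of \<open>V\<close> would join \<open>U\<close> as a further nonzero
    torsion term. The total would still be nonzero, since otherwise \<open>C = U\<close> completes
    \<open>V\<close>. Hence \<open>card U + 2 \<le> N\<close>, one more than \<open>many\<close>
    permits.\<close>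
  have ext: "\<exists>C\<subseteq>U. zsum n q x y (V \<union> C)"
    if V: "V \<subseteq> I - U" and zV: "zsum n' q' x y V" for V
  proof (rule ccontr)
    assume *: "\<not> ?thesis"
    have finV: "finite V" using V fin finite_subset by blast
    have "V \<noteq> {}" using * by auto
    then obtain t where t: "t \<in> V" by auto
    then have tU: "t \<notin> U" using V by auto
    have disj: "V \<inter> U = {}" using V by auto
    let ?x = "x(t := sum x V)" and ?y = "y(t := sum y V)"
    have "ufam n q (insert t ((V \<union> U) - V)) ?x ?y"
      using V UI t by (intro ufam_merge ufam_subset[OF ufam]) auto
    also have "insert t ((V \<union> U) - V) = insert t U" using disj t by auto
    finally have cl2: "ufam n q (insert t U) ?x ?y" .
    have sum2: "sum (h(t := sum h V)) (insert t U) = sum h (V \<union> U)" for h :: "nat \<Rightarrow> int"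
    proof -
      have "sum (h(t := sum h V)) (insert t U) = sum h V + sum (h(t := sum h V)) U"
        using tU finU by simp
      also have "sum (h(t := sum h V)) U = sum h U" using tU by (intro sum.cong) auto
      finally show ?thesis using disj finV finU by (simp add: sum.union_disjoint)
    qed
    have "card (insert t U) + (if zsum n q ?x ?y (insert t U) then 0 else 1) \<le> N"
    proof -
      have "\<forall>i\<in>insert t U. zmod n q (int l * ?x i) (int l * ?y i) \<and> \<not> zmod n q (?x i) (?y i)"
        using U tU zV *[THEN notE] quot_modD[OF quot_mod] * by (auto dest: spec[of _ "{}"])
      then show ?thesis using torsion_bd cl2 unfolding torsion_bd_def by blast
    qed
    moreover have "\<not> zsum n q ?x ?y (insert t U)"
      using * unfolding sum2 by blast
    ultimately show False using many tU finU unfolding U_def[symmetric] by simp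
  qed
  have cl': "ufam n' q' (I - U) x y"
  proof (rule ufamI)
    show "finite (I - U)" using fin by simp
    fix V W assume a: "V \<subseteq> I - U" "W \<subseteq> I - U" "zsum n' q' x y V" "zsum n' q' x y W"
    obtain C where C: "C \<subseteq> U" "zsum n q x y (V \<union> C)" using ext a by blast
    obtain D where D: "D \<subseteq> U" "zsum n q x y (W \<union> D)" using ext a by blast
    \<comment> \<open>The completions meet in \<open>C \<inter> D\<close>, whose sum is
      \<open>l\<close>-torsion and disappears after multiplication by \<open>l\<close>.\<close>
    have "zsum n q x y ((V \<union> C) \<inter> (W \<union> D))"
      using C D a UI by (intro ufam_Int[OF ufam]) auto
    moreover have "(V \<union> C) \<inter> (W \<union> D) = (V \<inter> W) \<union> (C \<inter> D)" using C D a by auto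
    moreover have "sum h ((V \<inter> W) \<union> (C \<inter> D)) = sum h (V \<inter> W) + sum h (C \<inter> D)" for h :: "nat \<Rightarrow> int"
    proof -
      have "finite V" "finite C" using a C finU fin finite_subset by blast+
      then show ?thesis using a C by (intro sum.union_disjoint) auto
    qed
    ultimately have "zmod n q (int l * (sum x (V \<inter> W) + sum x (C \<inter> D))) (int l * (sum y (V \<inter> W) + sum y (C \<inter> D)))"
      using zmod_mult by simp
    moreover have "zmod n q (int l * sum x (C \<inter> D)) (int l * sum y (C \<inter> D))"
      using C by (intro Usum) auto
    ultimately have "zmod n q (int l * sum x (V \<inter> W)) (int l * sum y (V \<inter> W))"
      using zmod_diff by (fastforce simp: distrib_left)
    then show "zsum n' q' x y (V \<inter> W)" unfolding quot_modD[OF quot_mod] .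
  qed
  have "card U \<le> N"
    using torsion_bd ufam_subset[OF ufam UI] U unfolding torsion_bd_def by (meson add_leD1)
  have "cross n q I x y = cross n q (I - U) x y + cross n q U x y"
    unfolding cross_def using UI fin by (intro sum.subset_diff) auto
  also have "cross n q U x y = (\<Sum>i\<in>U. 1 / real l)"
    unfolding cross_def using U by (intro sum.cong) (auto simp: weight_def U_def)
  also have "\<dots> \<le> real N / real l"
    using \<open>card U \<le> N\<close> by (simp add: divide_right_mono)
  \<comment> \<open>If \<open>l\<close> divides the order, the quotient divides the order by
    \<open>l\<close>, so the new weight is \<open>l\<close> times the old. Otherwise order and
    weight \<open>w\<close> are unchanged, and \<open>w = w / l + (1 - 1 / l) w\<close>. In this
    form \<open>B'\<close> applies to all of \<open>I - U\<close> at once.\<close>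
  also have "cross n q (I - U) x y = (\<Sum>i\<in>I - U. weight n' q' (x i) (y i) / real l +
      (1 - 1 / real l) * (if l dvd ord_mod n q (x i) (y i) then 0 else weight n q (x i) (y i)))"
    unfolding cross_def
  proof (intro sum.cong refl)
    fix i assume i: "i \<in> I - U"
    show "weight n q (x i) (y i) = weight n' q' (x i) (y i) / real l +
      (1 - 1 / real l) * (if l dvd ord_mod n q (x i) (y i) then 0 else weight n q (x i) (y i))"
    proof (cases "l dvd ord_mod n q (x i) (y i)")
      case True
      have eq: "ord_mod n q (x i) (y i) = l * ord_mod n' q' (x i) (y i)"
        using quot_mod_ord_dvd_prime[OF quot_mod pos _ True] l1 by simp
      then have "ord_mod n' q' (x i) (y i) \<noteq> 1" "ord_mod n q (x i) (y i) \<noteq> 1" using i l1 by (auto simp: U_def)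
      then have "\<not> zmod n' q' (x i) (y i)" "\<not> zmod n q (x i) (y i)"
        unfolding ord_mod_eq_1_iff[OF pos(1,2)] ord_mod_eq_1_iff[OF pos(3,4)] .
      then show ?thesis using True eq by (simp add: weight_def)
    next
      case False
      then have "coprime l (ord_mod n q (x i) (y i))" using l by (simp add: prime_imp_coprime)
      then have eq: "ord_mod n' q' (x i) (y i) = ord_mod n q (x i) (y i)" by (rule quot_mod_ord_coprime[OF quot_mod pos])
      then have "zmod n' q' (x i) (y i) \<longleftrightarrow> zmod n q (x i) (y i)"
        using ord_mod_eq_1_iff[OF pos(1,2)] ord_mod_eq_1_iff[OF pos(3,4)] by metis
      then show ?thesis using False eq l1 by (simp add: weight_def field_simps)
    qed
  qed
  also have "\<dots> = cross n' q' (I - U) x y / real l + (1 - 1 / real l) *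
      (\<Sum>i\<in>I - U. if l dvd ord_mod n q (x i) (y i) then 0 else weight n q (x i) (y i))"
    by (simp add: sum.distrib cross_def sum_divide_distrib sum_distrib_left)
  also have "(\<Sum>i\<in>I - U. if l dvd ord_mod n q (x i) (y i) then 0 else weight n q (x i) (y i)) =
      cross n q {i \<in> I. \<not> l dvd ord_mod n q (x i) (y i)} x y"
    unfolding cross_def using fin by (intro sum.mono_neutral_cong_right) (auto simp: U_def)
  finally have "cross n q I x y \<le> cross n' q' (I - U) x y / real l + (1 - 1 / real l) *
      cross n q {i \<in> I. \<not> l dvd ord_mod n q (x i) (y i)} x y + real N / real l" by simp
  moreover have "cross n' q' (I - U) x y / real l \<le> B' / real l"
    using cross_bdD[OF B' cl'] by (simp add: divide_right_mono)
  moreover have "(1 - 1 / real l) * cross n q {i \<in> I. \<not> l dvd ord_mod n q (x i) (y i)} x y \<le> (1 - 1 / real l) * B''"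
    using B'' l1 by (intro mult_left_mono) auto
  ultimately show ?thesis by linarith
qed

section \<open>Contributions of the individual orders\<close>

lemma weight_ord_mod:
  assumes "n > 0" "q > 0"
  shows "weight n q a b = (if ord_mod n q a b = 1 then 0 else 1 / real (ord_mod n q a b))"
  unfolding ord_mod_eq_1_iff[OF assms] by (simp add: weight_def)

lemma cross_by_orders:
  assumes "finite I" "n > 0" "q > 0"
  shows "cross n q {i \<in> I. P (ord_mod n q (x i) (y i))} x y =
    (\<Sum>M | M dvd lcm n q \<and> P M \<and> M \<noteq> 1. real (card {i \<in> I. ord_mod n q (x i) (y i) = M}) / real M)"
proof -
  let ?Ms = "{M. M dvd lcm n q \<and> P M \<and> M \<noteq> 1}"
  let ?I = "{i \<in> I. P (ord_mod n q (x i) (y i)) \<and> ord_mod n q (x i) (y i) \<noteq> 1}"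
  have finM: "finite ?Ms"
    using assms finite_divisors_nat[OF lcm_pos_nat[OF assms(2,3)]] by simp
  have "cross n q {i \<in> I. P (ord_mod n q (x i) (y i))} x y = (\<Sum>i\<in>?I. 1 / real (ord_mod n q (x i) (y i)))"
    unfolding cross_def weight_ord_mod[OF assms(2,3)] using assms(1)
    by (intro sum.mono_neutral_cong_right) auto
  also have "\<dots> = (\<Sum>M\<in>?Ms. \<Sum>i\<in>{i \<in> ?I. ord_mod n q (x i) (y i) = M}. 1 / real (ord_mod n q (x i) (y i)))"
    using assms finM ord_mod_dvd_lcm[OF assms(2,3)] by (intro sum.group[symmetric]) auto
  also have "\<dots> = (\<Sum>M\<in>?Ms. real (card {i \<in> I. ord_mod n q (x i) (y i) = M}) / real M)"
  proof (intro sum.cong refl)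
    fix M assume M: "M \<in> ?Ms"
    then have "{i \<in> ?I. ord_mod n q (x i) (y i) = M} = {i \<in> I. ord_mod n q (x i) (y i) = M}" by auto
    then show "(\<Sum>i\<in>{i \<in> ?I. ord_mod n q (x i) (y i) = M}. 1 / real (ord_mod n q (x i) (y i))) =
      real (card {i \<in> I. ord_mod n q (x i) (y i) = M}) / real M" by simp
  qed
  finally show ?thesis .
qed

text \<open>A divisor corresponds to its exponent at \<open>p\<close> together with its part prime
  to \<open>p\<close>.\<close>

lemma sum_divisors_prime_power:
  fixes f :: "nat \<Rightarrow> real"
  assumes p: "prime p" "\<not> p dvd D" "D > 0"
  shows "(\<Sum>M | M dvd p ^ a * D. f M) = (\<Sum>j\<le>a. \<Sum>d | d dvd D. f (p ^ j * d))"
proof -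
  have "coprime p D" using p by (simp add: prime_imp_coprime)
  have "(\<Sum>M | M dvd p ^ a * D. f M) = (\<Sum>(j, d)\<in>{..a} \<times> {d. d dvd D}. f (p ^ j * d))"
  proof (rule sum.reindex_bij_witness[of _ "\<lambda>(j, d). p ^ j * d" "\<lambda>M. (multiplicity p M, M div p ^ multiplicity p M)"])
    fix M assume "M \<in> {M. M dvd p ^ a * D}"
    then have M: "M dvd p ^ a * D" by simp
    have nz: "p ^ a * D \<noteq> 0" using p prime_gt_0_nat by simp
    then have M0: "M \<noteq> 0" using M by (metis dvd_0_left)
    show "(case (multiplicity p M, M div p ^ multiplicity p M) of (j, d) \<Rightarrow> p ^ j * d) = M"
      using multiplicity_dvd[of p M] by simp
    have np: "\<not> is_unit p" using p by auto
    have "multiplicity p M \<le> multiplicity p (p ^ a * D)"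
      using M nz by (rule dvd_imp_multiplicity_le)
    also have "\<dots> = a" using p
      by (simp add: prime_elem_multiplicity_mult_distrib not_dvd_imp_multiplicity_0 prime_gt_0_nat)
    finally have 1: "multiplicity p M \<le> a" .
    define d where "d = M div p ^ multiplicity p M"
    have "d dvd p ^ a * D" using M multiplicity_dvd[of p M] unfolding d_def
      by (metis dvd_trans dvd_div_mult_self dvd_triv_left)
    moreover have "coprime d (p ^ a)"
    proof -
      have "\<not> p dvd d" unfolding d_def using multiplicity_decompose[OF M0 np] by simp
      then have "coprime p d" using p prime_imp_coprime by blast
      then show ?thesis by (simp add: coprime_commute)
    qed
    ultimately have "d dvd D" by (simp add: coprime_dvd_mult_right_iff)
    then show "(multiplicity p M, M div p ^ multiplicity p M) \<in> {..a} \<times> {d. d dvd D}"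
      using 1 by (simp add: d_def)
    show "(case (multiplicity p M, M div p ^ multiplicity p M) of (j, d) \<Rightarrow> f (p ^ j * d)) = f M"
      using multiplicity_dvd[of p M] by simp
  next
    fix jd :: "nat \<times> nat" assume "jd \<in> {..a} \<times> {d. d dvd D}"
    then obtain j d where jd: "jd = (j, d)" "j \<le> a" "d dvd D" by auto
    have d: "\<not> p dvd d" "d > 0"
      using dvd_trans[OF _ jd(3), of p] p(2) dvd_pos_nat[OF p(3) jd(3)] by blast+
    have j: "multiplicity p (p ^ j * d) = j"
      using p d by (simp add: prime_elem_multiplicity_mult_distrib not_dvd_imp_multiplicity_0 prime_gt_0_nat)
    have "p ^ j * d dvd p ^ a * D"
      by (rule mult_dvd_mono[OF le_imp_power_dvd[OF jd(2)] jd(3)])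
    then show "(case jd of (j, d) \<Rightarrow> p ^ j * d) \<in> {M. M dvd p ^ a * D}" by (simp add: jd(1))
    have "p ^ j * d div p ^ j = d" using prime_gt_0_nat[OF p(1)] by simp
    then show "(multiplicity p (case jd of (j, d) \<Rightarrow> p ^ j * d), (case jd of (j, d) \<Rightarrow> p ^ j * d) div
        p ^ multiplicity p (case jd of (j, d) \<Rightarrow> p ^ j * d)) = jd"
      by (simp add: jd(1) j)
  qed
  then show ?thesis by (simp add: sum.cartesian_product)
qed

section \<open>Upper bounds for the cross number\<close>

text \<open>The contribution of a cyclic summand of order \<open>p^a\<close> to
  \<open>K1_star\<close>, by \<open>geo_formula\<close>. With exponent \<open>a + 1\<close> it is
  the factor belonging to \<open>p^a\<close> in the product defining
  \<open>two_wide_wrt\<close>.\<close>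

definition geo :: "nat \<Rightarrow> nat \<Rightarrow> real" where
  "geo p a = (\<Sum>i<a. 1 / real p ^ i)"

lemma geo_0 [simp]: "geo p 0 = 0"
  by (simp add: geo_def)

text \<open>The recursion matches \<open>quotient_bound\<close>: for \<open>N = p\<close>,
  \<open>B' = geo p a + B\<close> and \<open>B'' = B\<close> the bound there equals
  \<open>geo p (Suc a) + B\<close>.\<close>

lemma geo_Suc: "geo p (Suc a) = 1 + geo p a / real p"
  unfolding geo_def sum.lessThan_Suc_shift by (simp add: sum_divide_distrib mult.commute)

lemma geo_nonneg: "geo p a \<ge> 0"
  by (simp add: geo_def sum_nonneg)

lemma geo_le:
  assumes "p > 1"
  shows "geo p a \<le> real p / (real p - 1)"
proof (induction a)
  case (Suc a)
  have "geo p (Suc a) \<le> 1 + (real p / (real p - 1)) / real p"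
    unfolding geo_Suc using Suc assms by (intro add_left_mono divide_right_mono) auto
  also have "\<dots> = real p / (real p - 1)" using assms by (simp add: field_simps)
  finally show ?case .
qed (use assms in simp)

lemma cofactor_dvd_coprime:
  assumes "prime l" "\<not> l dvd q"
  shows "cofactor_dvd q l M"
proof -
  have "coprime (int q) (int l)"
    using assms by (simp add: coprime_commute prime_imp_coprime)
  then show ?thesis
    unfolding cofactor_dvd_def of_nat_mult mult.assoc by (simp add: coprime_dvd_mult_right_iff)
qed

text \<open>If \<open>p\<close> divides \<open>M\<close>, multiplication by \<open>M\<close> kills
  the second component. For \<open>M = 1\<close> the property fails, so the order \<open>p\<close>
  itself cannot be merged when \<open>q = p\<close>.\<close>

lemma cofactor_dvdI: "p dvd M \<Longrightarrow> cofactor_dvd p p M"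
  by (simp add: cofactor_dvd_def)

lemma sum_orders_prime:
  fixes f :: "nat \<Rightarrow> real"
  assumes p: "prime p" "\<not> p dvd D" "D > 0"
  shows "(\<Sum>M | M dvd p ^ a * D \<and> p dvd M \<and> M \<noteq> 1. f M) = (\<Sum>j<a. \<Sum>d | d dvd D. f (p ^ Suc j * d))"
proof -
  have p1: "p > 1" using p prime_gt_1_nat by blast
  have fin: "finite {M. M dvd p ^ a * D}" using p1 p by (intro finite_divisors_nat) auto
  have "(\<Sum>M | M dvd p ^ a * D \<and> p dvd M \<and> M \<noteq> 1. f M) = (\<Sum>M | M dvd p ^ a * D. if p dvd M then f M else 0)"
    using fin p1 by (intro sum.mono_neutral_cong_left) auto
  also have "\<dots> = (\<Sum>j\<le>a. \<Sum>d | d dvd D. if p dvd p ^ j * d then f (p ^ j * d) else 0)"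
    by (rule sum_divisors_prime_power[OF p])
  also have "\<dots> = (\<Sum>d | d dvd D. if p dvd d then f d else 0) + (\<Sum>j<a. \<Sum>d | d dvd D. f (p ^ Suc j * d))"
    unfolding sum.atMost_shift by (simp add: mult.assoc cong: if_cong)
  also have "(\<Sum>d | d dvd D. if p dvd d then f d else 0) = 0"
    using p(2) dvd_trans by (intro sum.neutral) auto
  finally show ?thesis by simp
qed

text \<open>Induction on \<open>a\<close>. With at least \<open>p - 1\<close> terms of order
  \<open>p\<close> the quotient by the \<open>p\<close>-torsion reduces to exponent
  \<open>a\<close>. With at most \<open>p - 2\<close> the orders divisible by \<open>p\<close> are
  counted directly, while the terms of order prime to \<open>p\<close> are in both cases bounded by
  \<open>B\<close>.\<close>

lemma cyclic_extension:
  assumes p: "prime p" and m: "m > 0" "\<not> p dvd m" and q: "q > 0" "\<not> p dvd q" and B: "cross_bd m q B"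
    and wide: "(\<Sum>d | d dvd lcm m q \<and> d \<noteq> 1. 1 / real d) \<le> 2 * (real p - 1) / real p ^ 2"
  shows "cross_bd (p ^ a * m) q (geo p a + B)"
proof (induction a)
  case 0
  then show ?case using B by simp
next
  case (Suc a)
  define n where "n = p ^ Suc a * m"
  define s where "s = (\<Sum>d | d dvd lcm m q \<and> d \<noteq> 1. 1 / real d)"
  have p1: "p > 1" using p prime_gt_1_nat by blast
  have n: "n > 0" using p1 m by (simp add: n_def)
  have na: "p ^ a * m > 0" using p1 m by simp
  have cop: "coprime (int q) (int p ^ k)" for k
    using p q(2) by (simp add: coprime_commute prime_imp_coprime)
  have quo1: "quot_mod n q (p ^ a * m) q p"
    unfolding quot_mod_def zmod_def n_def using p1 cop[of 1]
    by (simp add: mult.assoc coprime_dvd_mult_right_iff)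
  have quo2: "quot_mod n q m q (p ^ Suc a)"
    unfolding quot_mod_def zmod_def n_def of_nat_mult of_nat_power using p1 cop[of "Suc a"]
    by (simp add: coprime_dvd_mult_right_iff del: power_Suc)
  have "cross_bd n q (geo p (Suc a) + B)"
  proof (rule cross_bd_by_classes[OF n q(1)])
    fix I :: "nat set" and x y
    assume ufam: "ufam n q I x y"
      and classes: "\<And>l M. prime l \<Longrightarrow> cofactor_dvd q l M \<Longrightarrow> card {i \<in> I. ord_mod n q (x i) (y i) = l * M} \<le> l"
    have fin: "finite I" using ufam by (rule ufam_finite)
    define c where "c M = card {i \<in> I. ord_mod n q (x i) (y i) = M}" for M
    have c: "c (p ^ Suc j * d) \<le> p" for j d
      unfolding c_def using classes[OF p cofactor_dvd_coprime[OF p q(2)], of "p ^ j * d"] by (simp add: mult.assoc)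
    let ?A = "{i \<in> I. \<not> p dvd ord_mod n q (x i) (y i)}"
    have A: "cross n q ?A x y \<le> B"
    proof (rule coprime_part_bound[OF quo2 n q(1) m(1) q(1) B])
      show "ufam n q ?A x y" by (rule ufam_subset[OF ufam]) auto
      show "coprime (p ^ Suc a) (ord_mod n q (x i) (y i))" if "i \<in> ?A" for i
        using that p by (simp add: prime_imp_coprime del: power_Suc)
    qed
    show "cross n q I x y \<le> geo p (Suc a) + B"
    proof (cases "p \<le> c p + 1")
      case True
      have "torsion_bd n q p p" using n q p by (intro torsion_bd_cyclic) (auto simp: n_def)
      from quotient_bound[OF p quo1 n q(1) na q(1) this ufam _ Suc A]
      have "cross n q I x y \<le> real p / real p + (geo p a + B) / real p + (1 - 1 / real p) * B"
        using True by (simp add: c_def)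
      also have "\<dots> = geo p (Suc a) + B"
        using p1 by (simp add: geo_Suc field_simps)
      finally show ?thesis .
    next
      case False
      have D0: "\<not> p dvd lcm m q" "lcm m q > 0"
      proof -
        have "lcm m q dvd m * q" by simp
        then show "\<not> p dvd lcm m q"
          using dvd_trans[of p "lcm m q" "m * q"] prime_dvd_mult_iff[OF p, of m q] m q by blast
        show "lcm m q > 0" using m q by (simp add: lcm_pos_nat)
      qed
      have D: "lcm n q = p ^ Suc a * lcm m q"
      proof (rule dvd_antisym)
        show "lcm n q dvd p ^ Suc a * lcm m q"
          unfolding n_def by (intro lcm_least mult_dvd_mono dvd_mult) auto
        have "p ^ Suc a dvd lcm n q" "lcm m q dvd lcm n q"
          unfolding n_def by (meson dvd_lcm1 dvd_mult_left, meson dvd_lcm1 dvd_lcm2 dvd_mult_right lcm_least)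
        moreover have "coprime (p ^ Suc a) (lcm m q)"
          using p D0(1) by (simp add: prime_imp_coprime del: power_Suc)
        ultimately show "p ^ Suc a * lcm m q dvd lcm n q" by (rule divides_mult)
      qed
      have finD: "finite {d. d dvd lcm m q}" using D0 by (intro finite_divisors_nat)
      have s1: "(\<Sum>d | d dvd lcm m q. 1 / real d) = 1 + s"
        unfolding s_def using finD by (subst sum.remove[of _ 1]) (auto intro!: sum.cong)
      have inner: "(\<Sum>d | d dvd lcm m q. t * (1 / real d) - (if d = 1 then z else 0)) = t * (1 + s) - z"
        for t z :: real
        unfolding sum_subtractf sum_distrib_left[symmetric] s1 using finD by simp
      have split: "cross n q I x y = cross n q {i \<in> I. p dvd ord_mod n q (x i) (y i)} x y + cross n q ?A x y"
        unfolding cross_def using fin by (subst sum.union_disjoint[symmetric]) (auto intro!: sum.cong)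
      have "cross n q {i \<in> I. p dvd ord_mod n q (x i) (y i)} x y =
          (\<Sum>M | M dvd p ^ Suc a * lcm m q \<and> p dvd M \<and> M \<noteq> 1. real (c M) / real M)"
        unfolding cross_by_orders[OF fin n q(1)] D c_def ..
      also have "\<dots> = (\<Sum>j<Suc a. \<Sum>d | d dvd lcm m q. real (c (p ^ Suc j * d)) / real (p ^ Suc j * d))"
        by (rule sum_orders_prime[OF p D0])
      \<comment> \<open>At most \<open>p\<close> terms of order \<open>p^(j+1) d\<close> contribute
        at most \<open>1 / (p^j d)\<close>. Only for the order \<open>p\<close> itself, with at most
        \<open>p - 2\<close> terms, can \<open>2 / p\<close> be subtracted.\<close>
      also have "\<dots> \<le> (\<Sum>j<Suc a. \<Sum>d | d dvd lcm m q. 1 / real p ^ j * (1 / real d) -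
          (if d = 1 then if j = 0 then 2 / real p else 0 else 0))"
      proof (intro sum_mono)
        fix j d assume "j \<in> {..<Suc a}" "d \<in> {d. d dvd lcm m q}"
        then have d: "d > 0" using D0 by (auto intro: dvd_pos_nat)
        show "real (c (p ^ Suc j * d)) / real (p ^ Suc j * d) \<le> 1 / real p ^ j * (1 / real d) -
          (if d = 1 then if j = 0 then 2 / real p else 0 else 0)"
        proof (cases "d = 1 \<and> j = 0")
          case True
          have "real (c p) \<le> real p - 2" using False by linarith
          then show ?thesis using True p1 by (simp add: field_simps)
        next
          case False
          have "real (c (p ^ Suc j * d)) / real (p ^ Suc j * d) \<le> real p / real (p ^ Suc j * d)"
            using c[of j d] by (intro divide_right_mono) auto
          also have "\<dots> = 1 / real p ^ j * (1 / real d)" using p1 d by (simp add: field_simps)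
          finally show ?thesis using False by auto
        qed
      qed
      also have "\<dots> = (\<Sum>j<Suc a. 1 / real p ^ j * (1 + s) - (if j = 0 then 2 / real p else 0))"
        by (intro sum.cong refl inner)
      also have "\<dots> = geo p (Suc a) * (1 + s) - 2 / real p"
        unfolding sum_subtractf sum_distrib_right[symmetric] geo_def by (simp del: sum.lessThan_Suc)
      finally have "cross n q I x y \<le> geo p (Suc a) * (1 + s) - 2 / real p + cross n q ?A x y"
        unfolding split by simp
      \<comment> \<open>The excess over \<open>geo p (Suc a)\<close> caused by the divisors
        \<open>d > 1\<close>; it is at most the \<open>2 / p\<close> saved.\<close>
      moreover have "geo p (Suc a) * s \<le> real p / (real p - 1) * (2 * (real p - 1) / real p ^ 2)"
        using wide geo_le[OF p1, of "Suc a"] p1 unfolding s_def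
        by (intro mult_mono) (auto intro!: sum_nonneg)
      moreover have "real p / (real p - 1) * (2 * (real p - 1) / real p ^ 2) = 2 / real p"
        using p1 by (simp add: field_simps power2_eq_square)
      ultimately show ?thesis using A by (simp add: distrib_left)
    qed
  qed
  then show ?case by (simp add: n_def)
qed

lemma cross_bd_trivial: "cross_bd 1 1 0"
  unfolding cross_bd_def cross_def weight_def zmod_def by simp

lemma cross_bd_prime_power: "prime r \<Longrightarrow> cross_bd (r ^ b) 1 (geo r b)"
  using cyclic_extension[of r 1 1 0 b] cross_bd_trivial prime_gt_1_nat[of r]
  by simp

lemma sum_divisors_prime_power':
  fixes f :: "nat \<Rightarrow> real"
  assumes "prime r"
  shows "(\<Sum>d | d dvd r ^ b. f d) = (\<Sum>j\<le>b. f (r ^ j))"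
  using sum_divisors_prime_power[OF assms, where D = 1 and a = b and f = f] prime_gt_1_nat[OF assms] by simp

text \<open>For two primes the condition \<open>wide\<close> is automatic: the sum of the
  \<open>1 / r^j\<close> with \<open>j \<ge> 1\<close> is at most
  \<open>1 / (r - 1) \<le> 1 / p\<close>, and \<open>p \<le> 2 (p - 1)\<close>.\<close>

lemma cross_bd_two_primes:
  assumes p: "prime p" and r: "prime r" and pr: "p < r"
  shows "cross_bd (p ^ a * r ^ b) 1 (geo p a + geo r b)"
proof (rule cyclic_extension[OF p])
  have p1: "p > 1" and r1: "r > 1" using p r prime_gt_1_nat by blast+
  show "r ^ b > 0" "\<not> p dvd 1" "cross_bd (r ^ b) 1 (geo r b)" using r1 p1 cross_bd_prime_power[OF r] by auto
  show "\<not> p dvd r ^ b" using p r pr by (metis less_irrefl prime_dvd_power primes_dvd_imp_eq)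
  have "(\<Sum>d | d dvd lcm (r ^ b) 1 \<and> d \<noteq> 1. 1 / real d) = (\<Sum>d | d dvd r ^ b. if d = 1 then 0 else 1 / real d)"
    using r1 by (intro sum.mono_neutral_cong_left) auto
  also have "\<dots> = (\<Sum>j\<le>b. if r ^ j = 1 then 0 else 1 / real (r ^ j))"
    by (rule sum_divisors_prime_power'[OF r])
  also have "\<dots> = geo r b / real r"
    unfolding sum.atMost_shift geo_def sum_divide_distrib using r1 by (auto intro!: sum.cong simp: mult.commute)
  also have "\<dots> \<le> (real r / (real r - 1)) / real r"
    using geo_le[OF r1] by (intro divide_right_mono) auto
  also have "\<dots> = 1 / (real r - 1)" using r1 by simp
  also have "\<dots> \<le> 1 / real p" using pr p1 by (intro divide_left_mono) auto
  also have "\<dots> \<le> 2 * (real p - 1) / real p ^ 2"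
    using p1 by (simp add: field_simps power2_eq_square)
  finally show "(\<Sum>d | d dvd lcm (r ^ b) 1 \<and> d \<noteq> 1. 1 / real d) \<le> 2 * (real p - 1) / real p ^ 2" .
qed simp

text \<open>Many terms of order \<open>p\<close> lead to a cyclic quotient, many of order
  \<open>r\<close> to a smaller \<open>b\<close>. If both are scarce, at most \<open>2 p - 2\<close>
  and \<open>r - 2\<close>, a direct count succeeds, because the savings \<open>2 / p\<close> and
  \<open>2 / r\<close> cover the mixed orders. The exponent \<open>b = 0\<close> covers the case
  that \<open>p\<close> is the largest prime.\<close>

lemma cross_bd_rank2:
  assumes p: "prime p" and r: "prime r" and pr: "p < r"
  shows "cross_bd (p ^ Suc a * r ^ b) p (geo p (Suc a) + geo r b + 1)"
proof (induction b rule: less_induct)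
  case (less b)
  define n where "n = p ^ Suc a * r ^ b"
  have p1: "p > 1" and r1: "r > 1" using p r prime_gt_1_nat by blast+
  have r3: "r \<ge> 3" using pr p1 by simp
  have pr': "\<not> p dvd r ^ k" "\<not> r dvd p ^ k" "\<not> r dvd p" for k
    using p r pr by (metis less_irrefl prime_dvd_power primes_dvd_imp_eq)+
  have n: "n > 0" and p0: "p > 0" using p1 r1 by (auto simp: n_def)
  have cop: "coprime (int p) (int r ^ k)" "coprime (int r ^ k) (int p)" for k
    using primes_coprime[OF p r] pr by (simp_all add: coprime_commute)
  have "cross_bd n p (geo p (Suc a) + geo r b + 1)"
  proof (rule cross_bd_by_classes[OF n p0])
    fix I :: "nat set" and x y
    assume ufam: "ufam n p I x y"
      and classes: "\<And>l M. prime l \<Longrightarrow> cofactor_dvd p l M \<Longrightarrow> card {i \<in> I. ord_mod n p (x i) (y i) = l * M} \<le> l"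
    have fin: "finite I" using ufam by (rule ufam_finite)
    define c where "c M = card {i \<in> I. ord_mod n p (x i) (y i) = M}" for M
    show "cross n p I x y \<le> geo p (Suc a) + geo r b + 1"
    proof (cases "2 * p \<le> c p + 1")
      case True
      \<comment> \<open>The second component consists of \<open>p\<close>-torsion, so the quotient
        is cyclic.\<close>
      have quo1: "quot_mod n p (p ^ a * r ^ b) 1 p"
        unfolding quot_mod_def zmod_def n_def using p1 by (simp add: mult.assoc)
      have quo2: "quot_mod n p (r ^ b) 1 (p ^ Suc a)"
        unfolding quot_mod_def zmod_def n_def using p1 by (simp add: mult.assoc)
      let ?A = "{i \<in> I. \<not> p dvd ord_mod n p (x i) (y i)}"
      have A: "cross n p ?A x y \<le> geo r b"
      proof (rule coprime_part_bound[OF quo2 n p0 _ _ cross_bd_prime_power[OF r]])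
        show "ufam n p ?A x y" by (rule ufam_subset[OF ufam]) auto
        show "coprime (p ^ Suc a) (ord_mod n p (x i) (y i))" if "i \<in> ?A" for i
          using that p by (simp add: prime_imp_coprime del: power_Suc)
      qed (use r1 in auto)
      have "torsion_bd n p p (2 * p)" using n p by (intro torsion_bd_rank2) (auto simp: n_def)
      from quotient_bound[OF p quo1 n p0 _ _ this ufam _ cross_bd_two_primes[OF p r pr] A]
      have "cross n p I x y \<le> real (2 * p) / real p + (geo p a + geo r b) / real p + (1 - 1 / real p) * geo r b"
        using True p1 r1 by (simp add: c_def)
      also have "\<dots> = geo p (Suc a) + geo r b + 1"
        using p1 by (simp add: geo_Suc field_simps)
      finally show ?thesis .
    next
      case u: False
      show ?thesis
      proof (cases "b > 0 \<and> r \<le> c r + 1")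
        case True
        then obtain b' where b: "b = Suc b'" by (metis gr0_conv_Suc)
        have quo1: "quot_mod n p (p ^ Suc a * r ^ b') p r"
          unfolding quot_mod_def zmod_def n_def b using r1 cop[of 1]
          by (simp add: mult.left_commute[of _ "int r"] coprime_dvd_mult_right_iff)
        have quo2: "quot_mod n p (p ^ Suc a) p (r ^ b)"
          unfolding quot_mod_def zmod_def n_def of_nat_mult of_nat_power using r1 cop[of b]
          by (simp add: mult.commute[of _ "int r ^ b"] coprime_dvd_mult_right_iff)
        let ?A = "{i \<in> I. \<not> r dvd ord_mod n p (x i) (y i)}"
        \<comment> \<open>The terms of order prime to \<open>r\<close> live in the group with
          \<open>b = 0\<close>, which the induction hypothesis covers because \<open>b > 0\<close>
          here.\<close>
        have B0: "cross_bd (p ^ Suc a) p (geo p (Suc a) + 1)"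
          using less.IH[of 0] b by simp
        have A: "cross n p ?A x y \<le> geo p (Suc a) + 1"
        proof (rule coprime_part_bound[OF quo2 n p0 _ _ B0])
          show "ufam n p ?A x y" by (rule ufam_subset[OF ufam]) auto
          show "coprime (r ^ b) (ord_mod n p (x i) (y i))" if "i \<in> ?A" for i
            using that r b by (simp add: prime_imp_coprime del: power_Suc)
        qed (use p1 in auto)
        have "torsion_bd n p r r" using n p0 r pr' b by (intro torsion_bd_cyclic) (auto simp: n_def)
        from quotient_bound[OF r quo1 n p0 _ _ this ufam _ less.IH A]
        have "cross n p I x y \<le> real r / real r + (geo p (Suc a) + geo r b' + 1) / real r +
            (1 - 1 / real r) * (geo p (Suc a) + 1)"
          using True p1 r1 b by (simp add: c_def)
        also have "\<dots> = geo p (Suc a) + geo r b + 1"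
          using r1 by (simp add: b geo_Suc[of r] field_simps)
        finally show ?thesis .
      next
        case v: False
        define h where "h M = (if M = 1 then 0 else real (c M) / real M)" for M
        have lcm: "lcm n p = p ^ Suc a * r ^ b"
          unfolding n_def by (rule lcm_proj1_if_dvd_nat) simp
        have "cross n p I x y = cross n p {i \<in> I. True} x y" by simp
        also have "\<dots> = (\<Sum>M | M dvd lcm n p \<and> True \<and> M \<noteq> 1. real (c M) / real M)"
          unfolding c_def by (rule cross_by_orders[OF fin n p0])
        also have "\<dots> = (\<Sum>M | M dvd p ^ Suc a * r ^ b. h M)"
          unfolding lcm h_def using n unfolding n_def
          by (intro sum.mono_neutral_cong_left) auto
        also have "\<dots> = (\<Sum>i\<le>Suc a. \<Sum>j\<le>b. h (p ^ i * r ^ j))"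
          using sum_divisors_prime_power[OF p pr'(1)[of b], where a = "Suc a" and f = h] r1
            sum_divisors_prime_power'[OF r, of "\<lambda>d. h (p ^ _ * d)"] by simp
        \<comment> \<open>Split by the exponent of \<open>p\<close> in the order. Merging at
          \<open>p\<close> is available only for exponents at least \<open>2\<close>; merging at
          \<open>r\<close> is available for every order divisible by \<open>r\<close>.\<close>
        also have "\<dots> = (\<Sum>j\<le>b. h (r ^ j)) + (\<Sum>j\<le>b. h (p * r ^ j)) +
            (\<Sum>i<a. \<Sum>j\<le>b. h (p ^ Suc (Suc i) * r ^ j))"
          unfolding sum.atMost_shift[of _ "Suc a"] sum.lessThan_Suc_shift by simp
        finally have cross: "cross n p I x y = (\<Sum>j\<le>b. h (r ^ j)) + (\<Sum>j\<le>b. h (p * r ^ j)) +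
            (\<Sum>i<a. \<Sum>j\<le>b. h (p ^ Suc (Suc i) * r ^ j))" .
        have hr: "h (p ^ i * r ^ Suc j) \<le> 1 / (real p ^ i * real r ^ j)" for i j
        proof -
          have "c (p ^ i * r ^ Suc j) \<le> r"
            unfolding c_def using classes[OF r cofactor_dvd_coprime[OF r pr'(3)], of "p ^ i * r ^ j"]
            by (simp add: mult.left_commute)
          then have "h (p ^ i * r ^ Suc j) \<le> real r / real (p ^ i * r ^ Suc j)"
            unfolding h_def by (auto intro!: divide_right_mono simp del: power_Suc)
          also have "\<dots> = 1 / (real p ^ i * real r ^ j)" using r1 by simp
          finally show ?thesis .
        qed
        have hp: "h (p ^ Suc (Suc i) * r ^ j) \<le> 1 / (real p ^ Suc i * real r ^ j)" for i j
        proof -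
          have "cofactor_dvd p p (p ^ Suc i * r ^ j)" by (rule cofactor_dvdI) simp
          then have "c (p ^ Suc (Suc i) * r ^ j) \<le> p"
            unfolding c_def using classes[OF p] by (fastforce simp: mult.assoc)
          then have "h (p ^ Suc (Suc i) * r ^ j) \<le> real p / real (p ^ Suc (Suc i) * r ^ j)"
            unfolding h_def by (auto intro!: divide_right_mono simp del: power_Suc)
          also have "\<dots> = 1 / (real p ^ Suc i * real r ^ j)" using p1 by simp
          finally show ?thesis .
        qed
        have F0: "(\<Sum>j\<le>b. h (r ^ j)) \<le> geo r b - (if b > 0 then 2 / real r else 0)"
        proof -
          have "(\<Sum>j\<le>b. h (r ^ j)) = (\<Sum>j<b. h (r ^ Suc j))"
            unfolding sum.atMost_shift by (simp add: h_def)
          also have "\<dots> \<le> (\<Sum>j<b. 1 / real r ^ j - (if j = 0 then 2 / real r else 0))"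
          proof (rule sum_mono)
            fix j assume "j \<in> {..<b}"
            show "h (r ^ Suc j) \<le> 1 / real r ^ j - (if j = 0 then 2 / real r else 0)"
            proof (cases "j = 0")
              case True
              then have "real (c r) \<le> real r - 2" using v \<open>j \<in> {..<b}\<close> by auto
              then show ?thesis using True r1 by (simp add: h_def field_simps)
            next
              case False
              then show ?thesis using hr[of 0 j] by simp
            qed
          qed
          also have "\<dots> = geo r b - (if b > 0 then 2 / real r else 0)"
            by (simp add: sum_subtractf geo_def)
          finally show ?thesis .
        qed
        have F1: "(\<Sum>j\<le>b. h (p * r ^ j)) \<le> 2 - 2 / real p + geo r b / real p"
        proof -
          have "(\<Sum>j\<le>b. h (p * r ^ j)) = h p + (\<Sum>j<b. h (p ^ 1 * r ^ Suc j))"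
            unfolding sum.atMost_shift by simp
          also have "(\<Sum>j<b. h (p ^ 1 * r ^ Suc j)) \<le> (\<Sum>j<b. 1 / (real p ^ 1 * real r ^ j))"
            by (intro sum_mono hr)
          also have "\<dots> = geo r b / real p" by (simp add: geo_def sum_divide_distrib mult.commute)
          also have "h p \<le> 2 - 2 / real p"
          proof -
            have "real (c p) \<le> 2 * real p - 2" using u by linarith
            then show ?thesis using p1 by (simp add: h_def field_simps)
          qed
          finally show ?thesis by simp
        qed
        have F2: "(\<Sum>i<a. \<Sum>j\<le>b. h (p ^ Suc (Suc i) * r ^ j)) \<le> geo p a / real p * (1 + geo r b / real r)"
        proof -
          have "(\<Sum>i<a. \<Sum>j\<le>b. h (p ^ Suc (Suc i) * r ^ j)) \<le> (\<Sum>i<a. \<Sum>j\<le>b. 1 / (real p ^ Suc i * real r ^ j))"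
            by (intro sum_mono hp)
          also have "\<dots> = (\<Sum>i<a. 1 / real p ^ Suc i) * (\<Sum>j\<le>b. 1 / real r ^ j)"
            by (simp add: sum_product)
          also have "(\<Sum>i<a. 1 / real p ^ Suc i) = geo p a / real p"
            by (simp add: geo_def sum_divide_distrib mult.commute)
          also have "(\<Sum>j\<le>b. 1 / real r ^ j) = 1 + geo r b / real r"
            unfolding sum.atMost_shift by (simp add: geo_def sum_divide_distrib mult.commute)
          finally show ?thesis .
        qed
        have "cross n p I x y \<le> geo r b - (if b > 0 then 2 / real r else 0) + (2 - 2 / real p + geo r b / real p) +
            geo p a / real p * (1 + geo r b / real r)"
          unfolding cross using F0 F1 F2 by linarith
        also have "\<dots> \<le> geo p (Suc a) + geo r b + 1"
        proof (cases "b > 0")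
          case True
          \<comment> \<open>From \<open>r \<ge> 3\<close>. With it the \<open>2 / p\<close> saved on
            order \<open>p\<close> pays for the orders \<open>p r^j\<close>, and the
            \<open>2 / r\<close> saved on order \<open>r\<close> pays for the orders
            \<open>p^i r^j\<close> with \<open>i \<ge> 2\<close>, where \<open>j \<ge> 1\<close> in
            both.\<close>
          have Kr: "geo r b \<le> 2"
          proof -
            have "real r / (real r - 1) \<le> 2" using r3 by (simp add: field_simps)
            then show ?thesis using geo_le[OF r1, of b] by linarith
          qed
          have A1: "geo p a / real p \<le> 1"
          proof -
            have "real p / (real p - 1) \<le> real p" using p1 by (simp add: field_simps)
            then have "geo p a \<le> real p" by (rule order_trans[OF geo_le[OF p1]])
            then show ?thesis using p1 by simp
          qed
          have "geo r b / real p \<le> 2 / real p" using Kr by (intro divide_right_mono) auto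
          moreover have "geo p a / real p * (geo r b / real r) \<le> 1 * (2 / real r)"
            using A1 Kr geo_nonneg by (intro mult_mono divide_right_mono) auto
          ultimately show ?thesis using True by (simp add: geo_Suc distrib_left)
        next
          case False
          then show ?thesis using p1 by (simp add: geo_Suc)
        qed
        finally show ?thesis .
      qed
    qed
  qed
  then show ?case by (simp add: n_def)
qed

section \<open>The invariant \<open>K\<^sub>1\<^sup>*\<close>\<close>

lemma geo_formula:
  assumes "p > 1"
  shows "geo p (Suc b) = (real p ^ Suc b - 1) / (real p ^ Suc b - real p ^ b)"
proof -
  have *: "geo p (Suc b) * (real p ^ Suc b - real p ^ b) = real p ^ Suc b - 1"
  proof (induction b)
    case 0
    then show ?case by (simp add: geo_def)
  next
    case (Suc b)
    have "geo p (Suc (Suc b)) * (real p ^ Suc (Suc b) - real p ^ Suc b) =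
        (real p ^ Suc (Suc b) - real p ^ Suc b) + geo p (Suc b) * (real p ^ Suc b - real p ^ b)"
      unfolding geo_Suc[of p "Suc b"] using assms by (simp add: field_simps)
    then show ?case unfolding Suc by simp
  qed
  have "real p ^ b < real p ^ Suc b" using assms by simp
  then show ?thesis using * by (simp add: nonzero_eq_divide_eq del: power_Suc)
qed

section \<open>Uniqueness of the elementary divisors by counting torsion\<close>

lemma card_torsion_prime_power:
  assumes "prime (P::nat)" "prime (p::nat)"
  shows "card {x \<in> {0..<int (p ^ a)}. int (p ^ a) dvd int (P ^ j) * x} = (if p = P then P ^ min j a else 1)"
proof (cases "p = P")
  case False
  have p1: "p > 1" using assms prime_gt_1_nat by blast
  have "coprime (int (p ^ a)) (int (P ^ j))"
    using primes_coprime[OF assms(2,1) False] by simp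
  then have "{x \<in> {0..<int (p ^ a)}. int (p ^ a) dvd int (P ^ j) * x} = {x \<in> {0..<int (p ^ a)}. int (p ^ a) dvd x}"
    by (simp add: coprime_dvd_mult_right_iff)
  also have "\<dots> = {0}" using p1 by (auto dest: zdvd_imp_le)
  finally show ?thesis using False by simp
next
  case True
  have p1: "p > 1" using assms prime_gt_1_nat by blast
  show ?thesis
  proof (cases "j \<le> a")
    case False
    then have "int (p ^ a) dvd int (P ^ j) * x" for x
      unfolding True[symmetric] by (intro dvd_mult2) (simp add: le_imp_power_dvd)
    then have "{x \<in> {0..<int (p ^ a)}. int (p ^ a) dvd int (P ^ j) * x} = {0..<int (p ^ a)}" by auto
    then show ?thesis using True False by (simp add: min_def del: of_nat_power)
  next
    case le: True
    define d where "d = int (p ^ (a - j))"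
    have d: "int (p ^ a) = int (p ^ j) * d" "d > 0"
      using le p1 by (auto simp: d_def power_add[symmetric])
    have pj: "int (p ^ j) > 0" using p1 by simp
    have "{x \<in> {0..<int (p ^ a)}. int (p ^ a) dvd int (P ^ j) * x} = (\<lambda>t. d * t) ` {0..<int (p ^ j)}"
    proof (intro equalityI subsetI)
      fix x assume "x \<in> {x \<in> {0..<int (p ^ a)}. int (p ^ a) dvd int (P ^ j) * x}"
      then have x: "0 \<le> x" "x < int (p ^ j) * d" "int (p ^ j) * d dvd int (p ^ j) * x"
        using True d by auto
      then have "d dvd x" using p1 by simp
      then obtain t where t: "x = d * t" by blast
      have "0 \<le> t" "t < int (p ^ j)" using x(1,2) d(2) unfolding t
        by (auto simp: zero_le_mult_iff mult.commute[of d])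
      then show "x \<in> (\<lambda>t. d * t) ` {0..<int (p ^ j)}" using t by auto
    next
      fix x assume "x \<in> (\<lambda>t. d * t) ` {0..<int (p ^ j)}"
      then obtain t where tx: "x = d * t" and "t \<in> {0..<int (p ^ j)}" by (rule imageE)
      then have t: "x = d * t" "0 \<le> t" "t < int (p ^ j)" by simp_all
      then have "x < int (p ^ a)" "int (p ^ a) dvd int (P ^ j) * x"
        unfolding d(1) True[symmetric] using d(2) by (auto simp: mult.commute[of d] mult.assoc)
      then show "x \<in> {x \<in> {0..<int (p ^ a)}. int (p ^ a) dvd int (P ^ j) * x}" using t d(2) by auto
    qed
    then have "card {x \<in> {0..<int (p ^ a)}. int (p ^ a) dvd int (P ^ j) * x} = p ^ j"
      using d(2) by (simp add: card_image inj_on_def del: of_nat_power)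
    then show ?thesis using True le by (simp add: min_def)
  qed
qed

lemma carrier_sum_integer_mod_group:
  fixes m :: "nat \<Rightarrow> nat"
  assumes "\<And>i. i < r \<Longrightarrow> m i > 0"
  shows "carrier (sum_group {..<r} (\<lambda>i. integer_mod_group (m i))) = (\<Pi>\<^sub>E i\<in>{..<r}. {0..<int (m i)})"
proof -
  have "carrier (sum_group {..<r} (\<lambda>i. integer_mod_group (m i))) =
      (\<Pi>\<^sub>E i\<in>{..<r}. carrier (integer_mod_group (m i)))"
    by (subst carrier_sum_group) (auto intro!: finite_Collect_conjI)
  also have "\<dots> = (\<Pi>\<^sub>E i\<in>{..<r}. {0..<int (m i)})"
    using assms by (intro PiE_cong) (simp add: carrier_integer_mod_group)
  finally show ?thesis .
qed

lemma pow_sum_integer_mod_group: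
  fixes k :: nat and m :: "nat \<Rightarrow> nat"
  assumes m: "\<And>i. i < r \<Longrightarrow> m i > 0"
    and f: "f \<in> carrier (sum_group {..<r} (\<lambda>i. integer_mod_group (m i)))"
  shows "f [^]\<^bsub>sum_group {..<r} (\<lambda>i. integer_mod_group (m i))\<^esub> k =
    (\<lambda>i\<in>{..<r}. (int k * f i) mod int (m i))"
proof (induction k)
  case 0
  then show ?case by (simp add: restrict_def fun_eq_iff)
next
  case (Suc k)
  then show ?case
    by (auto simp: fun_eq_iff restrict_def algebra_simps mod_simps)
qed

text \<open>The left side refers to \<open>G\<close> alone, so the exponents on the right are the
  same for all decompositions.\<close>

lemma card_torsion_decomposition:
  assumes G: "group G" and dec: "prime_power_decomposition G r p \<alpha>" and P: "prime P"
  shows "card {u \<in> carrier G. u [^]\<^bsub>G\<^esub> (P ^ j) = \<one>\<^bsub>G\<^esub>} = P ^ (\<Sum>i<r. if p i = P then min j (\<alpha> i) else 0)"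
proof -
  define m where "m i = p i ^ \<alpha> i" for i
  let ?S = "sum_group {..<r} (\<lambda>i. integer_mod_group (m i))"
  have pr: "prime (p i)" if "i < r" for i
    using dec that by (simp add: prime_power_decomposition_def)
  have m: "m i > 0" if "i < r" for i using prime_gt_0_nat[OF pr[OF that]] by (simp add: m_def)
  have S: "group ?S" by simp
  obtain h where h: "h \<in> iso G ?S"
    using dec unfolding prime_power_decomposition_def is_iso_def m_def by blast
  then have hom: "h \<in> hom G ?S" and bij: "bij_betw h (carrier G) (carrier ?S)" by (auto simp: iso_def)
  let ?T = "{f \<in> carrier ?S. f [^]\<^bsub>?S\<^esub> (P ^ j) = \<one>\<^bsub>?S\<^esub>}"
  have inj: "inj_on h (carrier G)" using bij by (simp add: bij_betw_def)
  have pow: "h (u [^]\<^bsub>G\<^esub> (P ^ j)) = h u [^]\<^bsub>?S\<^esub> (P ^ j)" if "u \<in> carrier G" for u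
    using hom_nat_pow[OF hom that G S] .
  have one: "h \<one>\<^bsub>G\<^esub> = \<one>\<^bsub>?S\<^esub>" using hom_one[OF hom G S] .
  have tors: "h u [^]\<^bsub>?S\<^esub> (P ^ j) = \<one>\<^bsub>?S\<^esub> \<longleftrightarrow> u [^]\<^bsub>G\<^esub> (P ^ j) = \<one>\<^bsub>G\<^esub>" if "u \<in> carrier G" for u
    unfolding pow[OF that, symmetric] one[symmetric]
    using inj that G by (intro inj_on_eq_iff) (auto simp: group.is_monoid monoid.nat_pow_closed monoid.one_closed)
  have img: "h ` carrier G = carrier ?S" using bij by (simp add: bij_betw_def)
  have eT: "h ` {u \<in> carrier G. u [^]\<^bsub>G\<^esub> (P ^ j) = \<one>\<^bsub>G\<^esub>} = ?T"
  proof (intro equalityI subsetI)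
    fix f assume "f \<in> h ` {u \<in> carrier G. u [^]\<^bsub>G\<^esub> (P ^ j) = \<one>\<^bsub>G\<^esub>}"
    then obtain u where u: "f = h u" "u \<in> carrier G" "u [^]\<^bsub>G\<^esub> (P ^ j) = \<one>\<^bsub>G\<^esub>" by auto
    then show "f \<in> ?T" using tors[OF u(2)] imageI[OF u(2), of h] unfolding img by simp
  next
    fix f assume f: "f \<in> ?T"
    then have "f \<in> h ` carrier G" unfolding img by simp
    then obtain u where u: "f = h u" "u \<in> carrier G" by (rule imageE)
    then show "f \<in> h ` {u \<in> carrier G. u [^]\<^bsub>G\<^esub> (P ^ j) = \<one>\<^bsub>G\<^esub>}"
      using f tors[OF u(2)] by simp
  qed
  have iT: "inj_on h {u \<in> carrier G. u [^]\<^bsub>G\<^esub> (P ^ j) = \<one>\<^bsub>G\<^esub>}"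
    by (rule inj_on_subset[OF inj]) auto
  have "card {u \<in> carrier G. u [^]\<^bsub>G\<^esub> (P ^ j) = \<one>\<^bsub>G\<^esub>} = card ?T"
    unfolding eT[symmetric] by (rule card_image[OF iT, symmetric])
  also have "?T = (\<Pi>\<^sub>E i\<in>{..<r}. {x \<in> {0..<int (m i)}. int (m i) dvd int (P ^ j) * x})"
  proof -
    have "f [^]\<^bsub>?S\<^esub> (P ^ j) = \<one>\<^bsub>?S\<^esub> \<longleftrightarrow> (\<forall>i<r. int (m i) dvd int (P ^ j) * f i)"
      if "f \<in> carrier ?S" for f
    proof -
      have "f [^]\<^bsub>?S\<^esub> (P ^ j) = (\<lambda>i\<in>{..<r}. (int (P ^ j) * f i) mod int (m i))"
        using m that by (intro pow_sum_integer_mod_group) auto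
      then show ?thesis by (auto simp: fun_eq_iff restrict_def dvd_eq_mod_eq_0)
    qed
    then have T1: "?T = {f \<in> carrier ?S. \<forall>i<r. int (m i) dvd int (P ^ j) * f i}"
      by (intro Collect_cong conj_cong refl)
    have T2: "carrier ?S = (\<Pi>\<^sub>E i\<in>{..<r}. {0..<int (m i)})"
      using m by (intro carrier_sum_integer_mod_group) auto
    show ?thesis unfolding T1 unfolding T2
    proof (intro equalityI subsetI)
      fix f assume "f \<in> {f \<in> \<Pi>\<^sub>E i\<in>{..<r}. {0..<int (m i)}. \<forall>i<r. int (m i) dvd int (P ^ j) * f i}"
      then have f: "f \<in> (\<Pi>\<^sub>E i\<in>{..<r}. {0..<int (m i)})" "\<forall>i<r. int (m i) dvd int (P ^ j) * f i"
        by simp_all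
      show "f \<in> (\<Pi>\<^sub>E i\<in>{..<r}. {x \<in> {0..<int (m i)}. int (m i) dvd int (P ^ j) * x})"
        using PiE_mem[OF f(1)] PiE_arb[OF f(1)] f(2) by (intro PiE_I) simp_all
    next
      fix f assume f: "f \<in> (\<Pi>\<^sub>E i\<in>{..<r}. {x \<in> {0..<int (m i)}. int (m i) dvd int (P ^ j) * x})"
      have "f \<in> (\<Pi>\<^sub>E i\<in>{..<r}. {0..<int (m i)})"
        using PiE_mem[OF f] PiE_arb[OF f] by (intro PiE_I) simp_all
      then show "f \<in> {f \<in> \<Pi>\<^sub>E i\<in>{..<r}. {0..<int (m i)}. \<forall>i<r. int (m i) dvd int (P ^ j) * f i}"
        using PiE_mem[OF f] by simp
    qed
  qed
  also have "card \<dots> = (\<Prod>i<r. card {x \<in> {0..<int (m i)}. int (m i) dvd int (P ^ j) * x})"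
    by (simp add: card_PiE)
  also have "\<dots> = (\<Prod>i<r. P ^ (if p i = P then min j (\<alpha> i) else 0))"
    using card_torsion_prime_power[OF P pr] unfolding m_def by (intro prod.cong) auto
  also have "\<dots> = P ^ (\<Sum>i<r. if p i = P then min j (\<alpha> i) else 0)"
    by (simp add: power_sum)
  finally show ?thesis .
qed

lemma geo_min_sum:
  assumes "a \<le> J"
  shows "geo p a = (\<Sum>j<J. (real (min (Suc j) a) - real (min j a)) / real p ^ j)"
proof -
  have "(\<Sum>j<J. (real (min (Suc j) a) - real (min j a)) / real p ^ j) =
      (\<Sum>j<J. if j < a then 1 / real p ^ j else 0)"
    by (intro sum.cong) (auto simp: min_def)
  also have "\<dots> = geo p a"
    unfolding geo_def using assms by (intro sum.mono_neutral_cong_right) auto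
  finally show ?thesis by simp
qed

text \<open>The difference of consecutive torsion exponents counts the summands for \<open>P\<close>
  with \<open>\<alpha> i > j\<close>, and each of these has the term \<open>1 / P^j\<close> in its
  \<open>geo\<close>. The sum thus depends only on the torsion counts.\<close>

lemma decomposition_sum:
  assumes J: "\<And>i. i < r \<Longrightarrow> \<alpha> i \<le> J" and PP: "finite PP" "\<And>i. i < r \<Longrightarrow> p i \<in> PP"
  shows "(\<Sum>i<r. geo (p i) (\<alpha> i)) = (\<Sum>P\<in>PP. \<Sum>j<J.
    (real (\<Sum>i<r. if p i = P then min (Suc j) (\<alpha> i) else 0) -
     real (\<Sum>i<r. if p i = P then min j (\<alpha> i) else 0)) / real P ^ j)"
proof -
  have "(\<Sum>i<r. geo (p i) (\<alpha> i)) =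
      (\<Sum>i<r. \<Sum>j<J. (real (min (Suc j) (\<alpha> i)) - real (min j (\<alpha> i))) / real (p i) ^ j)"
    using geo_min_sum[OF J] by (intro sum.cong) auto
  also have "\<dots> = (\<Sum>i<r. \<Sum>P\<in>PP. \<Sum>j<J. (if p i = P then real (min (Suc j) (\<alpha> i)) - real (min j (\<alpha> i)) else 0) / real P ^ j)"
  proof (rule sum.cong[OF refl])
    fix i assume "i \<in> {..<r}"
    then have "p i \<in> PP" using PP by auto
    then show "(\<Sum>j<J. (real (min (Suc j) (\<alpha> i)) - real (min j (\<alpha> i))) / real (p i) ^ j) =
        (\<Sum>P\<in>PP. \<Sum>j<J. (if p i = P then real (min (Suc j) (\<alpha> i)) - real (min j (\<alpha> i)) else 0) / real P ^ j)"
      using PP(1) by (subst sum.remove[of PP "p i"]) (auto intro!: sum.neutral)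
  qed
  also have "\<dots> = (\<Sum>P\<in>PP. \<Sum>j<J. \<Sum>i<r. (if p i = P then real (min (Suc j) (\<alpha> i)) - real (min j (\<alpha> i)) else 0) / real P ^ j)"
    by (subst sum.swap) (intro sum.cong refl sum.swap)
  also have "\<dots> = (\<Sum>P\<in>PP. \<Sum>j<J.
    (real (\<Sum>i<r. if p i = P then min (Suc j) (\<alpha> i) else 0) -
     real (\<Sum>i<r. if p i = P then min j (\<alpha> i) else 0)) / real P ^ j)"
    unfolding of_nat_sum sum_subtractf[symmetric] sum_divide_distrib
    by (intro sum.cong refl) auto
  finally show ?thesis .
qed

lemma K1_star_eq:
  assumes G: "group G" and dec: "prime_power_decomposition G r p \<alpha>"
  shows "K1_star G = (\<Sum>i<r. geo (p i) (\<alpha> i))"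
proof -
  have eq: "(\<Sum>i<r'. (real (p' i) ^ \<alpha>' i - 1) / (real (p' i) ^ \<alpha>' i - real (p' i) ^ (\<alpha>' i - 1))) =
      (\<Sum>i<r'. geo (p' i) (\<alpha>' i))" if "prime_power_decomposition G r' p' \<alpha>'" for r' p' \<alpha>'
  proof (intro sum.cong refl)
    fix i assume "i \<in> {..<r'}"
    then have "prime (p' i)" "0 < \<alpha>' i" using that by (auto simp: prime_power_decomposition_def)
    then show "(real (p' i) ^ \<alpha>' i - 1) / (real (p' i) ^ \<alpha>' i - real (p' i) ^ (\<alpha>' i - 1)) = geo (p' i) (\<alpha>' i)"
      using geo_formula[of "p' i" "\<alpha>' i - 1"] prime_gt_1_nat[of "p' i"] by simp
  qed
  show ?thesis
    unfolding K1_star_def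
  proof (rule the_equality)
    show "\<exists>r' p' \<alpha>'. prime_power_decomposition G r' p' \<alpha>' \<and> (\<Sum>i<r. geo (p i) (\<alpha> i)) =
        (\<Sum>i<r'. (real (p' i) ^ \<alpha>' i - 1) / (real (p' i) ^ \<alpha>' i - real (p' i) ^ (\<alpha>' i - 1)))"
      using dec eq[OF dec] by (intro exI[of _ r] exI[of _ p] exI[of _ \<alpha>]) simp
  next
    fix x assume "\<exists>r' p' \<alpha>'. prime_power_decomposition G r' p' \<alpha>' \<and> x =
        (\<Sum>i<r'. (real (p' i) ^ \<alpha>' i - 1) / (real (p' i) ^ \<alpha>' i - real (p' i) ^ (\<alpha>' i - 1)))"
    then obtain r' p' \<alpha>' where dec': "prime_power_decomposition G r' p' \<alpha>'"
      and "x = (\<Sum>i<r'. (real (p' i) ^ \<alpha>' i - 1) / (real (p' i) ^ \<alpha>' i - real (p' i) ^ (\<alpha>' i - 1)))"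
      by (elim exE conjE)
    then have x: "x = (\<Sum>i<r'. geo (p' i) (\<alpha>' i))" unfolding eq[OF dec'] by simp
    \<comment> \<open>A common set of primes, and below a common bound for the exponents, make both
      sums range over the same indices.\<close>
    define PP where "PP = p ` {..<r} \<union> p' ` {..<r'}"
    define J where "J = Max (insert 0 (\<alpha> ` {..<r} \<union> \<alpha>' ` {..<r'}))"
    have J: "\<alpha> i \<le> J" if "i < r" for i unfolding J_def using that by (intro Max_ge) auto
    have J': "\<alpha>' i \<le> J" if "i < r'" for i unfolding J_def using that by (intro Max_ge) auto
    have prime: "prime P" if "P \<in> PP" for P
      using that dec dec' by (auto simp: PP_def prime_power_decomposition_def)
    have "(\<Sum>i<r. if p i = P then min j (\<alpha> i) else 0) = (\<Sum>i<r'. if p' i = P then min j (\<alpha>' i) else 0)"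
      if "P \<in> PP" for P j
    proof -
      have "P > 1" using prime[OF that] prime_gt_1_nat by blast
      then show ?thesis
        using card_torsion_decomposition[OF G dec prime[OF that], of j]
          card_torsion_decomposition[OF G dec' prime[OF that], of j] by simp
    qed
    then show "x = (\<Sum>i<r. geo (p i) (\<alpha> i))"
      unfolding x
      by (subst (1 2) decomposition_sum[where PP = PP and J = J])
        (auto simp: J J' PP_def simp del: of_nat_sum intro!: sum.cong)
  qed
qed

section \<open>Unique factorization indexed sequences\<close>

lemma zmod_shift:
  assumes "zmod n q (a - a') (b - b')"
  shows "zmod n q a b \<longleftrightarrow> zmod n q a' b'"
  using zmod_add[OF assms, of a' b'] zmod_diff[of n q a b "a - a'" "b - b'"] assms by auto

lemma zmod_trans:
  assumes "zmod n q (a - b) (a' - b')" "zmod n q (b - c) (b' - c')"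
  shows "zmod n q (a - c) (a' - c')"
  using zmod_add[OF assms] by simp

section \<open>Indexed sequences as finite sets of terms\<close>

lemma vbar_empty [simp]: "vbar g {#} = 0"
  by (simp add: vbar_def)

lemma vbar_add_mset: "vbar g (add_mset a M) = (if fst a = g then 1 else 0) + vbar g M"
  by (simp add: vbar_def)

lemma sum_vbar:
  fixes w :: "'a \<Rightarrow> 'c :: comm_semiring_1"
  assumes "finite N" "fst ` set_mset M \<subseteq> N"
  shows "(\<Sum>g\<in>N. of_nat (vbar g M) * w g) = (\<Sum>a\<in>#M. w (fst a))"
  using assms(2)
proof (induction M)
  case (add a M)
  have "(\<Sum>g\<in>N. of_nat (vbar g (add_mset a M)) * w g) =
      (\<Sum>g\<in>N. (if fst a = g then w g else 0) + of_nat (vbar g M) * w g)"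
    by (intro sum.cong) (auto simp: vbar_add_mset distrib_right)
  also have "\<dots> = w (fst a) + (\<Sum>g\<in>N. of_nat (vbar g M) * w g)"
    using add.prems assms(1) by (simp add: sum.distrib)
  finally show ?case using add by simp
qed simp

lemma indexed_sequence_mset_set:
  "finite A \<Longrightarrow> A \<subseteq> nonzero G \<times> UNIV \<Longrightarrow> indexed_sequence G (mset_set A)"
  by (auto simp: indexed_sequence_def count_mset_set')

lemma indexed_sequence_eq_mset_set:
  assumes "indexed_sequence G M"
  shows "mset_set (set_mset M) = M"
proof (rule multiset_eqI)
  fix a
  have "count M a \<le> 1" using assms unfolding indexed_sequence_def by blast
  then have "count M a = (if a \<in># M then 1 else 0)"
  proof (cases "a \<in># M")
    case True
    then have "count M a > 0" by simp
    then show ?thesis using True \<open>count M a \<le> 1\<close> by (simp del: count_greater_zero_iff)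
  qed (simp add: not_in_iff)
  then show "count (mset_set (set_mset M)) a = count M a"
    by (simp add: count_mset_set')
qed

lemma indexed_sequence_subset:
  assumes "indexed_sequence G M" "T \<subseteq># M"
  shows "indexed_sequence G T"
proof -
  have "count T a \<le> count M a" for a using assms(2) by (rule mset_subset_eq_count)
  then show ?thesis
    using assms(1) set_mset_mono[OF assms(2)] unfolding indexed_sequence_def
    by (meson order_trans)
qed

lemma member_subset_sum_mset: "B \<in># F \<Longrightarrow> B \<subseteq># sum_mset F"
  by (auto dest!: multi_member_split)

text \<open>The coordinates \<open>X\<close> and \<open>Y\<close> induce an isomorphism onto the sum
  of the cyclic groups of orders \<open>n\<close> and \<open>q\<close>: \<open>one_iff\<close> is
  injectivity, \<open>surj\<close> surjectivity. All conditions are modular, so any integer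
  representatives will do.\<close>

locale modelled_group = comm_group G for G :: "('a, 'b) monoid_scheme" (structure) +
  fixes X Y :: "'a \<Rightarrow> int" and n q :: nat
  assumes pos: "n > 0" "q > 0" and fin: "finite (carrier G)"
    and hom: "u \<in> carrier G \<Longrightarrow> v \<in> carrier G \<Longrightarrow> zmod n q (X (u \<otimes> v) - (X u + X v)) (Y (u \<otimes> v) - (Y u + Y v))"
    and one_iff: "u \<in> carrier G \<Longrightarrow> u = \<one> \<longleftrightarrow> zmod n q (X u) (Y u)"
    and surj: "\<exists>u\<in>carrier G. zmod n q (X u - a) (Y u - b)"
begin

lemma pow_zmod:
  fixes k :: nat
  assumes "u \<in> carrier G"
  shows "zmod n q (X (u [^] k) - int k * X u) (Y (u [^] k) - int k * Y u)"
proof (induction k)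
  case 0
  then show ?case using one_iff[of \<one>] by simp
next
  case (Suc k)
  have "zmod n q (X (u [^] k \<otimes> u) - (X (u [^] k) + X u)) (Y (u [^] k \<otimes> u) - (Y (u [^] k) + Y u))"
    using assms by (intro hom) auto
  from zmod_add[OF this Suc] show ?case by (simp add: algebra_simps)
qed

lemma finprod_zmod:
  assumes "finite A" "f \<in> A \<rightarrow> carrier G"
  shows "zmod n q (X (finprod G f A) - (\<Sum>a\<in>A. X (f a))) (Y (finprod G f A) - (\<Sum>a\<in>A. Y (f a)))"
  using assms
proof (induction A rule: finite_induct)
  case empty
  then show ?case using one_iff[of \<one>] by simp
next
  case (insert a A)
  have "zmod n q (X (f a \<otimes> finprod G f A) - (X (f a) + X (finprod G f A)))
     (Y (f a \<otimes> finprod G f A) - (Y (f a) + Y (finprod G f A)))"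
    using insert.prems by (intro hom) auto
  moreover have "zmod n q (X (finprod G f A) - (\<Sum>a\<in>A. X (f a))) (Y (finprod G f A) - (\<Sum>a\<in>A. Y (f a)))"
    using insert by auto
  ultimately show ?case
    using insert zmod_add by (fastforce simp: algebra_simps)
qed

lemma ord_eq:
  assumes "u \<in> carrier G"
  shows "ord u = ord_mod n q (X u) (Y u)"
proof (rule ord_mod_unique[symmetric, OF pos])
  fix k
  have "ord u dvd k \<longleftrightarrow> u [^] k = \<one>" using pow_eq_id[OF assms] by simp
  also have "\<dots> \<longleftrightarrow> zmod n q (X (u [^] k)) (Y (u [^] k))" using assms by (intro one_iff) auto
  also have "\<dots> \<longleftrightarrow> zmod n q (int k * X u) (int k * Y u)" by (rule zmod_shift[OF pow_zmod[OF assms]])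
  finally show "ord u dvd k \<longleftrightarrow> zmod n q (int k * X u) (int k * Y u)" .
qed

definition ztotal :: "('a \<times> nat) multiset \<Rightarrow> bool" where
  "ztotal M \<longleftrightarrow> zmod n q (\<Sum>a\<in>#M. X (fst a)) (\<Sum>a\<in>#M. Y (fst a))"

lemma ztotal_empty: "ztotal {#}"
  by (simp add: ztotal_def)

lemma ztotal_add: "ztotal M \<Longrightarrow> ztotal N \<Longrightarrow> ztotal (M + N)"
  using zmod_add by (simp add: ztotal_def)

lemma ztotal_add_cancel: "ztotal (M + N) \<Longrightarrow> ztotal M \<Longrightarrow> ztotal N"
  using zmod_diff[of n q "(\<Sum>a\<in>#M + N. X (fst a))" "(\<Sum>a\<in>#M + N. Y (fst a))" "\<Sum>a\<in>#M. X (fst a)" "\<Sum>a\<in>#M. Y (fst a)"]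
  by (simp add: ztotal_def)

lemma ztotal_sum_mset: "(\<And>B. B \<in># F \<Longrightarrow> ztotal (g B)) \<Longrightarrow> ztotal (\<Sum>B\<in>#F. g B)"
  by (induction F) (auto intro: ztotal_empty ztotal_add)

lemma ztotal_mset_set: "ztotal (mset_set A) \<longleftrightarrow> zmod n q (\<Sum>a\<in>A. X (fst a)) (\<Sum>a\<in>A. Y (fst a))"
  by (simp add: ztotal_def sum_unfold_sum_mset)

lemma finite_nonzero: "finite (nonzero G)"
  using fin by (simp add: nonzero_def)

lemma sigma_bar_eq_one_iff:
  assumes "set_mset M \<subseteq> nonzero G \<times> UNIV"
  shows "sigma_bar G M = \<one> \<longleftrightarrow> ztotal M"
proof -
  let ?f = "\<lambda>g. g [^] vbar g M"
  have f: "?f \<in> nonzero G \<rightarrow> carrier G" by (auto simp: nonzero_def)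
  have 1: "zmod n q (X (sigma_bar G M) - (\<Sum>g\<in>nonzero G. X (?f g))) (Y (sigma_bar G M) - (\<Sum>g\<in>nonzero G. Y (?f g)))"
    unfolding sigma_bar_def by (rule finprod_zmod[OF finite_nonzero f])
  have p: "zmod n q (X (?f g) - int (vbar g M) * X g) (Y (?f g) - int (vbar g M) * Y g)" if "g \<in> nonzero G" for g
    using that by (intro pow_zmod) (auto simp: nonzero_def)
  have 2: "zmod n q ((\<Sum>g\<in>nonzero G. X (?f g)) - (\<Sum>g\<in>nonzero G. int (vbar g M) * X g))
      ((\<Sum>g\<in>nonzero G. Y (?f g)) - (\<Sum>g\<in>nonzero G. int (vbar g M) * Y g))"
    unfolding sum_subtractf[symmetric] zmod_def
    using dvd_sum[of "nonzero G" "int n" "\<lambda>g. X (?f g) - int (vbar g M) * X g"]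
      dvd_sum[of "nonzero G" "int q" "\<lambda>g. Y (?f g) - int (vbar g M) * Y g"] p
    by (auto simp: zmod_def)
  have sub: "fst ` set_mset M \<subseteq> nonzero G" using assms by auto
  have "sigma_bar G M \<in> carrier G" unfolding sigma_bar_def using f by (rule finprod_closed)
  then have "sigma_bar G M = \<one> \<longleftrightarrow> zmod n q (X (sigma_bar G M)) (Y (sigma_bar G M))" by (rule one_iff)
  also have "\<dots> \<longleftrightarrow> zmod n q (\<Sum>g\<in>nonzero G. int (vbar g M) * X g) (\<Sum>g\<in>nonzero G. int (vbar g M) * Y g)"
    by (rule zmod_shift[OF zmod_trans[OF 1 2]])
  also have "\<dots> \<longleftrightarrow> ztotal M"
    using sum_vbar[OF finite_nonzero sub, of X] sum_vbar[OF finite_nonzero sub, of Y]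
    by (simp add: ztotal_def)
  finally show ?thesis .
qed

lemma zero_sum_iff: "zero_sum G M \<longleftrightarrow> indexed_sequence G M \<and> ztotal M"
  using sigma_bar_eq_one_iff by (auto simp: zero_sum_def indexed_sequence_def)

text \<open>A nonempty zero-sum subsequence of least size is irreducible; its removal leaves a
  shorter zero-sum sequence.\<close>

lemma ex_irreducible_factorization:
  "zero_sum G M \<Longrightarrow> \<exists>F. irreducible_factorization G M F"
proof (induction "size M" arbitrary: M rule: less_induct)
  case less
  show ?case
  proof (cases "M = {#}")
    case True
    then show ?thesis by (intro exI[of _ "{#}"]) (simp add: irreducible_factorization_def)
  next
    case False
    let ?P = "\<lambda>T. T \<subseteq># M \<and> T \<noteq> {#} \<and> zero_sum G T"
    have "?P M" using False less.prems by simp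
    from ex_has_least_nat[of ?P, OF this, of size] obtain T
      where T: "T \<subseteq># M" "T \<noteq> {#}" "zero_sum G T" and min: "\<forall>T'. ?P T' \<longrightarrow> size T \<le> size T'"
      by (elim exE conjE) simp
    have irr: "irreducible_seq G T"
      unfolding irreducible_seq_def
    proof (intro conjI allI impI notI)
      fix T' assume T': "T' \<subset># T \<and> T' \<noteq> {#}" "zero_sum G T'"
      then have "?P T'" using T(1) by (meson subset_mset.less_imp_le subset_mset.order_trans)
      then have "size T \<le> size T'" using min by blast
      moreover have "size T' < size T" using T' by (intro mset_subset_size) simp
      ultimately show False by simp
    qed (use T in auto)
    have M: "T + (M - T) = M" using T(1) by simp
    have "ztotal (M - T)"
      using ztotal_add_cancel[of T "M - T"] less.prems T(3) unfolding M zero_sum_iff by blast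
    then have "zero_sum G (M - T)"
      using less.prems indexed_sequence_subset[of G M "M - T"] unfolding zero_sum_iff by auto
    moreover have "size (M - T) < size M"
      using T by (simp add: size_Diff_submset size_mset_mono nonempty_has_size diff_less[OF _ order_less_le_trans])
    ultimately obtain F where "irreducible_factorization G (M - T) F" using less.hyps by blast
    then have "irreducible_factorization G M (add_mset T F)"
      using irr M by (simp add: irreducible_factorization_def)
    then show ?thesis by blast
  qed
qed

text \<open>Factorizations of a zero-sum subset and of its complement combine to the unique
  factorization, so every irreducible factor lies inside or outside the subset. Hence
  \<open>S \<inter> T\<close> is composed of those factors of \<open>T\<close> that lie in
  \<open>S\<close>.\<close>

lemma UFIS_imp_ufam:
  assumes A: "finite A" "A \<subseteq> nonzero G \<times> UNIV" and U: "UFIS G (mset_set A)"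
  shows "ufam n q A (X \<circ> fst) (Y \<circ> fst)"
proof (rule ufamI[OF A(1)])
  obtain F where uniq: "\<And>F'. irreducible_factorization G (mset_set A) F' \<Longrightarrow> F' = F"
    using U unfolding UFIS_def by blast
  have zA: "ztotal (mset_set A)" using U unfolding UFIS_def zero_sum_iff by blast
  have fact: "\<exists>F1 F2. irreducible_factorization G (mset_set B) F1 \<and> irreducible_factorization G (mset_set (A - B)) F2 \<and> F1 + F2 = F"
    if B: "B \<subseteq> A" "ztotal (mset_set B)" for B
  proof -
    have finB: "finite B" using B A finite_subset by blast
    have un: "mset_set B + mset_set (A - B) = mset_set A"
      using B A finB by (subst mset_set_Union[symmetric]) (auto intro: arg_cong[of _ _ mset_set])
    have "ztotal (mset_set (A - B))" using ztotal_add_cancel[of "mset_set B" "mset_set (A - B)"] zA B(2) unfolding un by simp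
    then have "zero_sum G (mset_set B)" "zero_sum G (mset_set (A - B))"
      unfolding zero_sum_iff using A B finB by (auto intro!: indexed_sequence_mset_set)
    then obtain F1 F2 where F: "irreducible_factorization G (mset_set B) F1" "irreducible_factorization G (mset_set (A - B)) F2"
      using ex_irreducible_factorization by blast
    then have "irreducible_factorization G (mset_set A) (F1 + F2)"
      unfolding irreducible_factorization_def un[symmetric] by auto
    then show ?thesis using F uniq by blast
  qed
  fix S T
  assume ST: "S \<subseteq> A" "T \<subseteq> A" "zsum n q (X \<circ> fst) (Y \<circ> fst) S" "zsum n q (X \<circ> fst) (Y \<circ> fst) T"
  then have zST: "ztotal (mset_set S)" "ztotal (mset_set T)" by (auto simp: ztotal_mset_set comp_def)
  obtain F1 F2 where F: "irreducible_factorization G (mset_set S) F1" "irreducible_factorization G (mset_set (A - S)) F2" "F1 + F2 = F"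
    using fact[OF ST(1) zST(1)] by blast
  obtain F3 F4 where F': "irreducible_factorization G (mset_set T) F3" "irreducible_factorization G (mset_set (A - T)) F4" "F3 + F4 = F"
    using fact[OF ST(2) zST(2)] by blast
  have fins: "finite S" "finite T" using ST A finite_subset by blast+
  have mem: "set_mset B \<subseteq> C" if "irreducible_factorization G (mset_set C) F0" "B \<in># F0" "finite C" for B C F0
  proof -
    have "B \<subseteq># mset_set C"
      using member_subset_sum_mset[OF that(2)] that(1) by (simp add: irreducible_factorization_def)
    from set_mset_mono[OF this] show ?thesis using that(3) by simp
  qed
  have filt: "ztotal (filter_mset (\<lambda>a. a \<in> S) B)" if "B \<in># F3" for B
  proof -
    have "B \<in># F1 + F2" using that unfolding F(3) F'(3)[symmetric] by simp
    then consider "B \<in># F1" | "B \<in># F2" unfolding union_iff by blast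
    then show ?thesis
    proof cases
      case 1
      have "set_mset B \<subseteq> S" by (rule mem[OF F(1) 1 fins(1)])
      then have "filter_mset (\<lambda>a. a \<in> S) B = B"
        by (intro multiset_eqI) (auto simp: count_eq_zero_iff)
      moreover have "ztotal B" using that F'(1) unfolding irreducible_factorization_def irreducible_seq_def zero_sum_iff by blast
      ultimately show ?thesis by simp
    next
      case 2
      have "set_mset B \<subseteq> A - S" using mem[OF F(2) 2] A by simp
      then have "filter_mset (\<lambda>a. a \<in> S) B = {#}" by (intro multiset_eqI) (auto simp: count_eq_zero_iff)
      then show ?thesis by (simp only: ztotal_empty)
    qed
  qed
  have fs: "filter_mset (\<lambda>a. a \<in> S) (sum_mset K) = (\<Sum>B\<in>#K. filter_mset (\<lambda>a. a \<in> S) B)" for K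
    by (induction K) auto
  have "sum_mset F3 = mset_set T" using F'(1) by (simp add: irreducible_factorization_def)
  then have "filter_mset (\<lambda>a. a \<in> S) (mset_set T) = (\<Sum>B\<in>#F3. filter_mset (\<lambda>a. a \<in> S) B)"
    using fs[of F3] by (simp only:)
  then have "ztotal (filter_mset (\<lambda>a. a \<in> S) (mset_set T))"
    using ztotal_sum_mset[of F3, OF filt] by (simp only:)
  also have "filter_mset (\<lambda>a. a \<in> S) (mset_set T) = mset_set (S \<inter> T)"
    using fins by (simp add: Int_def conj_commute)
  finally show "zsum n q (X \<circ> fst) (Y \<circ> fst) (S \<inter> T)"
    by (simp add: ztotal_mset_set comp_def)
qed

text \<open>If factors from two factorizations share a term, their intersection is zero-sum and
  nonempty, so irreducibility makes them equal.\<close>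

lemma ufam_imp_UFIS:
  assumes A: "finite A" "A \<subseteq> nonzero G \<times> UNIV" and ufam: "ufam n q A (X \<circ> fst) (Y \<circ> fst)"
    and z: "zsum n q (X \<circ> fst) (Y \<circ> fst) A"
  shows "UFIS G (mset_set A)"
proof -
  have zA: "zero_sum G (mset_set A)"
    using z A indexed_sequence_mset_set by (auto simp: zero_sum_iff ztotal_mset_set comp_def)
  have memb: "B \<subseteq># mset_set A" if "irreducible_factorization G (mset_set A) F" "B \<in># F" for B F
    using member_subset_sum_mset[OF that(2)] that(1) by (simp add: irreducible_factorization_def)
  have irr: "irreducible_seq G B" if "irreducible_factorization G (mset_set A) F" "B \<in># F" for B F
    using that by (simp add: irreducible_factorization_def)
  \<comment> \<open>Factorizations are compared as multisets, so repeated factors must be excluded;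
    they would contradict squarefreeness.\<close>
  have le1: "count F B \<le> 1" if F: "irreducible_factorization G (mset_set A) F" for B F
  proof (rule ccontr)
    assume "\<not> count F B \<le> 1"
    then have "count F B > 0" by linarith
    then have "B \<in># F" by simp
    then obtain K1 where K1: "F = add_mset B K1" by (auto dest: multi_member_split)
    then have "count K1 B > 0" using \<open>\<not> count F B \<le> 1\<close> by (simp del: count_greater_zero_iff)
    then have "B \<in># K1" by simp
    then obtain K where K: "F = {#B, B#} + K" using K1 by (auto dest: multi_member_split)
    have "B \<noteq> {#}" using irr[OF F, of B] K by (auto simp: irreducible_seq_def)
    then obtain a where "a \<in># B" by auto
    then have "count B a > 0" by simp
    then have "count (sum_mset F) a \<ge> 2" unfolding K by (simp del: count_greater_zero_iff)
    moreover have "sum_mset F = mset_set A" using F by (simp add: irreducible_factorization_def)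
    ultimately show False by (simp add: count_mset_set' split: if_splits)
  qed
  have sub: "B \<in># F'" if F: "irreducible_factorization G (mset_set A) F" and F': "irreducible_factorization G (mset_set A) F'"
    and B: "B \<in># F" for B F F'
  proof -
    have "B \<noteq> {#}" using irr[OF F B] by (simp add: irreducible_seq_def)
    then obtain a where a: "a \<in># B" by auto
    then have "a \<in># mset_set A" using memb[OF F B] by (rule mset_subset_eqD[rotated])
    then have "a \<in># sum_mset F'" using F' by (simp add: irreducible_factorization_def)
    then obtain B' where B': "B' \<in># F'" "a \<in># B'" by (auto simp: in_Union_mset_iff)
    have ind: "indexed_sequence G (mset_set A)" using zA by (simp add: zero_sum_iff)
    define C where "C = set_mset B"
    define C' where "C' = set_mset B'"
    have BC: "B = mset_set C" "B' = mset_set C'"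
      using indexed_sequence_eq_mset_set[OF indexed_sequence_subset[OF ind memb[OF F B]]]
        indexed_sequence_eq_mset_set[OF indexed_sequence_subset[OF ind memb[OF F' B'(1)]]]
      by (simp_all add: C_def C'_def)
    have CA: "C \<subseteq> A" "C' \<subseteq> A"
      using set_mset_mono[OF memb[OF F B]] set_mset_mono[OF memb[OF F' B'(1)]] A(1) by (simp_all add: C_def C'_def)
    have finC: "finite C" "finite C'" by (simp_all add: C_def C'_def)
    have "ztotal B" "ztotal B'"
      using irr[OF F B] irr[OF F' B'(1)] by (auto simp: irreducible_seq_def zero_sum_iff)
    then have "ztotal (mset_set (C \<inter> C'))"
      using ufam_Int[OF ufam CA] unfolding BC ztotal_mset_set comp_def by blast
    then have zI: "zero_sum G (mset_set (C \<inter> C'))"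
      unfolding zero_sum_iff using A CA finC by (auto intro!: indexed_sequence_mset_set)
    have ne: "mset_set (C \<inter> C') \<noteq> {#}"
      using a B'(2) finC by (auto simp: mset_set_empty_iff C_def C'_def)
    have minimal: "C \<inter> C' = D" if D: "irreducible_seq G (mset_set D)" "C \<inter> C' \<subseteq> D" "finite D" for D
    proof (rule ccontr)
      assume "C \<inter> C' \<noteq> D"
      then have "mset_set (C \<inter> C') \<subset># mset_set D"
        using D finC by (auto simp: subset_mset_def subset_imp_msubset_mset_set)
      then show False using D(1) zI ne by (auto simp: irreducible_seq_def)
    qed
    have "C \<inter> C' = C" "C \<inter> C' = C'"
      using irr[OF F B] irr[OF F' B'(1)] finC by (intro minimal; simp add: BC)+
    then show ?thesis using B'(1) BC by simp
  qed
  have "F = F'" if F: "irreducible_factorization G (mset_set A) F" and F': "irreducible_factorization G (mset_set A) F'"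
    for F F'
  proof (rule multiset_eqI)
    fix B
    show "count F B = count F' B"
      using le1[OF F, of B] le1[OF F', of B] sub[OF F F', of B] sub[OF F' F, of B]
        count_greater_zero_iff[of F B] count_greater_zero_iff[of F' B] by linarith
  qed
  then show ?thesis
    unfolding UFIS_def using zA ex_irreducible_factorization[OF zA] by blast
qed

lemma cross_number_eq:
  assumes A: "finite A" "A \<subseteq> nonzero G \<times> UNIV"
  shows "cross_number G (mset_set A) = cross n q A (X \<circ> fst) (Y \<circ> fst)"
proof -
  have sub: "fst ` set_mset (mset_set A) \<subseteq> nonzero G" using A by auto
  have "cross_number G (mset_set A) = (\<Sum>a\<in>#mset_set A. 1 / real (ord (fst a)))"
    using sum_vbar[OF finite_nonzero sub, of "\<lambda>g. 1 / real (ord g)"]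
    by (simp add: cross_number_def)
  also have "\<dots> = (\<Sum>a\<in>A. 1 / real (ord (fst a)))" by (simp add: sum_unfold_sum_mset)
  also have "\<dots> = cross n q A (X \<circ> fst) (Y \<circ> fst)"
    unfolding cross_def
  proof (intro sum.cong refl)
    fix a assume "a \<in> A"
    then have "fst a \<in> carrier G" "fst a \<noteq> \<one>" using A by (auto simp: nonzero_def)
    then show "1 / real (ord (fst a)) = weight n q ((X \<circ> fst) a) ((Y \<circ> fst) a)"
      using one_iff[of "fst a"] ord_eq[of "fst a"] by (simp add: weight_def)
  qed
  finally show ?thesis .
qed

end

text \<open>Unlike in \<open>cross_bd\<close>, the terms are nonzero and the total is zero, since
  the family has to yield a UFIS.\<close>

definition attained :: "nat \<Rightarrow> nat \<Rightarrow> real \<Rightarrow> bool" where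
  "attained n q B \<longleftrightarrow> (\<exists>(I :: nat set) x y. ufam n q I x y \<and> zsum n q x y I \<and>
     (\<forall>i\<in>I. \<not> zmod n q (x i) (y i)) \<and> cross n q I x y = B)"

text \<open>Cross numbers lie in a discrete set, so that an upper bound leaves only finitely many
  values. \<open>Max\<close> in \<open>K1\<close> requires this finiteness.\<close>

lemma cross_rational:
  assumes "finite I" "n > 0" "q > 0"
  shows "\<exists>j. cross n q I x y = real j / real (lcm n q)"
proof -
  have "\<exists>j. weight n q a b = real j / real (lcm n q)" for a b
  proof (cases "zmod n q a b")
    case True
    then show ?thesis by (intro exI[of _ 0]) (simp add: weight_def)
  next
    case False
    obtain k where k: "lcm n q = ord_mod n q a b * k" using ord_mod_dvd_lcm[OF assms(2,3)] by blast
    have "lcm n q > 0" using assms by (simp add: lcm_pos_nat)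
    then have "k > 0" using k by (metis gr0I mult_0_right less_irrefl)
    then show ?thesis using False k by (intro exI[of _ k]) (simp add: weight_def)
  qed
  then obtain j where j: "\<And>a b. weight n q a b = real (j a b) / real (lcm n q)" by metis
  have "cross n q I x y = real (\<Sum>i\<in>I. j (x i) (y i)) / real (lcm n q)"
    unfolding cross_def j by (simp add: sum_divide_distrib)
  then show ?thesis by blast
qed

section \<open>From families to the invariant \<open>K1\<close>\<close>

context modelled_group
begin

lemma UFIS_cross_number:
  assumes "UFIS G S"
  obtains I x y where "ufam n q (I :: nat set) x y" "cross_number G S = cross n q I x y"
proof -
  define A where "A = set_mset S"
  have ind: "indexed_sequence G S" using assms by (simp add: UFIS_def zero_sum_def)
  have S: "S = mset_set A" using indexed_sequence_eq_mset_set[OF ind] by (simp add: A_def)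
  have A: "finite A" "A \<subseteq> nonzero G \<times> UNIV" using ind by (simp_all add: A_def indexed_sequence_def)
  obtain f where f: "bij_betw f {0..<card A} A" using ex_bij_betw_nat_finite[OF A(1)] by blast
  have ufam: "ufam n q A (X \<circ> fst) (Y \<circ> fst)" using UFIS_imp_ufam[OF A] assms S by simp
  show ?thesis
  proof (rule that)
    show "ufam n q {0..<card A} (\<lambda>j. (X \<circ> fst) (f j)) (\<lambda>j. (Y \<circ> fst) (f j))"
      using f by (intro ufam_image[OF ufam]) (auto simp: bij_betw_def)
    show "cross_number G S = cross n q {0..<card A} (\<lambda>j. (X \<circ> fst) (f j)) (\<lambda>j. (Y \<circ> fst) (f j))"
      unfolding S cross_number_eq[OF A] cross_def by (rule sum.reindex_bij_betw[OF f, symmetric])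
  qed
qed

lemma attained_UFIS:
  assumes "attained n q B"
  shows "\<exists>S. UFIS G S \<and> cross_number G S = B"
proof -
  obtain I x y where I: "ufam n q (I :: nat set) x y" "zsum n q x y I"
    "\<And>i. i \<in> I \<Longrightarrow> \<not> zmod n q (x i) (y i)" "cross n q I x y = B"
    using assms unfolding attained_def by blast
  have finI: "finite I" using I(1) by (rule ufam_finite)
  have "\<forall>i. \<exists>v. v \<in> carrier G \<and> zmod n q (X v - x i) (Y v - y i)" using surj by blast
  then obtain u where u0: "\<forall>i. u i \<in> carrier G \<and> zmod n q (X (u i) - x i) (Y (u i) - y i)"
    by (rule choice[THEN exE])
  have u: "u i \<in> carrier G" "zmod n q (X (u i) - x i) (Y (u i) - y i)" for i
    using u0 by simp_all
  \<comment> \<open>The index serves as the label, so that terms with the same group element remain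
    distinct.\<close>
  define A where "A = (\<lambda>i. (u i, i)) ` I"
  have inj: "inj_on (\<lambda>i. (u i, i)) I" by (simp add: inj_on_def)
  have iff: "zmod n q (X (u i)) (Y (u i)) \<longleftrightarrow> zmod n q (x i) (y i)" for i by (rule zmod_shift[OF u(2)])
  have A: "finite A" "A \<subseteq> nonzero G \<times> UNIV"
    using finI u(1) I(3) one_iff iff by (auto simp: A_def nonzero_def)
  have injA: "inj_on snd A" by (auto simp: A_def inj_on_def)
  have sums: "zsum n q (X \<circ> fst) (Y \<circ> fst) T \<longleftrightarrow> zsum n q x y (snd ` T)"
    if "T \<subseteq> A" for T
  proof -
    have injs: "inj_on snd T" using injA that by (rule inj_on_subset)
    have el: "zmod n q (X (fst a) - x (snd a)) (Y (fst a) - y (snd a))" if "a \<in> T" for a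
      using that \<open>T \<subseteq> A\<close> u(2) by (auto simp: A_def)
    have "zmod n q (sum (X \<circ> fst) T - sum x (snd ` T)) (sum (Y \<circ> fst) T - sum y (snd ` T))"
      unfolding sum.reindex[OF injs] sum_subtractf[symmetric] zmod_def comp_def
      using dvd_sum[of T "int n" "\<lambda>a. X (fst a) - x (snd a)"] dvd_sum[of T "int q" "\<lambda>a. Y (fst a) - y (snd a)"] el
      by (auto simp: zmod_def)
    then show ?thesis by (rule zmod_shift)
  qed
  have snd_A: "snd ` A = I" by (auto simp: A_def image_iff)
  have cl1: "ufam n q A (\<lambda>a. x (snd a)) (\<lambda>a. y (snd a))"
    using snd_A by (intro ufam_image[OF I(1)]) (auto simp: A_def inj_on_def)
  have "ufam n q A (X \<circ> fst) (Y \<circ> fst)"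
  proof (rule ufam_transfer[OF cl1])
    fix T assume T: "T \<subseteq> A"
    have injs: "inj_on snd T" using injA T by (rule inj_on_subset)
    show "zsum n q (X \<circ> fst) (Y \<circ> fst) T \<longleftrightarrow> zmod n q (\<Sum>a\<in>T. x (snd a)) (\<Sum>a\<in>T. y (snd a))"
      using sums[OF T] by (simp add: sum.reindex[OF injs] comp_def)
  qed
  moreover have "zsum n q (X \<circ> fst) (Y \<circ> fst) A"
    using sums[of A] I(2) by (simp add: snd_A)
  ultimately have "UFIS G (mset_set A)" using ufam_imp_UFIS[OF A] by blast
  moreover have "cross_number G (mset_set A) = B"
  proof -
    have "ord_mod n q (X (u i)) (Y (u i)) = ord_mod n q (x i) (y i)" for i
    proof (rule ord_mod_unique[OF pos])
      fix k
      have "zmod n q (int k * X (u i) - int k * x i) (int k * Y (u i) - int k * y i)"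
        using zmod_mult[OF u(2)] by (simp add: right_diff_distrib)
      then show "ord_mod n q (x i) (y i) dvd k \<longleftrightarrow> zmod n q (int k * X (u i)) (int k * Y (u i))"
        unfolding ord_mod_dvd_iff[OF pos] by (rule zmod_shift[symmetric])
    qed
    then have "cross n q A (X \<circ> fst) (Y \<circ> fst) = cross n q I x y"
      unfolding A_def cross_def sum.reindex[OF inj] by (intro sum.cong) (simp_all add: weight_def iff)
    then show ?thesis using cross_number_eq[OF A] I(4) by simp
  qed
  ultimately show ?thesis by blast
qed

theorem K1_eq:
  assumes "cross_bd n q B" "attained n q B"
  shows "K1 G = B"
  unfolding K1_def
proof (rule Max_eqI)
  let ?L = "lcm n q"
  have L: "?L > 0" using pos by (simp add: lcm_pos_nat)
  have "{cross_number G S | S. UFIS G S} \<subseteq> (\<lambda>j. real j / real ?L) ` {..nat \<lfloor>B * real ?L\<rfloor>}"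
  proof
    fix c assume "c \<in> {cross_number G S | S. UFIS G S}"
    then obtain S where S: "UFIS G S" "c = cross_number G S" by blast
    obtain I x y where I: "ufam n q (I :: nat set) x y" "c = cross n q I x y"
      using UFIS_cross_number[OF S(1)] S(2) by metis
    obtain j where j: "c = real j / real ?L" using cross_rational[OF ufam_finite[OF I(1)] pos] I(2) by metis
    have "c \<le> B" using cross_bdD[OF assms(1) I(1)] I(2) by simp
    then have "real j \<le> B * real ?L" using j L by (simp add: field_simps)
    then have "j \<le> nat \<lfloor>B * real ?L\<rfloor>" by (simp add: le_nat_floor)
    then show "c \<in> (\<lambda>j. real j / real ?L) ` {..nat \<lfloor>B * real ?L\<rfloor>}"
      using j by (intro image_eqI[of _ _ j]) simp_all
  qed
  then show "finite {cross_number G S | S. UFIS G S}" by (rule finite_subset) simp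
  show "c \<le> B" if c: "c \<in> {cross_number G S | S. UFIS G S}" for c
  proof -
    obtain S where S: "UFIS G S" "c = cross_number G S" using c by blast
    obtain I x y where "ufam n q (I :: nat set) x y" "c = cross n q I x y"
      using UFIS_cross_number[OF S(1)] S(2) by metis
    then show ?thesis using cross_bdD[OF assms(1)] by simp
  qed
  show "B \<in> {cross_number G S | S. UFIS G S}" using attained_UFIS[OF assms(2)] by blast
qed

end

section \<open>Extremal families and the main theorem\<close>

lemma attained_trivial: "attained 1 1 0"
  unfolding attained_def
  by (intro exI[of _ "{}"] exI[of _ "\<lambda>_. 0"]) (simp add: ufam_def cross_def)

lemma dvd_le_cases:
  fixes k q :: nat
  assumes "k \<le> q" "q > 0"
  shows "q dvd k \<longleftrightarrow> k = 0 \<or> k = q"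
  using assms dvd_imp_le[of q k] by (cases "k = 0") auto

text \<open>Take \<open>q\<close> copies of a generator: only the empty and the full subset are
  zero-sum. This is the family from which the second component starts.\<close>

lemma attained_prime:
  assumes q: "prime q"
  shows "attained 1 q 1"
proof -
  have q1: "q > 1" using q prime_gt_1_nat by blast
  let ?I = "{..<q}" and ?y = "\<lambda>_ :: nat. 1 :: int"
  have zmod_iff: "zsum 1 q (\<lambda>_. 0) ?y T \<longleftrightarrow> T = {} \<or> T = ?I" if "T \<subseteq> ?I" for T
  proof -
    have "finite T" using that finite_subset by blast
    moreover have "card T \<le> q" using card_mono[OF _ that] by simp
    ultimately have "q dvd card T \<longleftrightarrow> card T = 0 \<or> card T = q" using q1 by (intro dvd_le_cases) auto
    moreover have "card T = q \<longleftrightarrow> T = ?I" using card_subset_eq[of ?I T] that by auto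
    ultimately show ?thesis using \<open>finite T\<close> by (simp add: zmod_def)
  qed
  have "ufam 1 q ?I (\<lambda>_. 0) ?y"
  proof (rule ufamI)
    fix S T assume a: "S \<subseteq> ?I" "T \<subseteq> ?I" "zsum 1 q (\<lambda>_. 0) ?y S" "zsum 1 q (\<lambda>_. 0) ?y T"
    then have "S = {} \<or> S = ?I" "T = {} \<or> T = ?I" using zmod_iff by blast+
    then have "S \<inter> T = {} \<or> S \<inter> T = ?I" by auto
    then show "zsum 1 q (\<lambda>_. 0) ?y (S \<inter> T)"
      using zmod_iff[of "S \<inter> T"] a by blast
  qed simp
  moreover have nz: "\<not> zmod 1 q 0 1" using q1 by (simp add: zmod_def)
  moreover have "cross 1 q ?I (\<lambda>_. 0) ?y = 1"
  proof -
    have "ord_mod 1 q 0 1 = q"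
      using q1 by (intro ord_mod_unique) (auto simp: zmod_def)
    then show ?thesis using nz q1 by (simp add: cross_def weight_def)
  qed
  moreover have "zsum 1 q (\<lambda>_. 0) ?y ?I" using zmod_iff[of ?I] by blast
  ultimately show ?thesis unfolding attained_def by blast
qed

text \<open>The new terms are \<open>p - 1\<close> copies of an element \<open>g\<close> of order \<open>p\<^sup>v\<^sup>+\<^sup>1\<close> and the element
  \<open>g - p g\<close>.\<close>

lemma attained_step:
  assumes p: "prime p" and m: "m > 0" "\<not> p dvd m" and q: "q > 0" and att: "attained (p ^ v * m) q B"
  shows "attained (p ^ Suc v * m) q (B + 1 / real p ^ v)"
proof -
  obtain I x y where ufam: "ufam (p ^ v * m) q (I :: nat set) x y"
    and tot: "zsum (p ^ v * m) q x y I"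
    and nz: "\<And>i. i \<in> I \<Longrightarrow> \<not> zmod (p ^ v * m) q (x i) (y i)" and cross: "cross (p ^ v * m) q I x y = B"
    using att unfolding attained_def by blast
  define n where "n = p ^ v * m"
  have p1: "p > 1" using p prime_gt_1_nat by blast
  have n: "n > 0" using p1 m by (simp add: n_def)
  have N: "p ^ Suc v * m = p * n" by (simp add: n_def)
  have pn: "p * n > 0" using n p1 by simp
  have fin: "finite I" using ufam by (rule ufam_finite)
  obtain e where e: "\<forall>i\<in>I. i < e" using fin unfolding finite_nat_set_iff_bounded ..
  define J where "J = {e..<e + p}"
  have J: "finite J" "card J = p" "J \<inter> I = {}" "e \<in> J" using e p1 by (auto simp: J_def)
  \<comment> \<open>The \<open>w i\<close> sum to zero over \<open>J\<close> and are all
    \<open>1\<close> modulo \<open>p\<close>. Below, the old terms enter through multiplication by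
    \<open>p\<close> in the first component, which embeds the old group in the new one.\<close>
  define w where "w i = (if i = e then 1 - int p else 1)" for i
  define x' where "x' i = (if i \<in> J then int m * w i else int p * x i)" for i
  define y' where "y' i = (if i \<in> J then 0 else y i)" for i
  have sums: "sum x' T = int p * sum x (T - J) + int m * (int (card (T \<inter> J)) - (if e \<in> T then int p else 0))"
    "sum y' T = sum y (T - J)" if "T \<subseteq> I \<union> J" for T
  proof -
    have finT: "finite T" using that fin J finite_subset by blast
    have "sum x' T = sum x' (T - J) + sum x' (T \<inter> J)"
      using sum.Int_Diff[OF finT, of x' J] by simp
    also have "sum x' (T - J) = int p * sum x (T - J)"
      unfolding sum_distrib_left by (intro sum.cong) (auto simp: x'_def)
    also have "sum x' (T \<inter> J) = int m * (\<Sum>i\<in>T \<inter> J. 1 - (if i = e then int p else 0))"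
      unfolding sum_distrib_left by (intro sum.cong) (auto simp: x'_def w_def)
    also have "(\<Sum>i\<in>T \<inter> J. 1 - (if i = e then int p else 0)) = int (card (T \<inter> J)) - (if e \<in> T then int p else 0)"
      unfolding sum_subtractf using finT J(4) by simp
    finally show "sum x' T = int p * sum x (T - J) + int m * (int (card (T \<inter> J)) - (if e \<in> T then int p else 0))" .
    show "sum y' T = sum y (T - J)"
      unfolding y'_def using finT by (intro sum.mono_neutral_cong_right) auto
  qed
  have zmod_iff: "zsum (p * n) q x' y' T \<longleftrightarrow>
      zsum n q x y (T - J) \<and> (T \<inter> J = {} \<or> J \<subseteq> T)" if T: "T \<subseteq> I \<union> J" for T
  proof -
    have triv: "zsum (p * n) q x' y' T \<longleftrightarrow> zsum n q x y (T - J)"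
      if "T \<inter> J = {} \<or> J \<subseteq> T"
    proof -
      have "int (card (T \<inter> J)) - (if e \<in> T then int p else 0) = 0"
        using that J(2,4) by (auto simp: Int_absorb1)
      then show ?thesis using p1 by (simp add: zmod_def sums[OF T])
    qed
    \<comment> \<open>Modulo \<open>p\<close> the old terms vanish and \<open>m\<close> cancels, so
      only \<open>card (T \<inter> J)\<close> remains, a number between \<open>0\<close> and
      \<open>p\<close>.\<close>
    have "T \<inter> J = {} \<or> J \<subseteq> T" if z: "zsum (p * n) q x' y' T"
    proof -
      have "int p dvd int (p * n)" by simp
      also have "int (p * n) dvd sum x' T" using z by (simp add: zmod_def)
      finally have "int p dvd int m * (int (card (T \<inter> J)) - (if e \<in> T then int p else 0))"
        unfolding sums[OF T] by (simp add: dvd_add_right_iff)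
      then have "int p dvd int (card (T \<inter> J)) - (if e \<in> T then int p else 0)"
        using p m(2) by (simp add: prime_dvd_mult_iff)
      then have "int p dvd int (card (T \<inter> J))" by (auto split: if_splits dest: dvd_add[OF _ dvd_refl])
      then have "p dvd card (T \<inter> J)" by simp
      moreover have "card (T \<inter> J) \<le> p" using card_mono[of J "T \<inter> J"] J by auto
      ultimately have "card (T \<inter> J) = 0 \<or> card (T \<inter> J) = p"
        using p1 dvd_le_cases[of "card (T \<inter> J)" p] by simp
      then show ?thesis using J card_subset_eq[of J "T \<inter> J"] by auto
    qed
    then show ?thesis using triv by blast
  qed
  have "ufam (p * n) q (I \<union> J) x' y'"
  proof (rule ufamI)
    show "finite (I \<union> J)" using fin J by simp
    fix S T assume a: "S \<subseteq> I \<union> J" "T \<subseteq> I \<union> J" "zsum (p * n) q x' y' S" "zsum (p * n) q x' y' T"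
    then have z: "zsum n q x y (S - J)" "zsum n q x y (T - J)"
      "S \<inter> J = {} \<or> J \<subseteq> S" "T \<inter> J = {} \<or> J \<subseteq> T"
      using zmod_iff by blast+
    have "zsum n q x y ((S - J) \<inter> (T - J))"
      unfolding n_def using a z(1,2) by (intro ufam_Int[OF ufam]) (auto simp: n_def)
    moreover have "(S - J) \<inter> (T - J) = S \<inter> T - J" by auto
    moreover have "S \<inter> T \<subseteq> I \<union> J" using a by auto
    moreover have "S \<inter> T \<inter> J = {} \<or> J \<subseteq> S \<inter> T" using z(3,4) by auto
    ultimately show "zsum (p * n) q x' y' (S \<inter> T)"
      using zmod_iff[of "S \<inter> T"] by simp
  qed
  moreover have "zsum (p * n) q x' y' (I \<union> J)"
  proof -
    have "I \<union> J - J = I" using J by auto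
    then show ?thesis using zmod_iff[of "I \<union> J"] tot by (simp add: n_def)
  qed
  moreover have odJ: "ord_mod (p * n) q (int m * w i) 0 = p ^ Suc v" for i
  proof (rule ord_mod_unique[OF pn q])
    fix k
    have cop: "coprime (int p ^ Suc v) (w i)"
    proof -
      have "\<not> int p dvd w i" using p1 by (auto simp: w_def dvd_diff_left_iff)
      then have "coprime (int p) (w i)" using p by (simp add: prime_imp_coprime)
      then show ?thesis by (simp del: power_Suc)
    qed
    have "zmod (p * n) q (int k * (int m * w i)) (int k * 0) \<longleftrightarrow> int m * int p ^ Suc v dvd int m * (int k * w i)"
      by (simp add: zmod_def n_def ac_simps)
    also have "\<dots> \<longleftrightarrow> int p ^ Suc v dvd int k * w i" using m by simp
    also have "\<dots> \<longleftrightarrow> int p ^ Suc v dvd int k" using cop by (rule coprime_dvd_mult_left_iff)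
    also have "\<dots> \<longleftrightarrow> p ^ Suc v dvd k" by (metis int_dvd_int_iff of_nat_power)
    finally show "p ^ Suc v dvd k \<longleftrightarrow> zmod (p * n) q (int k * (int m * w i)) (int k * 0)" by simp
  qed
  moreover have nzJ: "\<not> zmod (p * n) q (int m * w i) 0" for i
    using odJ[of i] ord_mod_eq_1_iff[OF pn q, of "int m * w i" 0] p1 by auto
  moreover have zsI: "zmod (p * n) q (int p * a) b \<longleftrightarrow> zmod n q a b" for a b
    using p1 by (simp add: zmod_def)
  moreover have "cross (p * n) q (I \<union> J) x' y' = B + 1 / real p ^ v"
  proof -
    have odI: "ord_mod (p * n) q (int p * a) b = ord_mod n q a b" for a b
    proof (rule ord_mod_unique[OF pn q])
      fix k
      show "ord_mod n q a b dvd k \<longleftrightarrow> zmod (p * n) q (int k * (int p * a)) (int k * b)"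
        unfolding ord_mod_dvd_iff[OF n q] using zsI[of "int k * a" "int k * b"] by (simp add: mult.left_commute)
    qed
    have "cross (p * n) q (I \<union> J) x' y' = cross (p * n) q I x' y' + cross (p * n) q J x' y'"
      unfolding cross_def using fin J by (intro sum.union_disjoint) auto
    moreover have "cross (p * n) q I x' y' = cross n q I x y"
      unfolding cross_def using J(3) by (intro sum.cong) (auto simp: x'_def y'_def weight_def zsI odI)
    moreover have "cross (p * n) q J x' y' = (\<Sum>i\<in>J. 1 / real p ^ Suc v)"
      unfolding cross_def using odJ nzJ by (intro sum.cong) (auto simp: x'_def y'_def weight_def)
    moreover have "(\<Sum>i\<in>J. 1 / real p ^ Suc v) = 1 / real p ^ v" using J(2) p1 by simp
    ultimately show ?thesis using cross by (simp add: n_def)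
  qed
  moreover have "\<forall>i\<in>I \<union> J. \<not> zmod (p * n) q (x' i) (y' i)"
    using nz nzJ zsI by (auto simp: x'_def y'_def n_def)
  ultimately show ?thesis unfolding N attained_def by blast
qed

lemma attained_prime_power:
  assumes "prime p" "m > 0" "\<not> p dvd m" "q > 0" "attained m q B"
  shows "attained (p ^ a * m) q (geo p a + B)"
proof (induction a)
  case (Suc a)
  from attained_step[OF assms(1-4) this] show ?case by (simp add: geo_def algebra_simps)
qed (use assms in simp)

section \<open>Induction over the prime factors\<close>

definition Kstar :: "nat \<Rightarrow> real" where
  "Kstar n = (\<Sum>p\<in>prime_factors n. geo p (multiplicity p n))"

lemma prime_factors_prime_power_mult:
  fixes p m :: nat
  assumes "prime p" "\<not> p dvd m" "m > 0" "a > 0"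
  shows "prime_factors (p ^ a * m) = insert p (prime_factors m)"
    and "multiplicity p (p ^ a * m) = a"
    and "\<And>r. prime r \<Longrightarrow> r \<noteq> p \<Longrightarrow> multiplicity r (p ^ a * m) = multiplicity r m"
proof -
  have p0: "p > 0" using assms(1) prime_gt_0_nat by blast
  show "prime_factors (p ^ a * m) = insert p (prime_factors m)"
    using assms p0 by (simp add: prime_factors_product prime_factors_power prime_prime_factors)
  show "multiplicity p (p ^ a * m) = a"
    using assms p0 by (simp add: prime_elem_multiplicity_mult_distrib not_dvd_imp_multiplicity_0)
  show "multiplicity r (p ^ a * m) = multiplicity r m" if "prime r" "r \<noteq> p" for r
    using assms that p0 by (simp add: prime_elem_multiplicity_mult_distrib multiplicity_distinct_prime_power prime_elem_multiplicity_power_distrib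
      not_dvd_imp_multiplicity_0 primes_dvd_imp_eq)
qed

lemma Kstar_prime_power_mult:
  assumes "prime p" "\<not> p dvd m" "m > 0" "a > 0"
  shows "Kstar (p ^ a * m) = geo p a + Kstar m"
proof -
  note pf = prime_factors_prime_power_mult[OF assms]
  have "p \<notin> prime_factors m" using assms by auto
  then have "Kstar (p ^ a * m) = geo p a + (\<Sum>r\<in>prime_factors m. geo r (multiplicity r (p ^ a * m)))"
    unfolding Kstar_def pf(1) by (simp add: pf(2))
  also have "(\<Sum>r\<in>prime_factors m. geo r (multiplicity r (p ^ a * m))) = Kstar m"
    unfolding Kstar_def
  proof (rule sum.cong[OF refl])
    fix r assume "r \<in> prime_factors m"
    then have "prime r" "r \<noteq> p" using \<open>p \<notin> prime_factors m\<close> by auto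
    then show "geo r (multiplicity r (p ^ a * m)) = geo r (multiplicity r m)" by (simp add: pf(3))
  qed
  finally show ?thesis .
qed

lemma Kstar_1 [simp]: "Kstar (Suc 0) = 0"
  by (simp add: Kstar_def)

text \<open>The smallest prime is removed first because the condition in \<open>two_wide\<close> on
  a prime involves only larger primes, and so passes to the cofactor \<open>m\<close>.\<close>

lemma peel_smallest_prime:
  fixes n :: nat
  assumes "n > 1"
  obtains p a m where "prime p" "\<not> p dvd m" "m > 0" "a > 0" "n = p ^ a * m" "m < n"
    "\<And>r. r \<in> prime_factors m \<Longrightarrow> p < r"
proof -
  define p where "p = Min (prime_factors n)"
  obtain r where "prime r" "r dvd n" using assms prime_factor_nat[of n] by auto
  then have "r \<in> prime_factors n" using assms by (simp add: in_prime_factors_iff)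
  then have "prime_factors n \<noteq> {}" by blast
  then have "p \<in> prime_factors n" unfolding p_def by (intro Min_in) auto
  then have p: "prime p" "p dvd n" by auto
  have n0: "n \<noteq> 0" and np: "\<not> is_unit p" using assms p(1) by auto
  obtain m where m: "n = p ^ multiplicity p n * m" "\<not> p dvd m"
    using multiplicity_decompose'[OF n0 np] by metis
  have a: "multiplicity p n > 0" using p n0 np by (simp add: multiplicity_gt_zero_iff)
  have m0: "m > 0" using m(1) assms by (intro gr0I) simp
  have "1 < p ^ multiplicity p n" using a prime_gt_1_nat[OF p(1)] by (rule one_less_power[rotated])
  then have "m < n" using m0 by (subst m(1)) simp
  moreover have "p < r" if "r \<in> prime_factors m" for r
  proof -
    have "r \<in> prime_factors n" using that m n0 by (metis dvd_mult in_prime_factors_iff)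
    then have "p \<le> r" unfolding p_def by (intro Min_le) auto
    moreover have "p \<noteq> r" using that m(2) by auto
    ultimately show ?thesis by simp
  qed
  ultimately show ?thesis using that[OF p(1) m(2) m0 a m(1)] by blast
qed

lemma attained_Kstar:
  assumes "q > 0" "attained 1 q B" "n > 0"
  shows "attained n q (Kstar n + B)"
  using assms(3)
proof (induction n rule: less_induct)
  case (less n)
  show ?case
  proof (cases "n > 1")
    case False
    then show ?thesis using less.prems assms(2) by (cases "n = 1") auto
  next
    case True
    then obtain p a m where n: "prime p" "\<not> p dvd m" "m > 0" "a > 0" "n = p ^ a * m" "m < n"
      by (rule peel_smallest_prime)
    then have "attained n q (geo p a + (Kstar m + B))"
      using attained_prime_power[OF n(1,3,2) assms(1) less.IH] by simp
    then show ?thesis using Kstar_prime_power_mult[OF n(1-4)] n(5) by (simp add: add.assoc)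
  qed
qed

text \<open>Turns the product in \<open>two_wide_wrt\<close> into the divisor sum that
  \<open>cyclic_extension\<close> uses.\<close>

lemma sum_divisors_inverse:
  assumes "n > (0::nat)"
  shows "(\<Sum>d | d dvd n. 1 / real d) = (\<Prod>p\<in>prime_factors n. geo p (Suc (multiplicity p n)))"
  using assms
proof (induction n rule: less_induct)
  case (less n)
  show ?case
  proof (cases "n > 1")
    case False
    then show ?thesis using less.prems by (cases "n = 1") auto
  next
    case True
    then obtain p a m where n: "prime p" "\<not> p dvd m" "m > 0" "a > 0" "n = p ^ a * m" "m < n"
      by (rule peel_smallest_prime)
    note pf = prime_factors_prime_power_mult[OF n(1-4)]
    have notin: "p \<notin> prime_factors m" using n by auto
    have "(\<Sum>d | d dvd n. 1 / real d) = (\<Sum>j\<le>a. \<Sum>d | d dvd m. 1 / real (p ^ j * d))"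
      unfolding n(5) by (rule sum_divisors_prime_power[OF n(1-3)])
    also have "\<dots> = (\<Sum>j\<le>a. 1 / real p ^ j) * (\<Sum>d | d dvd m. 1 / real d)"
      by (simp add: sum_product)
    also have "(\<Sum>j\<le>a. 1 / real p ^ j) = geo p (Suc a)"
      by (simp add: geo_def lessThan_Suc_atMost)
    also have "(\<Sum>d | d dvd m. 1 / real d) = (\<Prod>r\<in>prime_factors m. geo r (Suc (multiplicity r m)))"
      by (rule less.IH[OF n(6,3)])
    also have "\<dots> = (\<Prod>r\<in>prime_factors m. geo r (Suc (multiplicity r n)))"
    proof (rule prod.cong[OF refl])
      fix r assume "r \<in> prime_factors m"
      then have "prime r" "r \<noteq> p" using notin by auto
      then show "geo r (Suc (multiplicity r m)) = geo r (Suc (multiplicity r n))" by (simp add: n(5) pf(3))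
    qed
    also have "geo p (Suc a) * \<dots> = (\<Prod>r\<in>prime_factors n. geo r (Suc (multiplicity r n)))"
      using notin pf(1,2) unfolding n(5) by simp
    finally show ?thesis .
  qed
qed

text \<open>Let \<open>p\<close> be the smallest prime. If \<open>q\<close> differs from
  \<open>p\<close>, then \<open>q\<close> divides \<open>m\<close>, and
  \<open>cyclic_extension\<close> adjoins the \<open>p\<close>-part to the group belonging to
  \<open>m\<close> and \<open>q\<close>. If \<open>q = p\<close>, at most one larger prime is left
  and \<open>cross_bd_rank2\<close> applies.\<close>

lemma two_wide_cross_bd:
  assumes "two_wide n"
  shows "cross_bd n 1 (Kstar n)"
    and "q \<in> prime_factors n \<Longrightarrow> card {r \<in> prime_factors n. q < r} \<le> 1 \<Longrightarrow> cross_bd n q (Kstar n + 1)"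
proof -
  have "cross_bd n 1 (Kstar n) \<and> (\<forall>q. q \<in> prime_factors n \<longrightarrow> card {r \<in> prime_factors n. q < r} \<le> 1 \<longrightarrow> cross_bd n q (Kstar n + 1))"
    using assms
  proof (induction n rule: less_induct)
    case (less n)
    have n0: "n > 0" using less.prems by (simp add: two_wide_def)
    show ?case
    proof (cases "n > 1")
      case False
      then have "n = 1" using n0 by simp
      then show ?thesis using cross_bd_trivial by simp
    next
      case True
      then obtain p a m where n: "prime p" "\<not> p dvd m" "m > 0" "a > 0" "n = p ^ a * m" "m < n"
        and gt: "\<And>r. r \<in> prime_factors m \<Longrightarrow> p < r"
        using peel_smallest_prime by metis
      note pf = prime_factors_prime_power_mult[OF n(1-4), folded n(5)]
      have p1: "p > 1" using n(1) prime_gt_1_nat by blast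
      have mult: "multiplicity r n = multiplicity r m" if "r \<in> prime_factors m" for r
        using pf(3)[of r] that gt[OF that] by auto
      have above: "{r \<in> prime_factors n. t < r} = {r \<in> prime_factors m. t < r}" if "p \<le> t" for t
        using that unfolding pf(1) by auto
      have Max: "Max (prime_factors n) = Max (prime_factors m)" if "m \<noteq> 1"
      proof -
        have ne: "prime_factors m \<noteq> {}" using that n(3) by (simp add: prime_factorization_empty_iff)
        then have "p \<le> Max (prime_factors m)" using gt[OF Max_in[OF _ ne]] by simp
        then show ?thesis unfolding pf(1) using ne by (simp add: max_def)
      qed
      have tw: "two_wide m"
        unfolding two_wide_def
      proof (intro conjI ballI impI)
        show "0 < m" by (rule n(3))
        fix t assume t: "t \<in> prime_factors m" "t \<noteq> Max (prime_factors m)"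
        have "m \<noteq> 1" using t by auto
        then have "t \<prec>\<^sub>2 (\<Prod>r\<in>{r \<in> prime_factors n. t < r}. r ^ multiplicity r n)"
          using less.prems t Max pf(1) by (simp add: two_wide_def)
        also have "(\<Prod>r\<in>{r \<in> prime_factors n. t < r}. r ^ multiplicity r n) =
            (\<Prod>r\<in>{r \<in> prime_factors m. t < r}. r ^ multiplicity r m)"
          using above[of t] gt[OF t(1)] mult by (intro prod.cong) auto
        finally show "t \<prec>\<^sub>2 (\<Prod>r\<in>{r \<in> prime_factors m. t < r}. r ^ multiplicity r m)" .
      qed
      \<comment> \<open>For \<open>m = 1\<close> the prime \<open>p\<close> is the largest and
        \<open>two_wide\<close> demands nothing of it, but then the sum is empty.\<close>
      have wide: "(\<Sum>d | d dvd m \<and> d \<noteq> 1. 1 / real d) \<le> 2 * (real p - 1) / real p ^ 2"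
      proof (cases "m = 1")
        case True
        then have "(\<Sum>d | d dvd m \<and> d \<noteq> 1. 1 / real d) = 0" by (intro sum.neutral) auto
        then show ?thesis using p1 by simp
      next
        case False
        have ne: "prime_factors m \<noteq> {}" using False n(3) by (simp add: prime_factorization_empty_iff)
        have "p \<noteq> Max (prime_factors n)" using gt[OF Max_in[OF _ ne]] Max[OF False] by simp
        then have "p \<prec>\<^sub>2 (\<Prod>r\<in>{r \<in> prime_factors n. p < r}. r ^ multiplicity r n)"
          using less.prems pf(1) by (simp add: two_wide_def)
        also have "(\<Prod>r\<in>{r \<in> prime_factors n. p < r}. r ^ multiplicity r n) = (\<Prod>r\<in>prime_factors m. r ^ multiplicity r m)"
          using above[of p] gt mult by (intro prod.cong) auto
        also have "\<dots> = m" using n(3) prod_prime_factors[of m] by simp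
        finally have "p \<prec>\<^sub>2 m" .
        then have "(\<Prod>r\<in>prime_factors m. (real r ^ (multiplicity r m + 1) - 1) /
            (real r ^ (multiplicity r m + 1) - real r ^ multiplicity r m)) \<le> (real p ^ 2 + 2 * real p - 2) / real p ^ 2"
          by (simp add: two_wide_wrt_def)
        also have "(\<Prod>r\<in>prime_factors m. (real r ^ (multiplicity r m + 1) - 1) /
            (real r ^ (multiplicity r m + 1) - real r ^ multiplicity r m)) =
            (\<Prod>r\<in>prime_factors m. geo r (Suc (multiplicity r m)))"
        proof (rule prod.cong[OF refl])
          fix r assume "r \<in> prime_factors m"
          then have "r > 1" using prime_gt_1_nat[of r] by auto
          then show "(real r ^ (multiplicity r m + 1) - 1) /
            (real r ^ (multiplicity r m + 1) - real r ^ multiplicity r m) = geo r (Suc (multiplicity r m))"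
            using geo_formula[of r "multiplicity r m"] by simp
        qed
        also have "\<dots> = (\<Sum>d | d dvd m. 1 / real d)" by (rule sum_divisors_inverse[OF n(3), symmetric])
        also have "\<dots> = 1 + (\<Sum>d | d dvd m \<and> d \<noteq> 1. 1 / real d)"
          using finite_divisors_nat[OF n(3)] by (subst sum.remove[of _ 1]) (auto intro!: sum.cong)
        \<comment> \<open>The summand \<open>1\<close> cancels against the divisor
          \<open>d = 1\<close>.\<close>
        also have "(real p ^ 2 + 2 * real p - 2) / real p ^ 2 = 1 + 2 * (real p - 1) / real p ^ 2"
          using p1 by (simp add: field_simps)
        finally show ?thesis by simp
      qed
      have IH: "cross_bd m 1 (Kstar m)" "\<And>q. q \<in> prime_factors m \<Longrightarrow> card {r \<in> prime_factors m. q < r} \<le> 1 \<Longrightarrow> cross_bd m q (Kstar m + 1)"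
        using less.IH[OF n(6) tw] by blast+
      have Kstar: "Kstar n = geo p a + Kstar m" using Kstar_prime_power_mult[OF n(1-4)] n(5) by simp
      have "cross_bd (p ^ a * m) 1 (geo p a + Kstar m)"
        using p1 wide by (intro cyclic_extension[OF n(1,3,2) _ _ IH(1)]) auto
      then have "cross_bd n 1 (Kstar n)" by (simp only: Kstar n(5)[symmetric])
      moreover have "cross_bd n q (Kstar n + 1)" if q: "q \<in> prime_factors n" "card {r \<in> prime_factors n. q < r} \<le> 1" for q
      proof (cases "q = p")
        case False
        then have qm: "q \<in> prime_factors m" using q(1) pf(1) by simp
        have "card {r \<in> prime_factors m. q < r} \<le> 1" using q(2) above[of q] gt[OF qm] by simp
        then have B: "cross_bd m q (Kstar m + 1)" using IH(2)[OF qm] by simp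
        have "q > 0" "\<not> p dvd q" "q dvd m"
          using qm False n(1) prime_gt_0_nat primes_dvd_imp_eq by auto
        then have "cross_bd (p ^ a * m) q (geo p a + (Kstar m + 1))"
          using wide by (intro cyclic_extension[OF n(1,3,2) _ _ B]) (simp_all add: lcm_proj1_if_dvd_nat)
        then show ?thesis by (simp only: Kstar n(5)[symmetric] add.assoc)
      next
        case True
        obtain a' where a: "a = Suc a'" using n(4) by (metis gr0_conv_Suc)
        have "{r \<in> prime_factors n. q < r} = prime_factors m"
          using above[of p] gt True by auto
        then have le: "card (prime_factors m) \<le> 1" using q(2) by simp
        \<comment> \<open>If \<open>p\<close> is the only prime, any larger prime with exponent
          \<open>0\<close> serves as \<open>r\<close>.\<close>
        obtain r b where r: "prime r" "p < r" "m = r ^ b" "Kstar m = geo r b"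
        proof (cases "m = 1")
          case True
          obtain r where "prime r" "p < r" using bigger_prime by blast
          then show ?thesis using that[of r 0] True by simp
        next
          case False
          then have "prime_factors m \<noteq> {}" using n(3) by (simp add: prime_factorization_empty_iff)
          then have "card (prime_factors m) = 1" using le by (simp add: le_Suc_eq card_0_eq)
          then obtain r where r: "prime_factors m = {r}" by (rule card_1_singletonE)
          have "m = r ^ multiplicity r m" using n(3) prod_prime_factors[of m] by (simp add: r)
          moreover have "prime r" "p < r" using gt r by auto
          ultimately show ?thesis using that[of r "multiplicity r m"] by (simp add: Kstar_def r)
        qed
        have "cross_bd n p (geo p a + geo r b + 1)"
          unfolding n(5) r(3) a by (rule cross_bd_rank2[OF n(1) r(1,2)])
        then show ?thesis unfolding True Kstar r(4) .
      qed
      ultimately show ?thesis by blast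
    qed
  qed
  then show "cross_bd n 1 (Kstar n)"
    and "q \<in> prime_factors n \<Longrightarrow> card {r \<in> prime_factors n. q < r} \<le> 1 \<Longrightarrow> cross_bd n q (Kstar n + 1)"
    by blast+
qed

section \<open>Elementary divisors of the two groups\<close>

context modelled_group
begin

lemma eq_iff_zmod:
  assumes "u \<in> carrier G" "v \<in> carrier G"
  shows "u = v \<longleftrightarrow> zmod n q (X u - X v) (Y u - Y v)"
proof
  assume z: "zmod n q (X u - X v) (Y u - Y v)"
  let ?w = "u \<otimes> inv v"
  have w: "?w \<in> carrier G" "?w \<otimes> v = u" using assms by (simp_all add: m_assoc)
  have "zmod n q (X (?w \<otimes> v) - (X ?w + X v)) (Y (?w \<otimes> v) - (Y ?w + Y v))" using w assms by (intro hom)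
  from zmod_diff[OF z this] have "zmod n q (X ?w) (Y ?w)" unfolding w(2) by simp
  then have "?w = \<one>" using one_iff[OF w(1)] by simp
  then show "u = v" using w(2) assms by simp
qed simp

text \<open>By \<open>W\<close> the residues determine the element, and equal cardinalities make
  this embedding an isomorphism. The flag \<open>z i\<close> tells which coordinate the
  \<open>i\<close>-th summand reads.\<close>

lemma prime_power_decompositionI:
  fixes z :: "nat \<Rightarrow> bool"
  defines "W \<equiv> \<lambda>i a b. if z i then b else (a :: int)"
  assumes pr: "\<And>i. i < r \<Longrightarrow> prime (p i) \<and> 0 < \<alpha> i"
    and card: "card (carrier G) = (\<Prod>i<r. p i ^ \<alpha> i)"
    and W: "\<And>a b. zmod n q a b \<longleftrightarrow> (\<forall>i<r. int (p i ^ \<alpha> i) dvd W i a b)"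
  shows "prime_power_decomposition G r p \<alpha>"
proof -
  define m where "m i = p i ^ \<alpha> i" for i
  let ?S = "sum_group {..<r} (\<lambda>i. integer_mod_group (m i))"
  have m: "m i > 0" if "i < r" for i using pr[OF that] prime_gt_0_nat by (simp add: m_def)
  have S: "carrier ?S = (\<Pi>\<^sub>E i\<in>{..<r}. {0..<int (m i)})" using m by (rule carrier_sum_integer_mod_group)
  define h where "h u = (\<lambda>i\<in>{..<r}. W i (X u) (Y u) mod int (m i))" for u
  have W_diff: "W i (a - a') (b - b') = W i a b - W i a' b'" for i a a' b b' by (simp add: W_def)
  have W_add: "W i (a + a') (b + b') = W i a b + W i a' b'" for i a a' b b' by (simp add: W_def)
  have closed: "h u \<in> carrier ?S" for u
    unfolding S h_def using m by (intro restrict_PiE_iff[THEN iffD2]) auto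
  have hom_h: "h \<in> hom G ?S"
  proof (rule homI)
    fix u v assume uv: "u \<in> carrier G" "v \<in> carrier G"
    have "W i (X (u \<otimes> v)) (Y (u \<otimes> v)) mod int (m i) =
        (W i (X u) (Y u) mod int (m i) + W i (X v) (Y v) mod int (m i)) mod int (m i)" if "i < r" for i
    proof -
      have "int (m i) dvd W i (X (u \<otimes> v) - (X u + X v)) (Y (u \<otimes> v) - (Y u + Y v))"
        using hom[OF uv] that unfolding W m_def by blast
      then have "W i (X (u \<otimes> v)) (Y (u \<otimes> v)) mod int (m i) = (W i (X u) (Y u) + W i (X v) (Y v)) mod int (m i)"
        unfolding W_diff W_add by (simp add: mod_eq_dvd_iff)
      then show ?thesis by (simp add: mod_simps)
    qed
    then show "h (u \<otimes> v) = h u \<otimes>\<^bsub>?S\<^esub> h v"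
      by (auto simp: h_def fun_eq_iff restrict_def)
  qed (rule closed)
  have inj: "inj_on h (carrier G)"
  proof (rule inj_onI)
    fix u v assume uv: "u \<in> carrier G" "v \<in> carrier G" "h u = h v"
    have "int (p i ^ \<alpha> i) dvd W i (X u - X v) (Y u - Y v)" if "i < r" for i
      using fun_cong[OF uv(3), of i] that unfolding W_diff h_def m_def by (simp add: mod_eq_dvd_iff)
    then show "u = v" unfolding eq_iff_zmod[OF uv(1,2)] W by blast
  qed
  have "card (carrier ?S) = card (carrier G)"
    unfolding S card by (simp add: card_PiE) (simp add: m_def)
  moreover have "finite (carrier ?S)" unfolding S by (intro finite_PiE) auto
  ultimately have "h ` carrier G = carrier ?S"
    using closed card_image[OF inj] by (intro card_subset_eq) auto
  then have "h \<in> iso G ?S" using hom_h inj by (simp add: iso_def bij_betw_def)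
  then show ?thesis
    using pr unfolding prime_power_decomposition_def is_iso_def m_def by blast
qed

end

lemma dvd_if_prime_powers_dvd:
  assumes "n > (0::nat)"
  shows "int n dvd a \<longleftrightarrow> (\<forall>p\<in>prime_factors n. int (p ^ multiplicity p n) dvd a)"
proof
  assume "int n dvd a"
  then show "\<forall>p\<in>prime_factors n. int (p ^ multiplicity p n) dvd a"
    by (meson dvd_trans int_dvd_int_iff multiplicity_dvd)
next
  assume *: "\<forall>p\<in>prime_factors n. int (p ^ multiplicity p n) dvd a"
  have "int (\<Prod>p\<in>A. p ^ multiplicity p n) dvd a" if "finite A" "A \<subseteq> prime_factors n" for A
    using that
  proof (induction A rule: finite_induct)
    case (insert p A)
    have "coprime (p ^ multiplicity p n) (\<Prod>r\<in>A. r ^ multiplicity r n)"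
    proof (rule prod_coprime_right)
      fix r assume "r \<in> A"
      then have "prime p" "prime r" "p \<noteq> r" using insert by auto
      then show "coprime (p ^ multiplicity p n) (r ^ multiplicity r n)" by (simp add: primes_coprime)
    qed
    then have "coprime (int (p ^ multiplicity p n)) (int (\<Prod>r\<in>A. r ^ multiplicity r n))"
      by (simp only: coprime_int_iff)
    then have "int (p ^ multiplicity p n) * int (\<Prod>r\<in>A. r ^ multiplicity r n) dvd a"
      using insert * by (intro divides_mult) auto
    then show ?case unfolding prod.insert[OF insert.hyps] of_nat_mult .
  qed simp
  from this[of "prime_factors n"] show "int n dvd a"
    using prime_factorization_nat[OF assms] by simp
qed

lemma prime_factors_enumeration:
  obtains f where "bij_betw f {..<card (prime_factors n)} (prime_factors (n::nat))"
  using ex_bij_betw_nat_finite[of "prime_factors n"] unfolding lessThan_atLeast0 by auto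

lemma integer_mod_group_modelled:
  assumes "n > 0"
  shows "modelled_group (integer_mod_group n) (\<lambda>u. u) (\<lambda>_. 0) n 1"
proof -
  interpret comm_group "integer_mod_group n" by (rule abelian_integer_mod_group)
  show ?thesis
  proof unfold_locales
    show "finite (carrier (integer_mod_group n))" using assms by (simp add: carrier_integer_mod_group)
    fix u v assume "u \<in> carrier (integer_mod_group n)"
    then have u: "0 \<le> u" "u < int n" using assms by (simp_all add: carrier_integer_mod_group)
    show "zmod n 1 (u \<otimes>\<^bsub>integer_mod_group n\<^esub> v - (u + v)) (0 - (0 + 0))"
      by (simp add: zmod_def mod_eq_dvd_iff[symmetric])
    show "u = \<one>\<^bsub>integer_mod_group n\<^esub> \<longleftrightarrow> zmod n 1 u 0"
      using u by (auto simp: zmod_def dest: zdvd_imp_le)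
  next
    fix a b
    show "\<exists>u\<in>carrier (integer_mod_group n). zmod n 1 (u - a) (0 - b)"
      using assms by (intro bexI[of _ "a mod int n"])
        (simp_all add: zmod_def carrier_integer_mod_group mod_eq_dvd_iff[symmetric])
  qed (use assms in simp_all)
qed

lemma integer_mod_group_pair_modelled:
  assumes "n > 0" "q > 0"
  shows "modelled_group (integer_mod_group n \<times>\<times> integer_mod_group q) fst snd n q"
proof -
  interpret group "integer_mod_group n \<times>\<times> integer_mod_group q" by (intro DirProd_group) simp_all
  have comm: "comm_group (integer_mod_group n \<times>\<times> integer_mod_group q)"
    by (rule group_comm_groupI) (auto simp: mult_DirProd' add.commute)
  then interpret comm_group "integer_mod_group n \<times>\<times> integer_mod_group q" .
  show ?thesis
  proof unfold_locales
    show "finite (carrier (integer_mod_group n \<times>\<times> integer_mod_group q))"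
      using assms by (simp add: carrier_integer_mod_group)
    fix u v assume "u \<in> carrier (integer_mod_group n \<times>\<times> integer_mod_group q)"
    then have u: "0 \<le> fst u" "fst u < int n" "0 \<le> snd u" "snd u < int q"
      using assms by (auto simp: carrier_integer_mod_group)
    show "zmod n q (fst (u \<otimes>\<^bsub>integer_mod_group n \<times>\<times> integer_mod_group q\<^esub> v) - (fst u + fst v))
        (snd (u \<otimes>\<^bsub>integer_mod_group n \<times>\<times> integer_mod_group q\<^esub> v) - (snd u + snd v))"
      by (simp add: zmod_def mult_DirProd' mod_eq_dvd_iff[symmetric])
    show "u = \<one>\<^bsub>integer_mod_group n \<times>\<times> integer_mod_group q\<^esub> \<longleftrightarrow> zmod n q (fst u) (snd u)"
      using u by (auto simp: zmod_def prod_eq_iff dest: zdvd_imp_le)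
  next
    fix a b
    show "\<exists>u\<in>carrier (integer_mod_group n \<times>\<times> integer_mod_group q). zmod n q (fst u - a) (snd u - b)"
      using assms by (intro bexI[of _ "(a mod int n, b mod int q)"])
        (simp_all add: zmod_def carrier_integer_mod_group mod_eq_dvd_iff[symmetric])
  qed (use assms in simp_all)
qed

lemma K1_star_cyclic:
  assumes "n > 0"
  shows "K1_star (integer_mod_group n) = Kstar n"
proof -
  interpret modelled_group "integer_mod_group n" "\<lambda>u. u" "\<lambda>_. 0" n 1
    by (rule integer_mod_group_modelled[OF assms])
  obtain f where f: "bij_betw f {..<card (prime_factors n)} (prime_factors n)"
    by (rule prime_factors_enumeration)
  let ?r = "card (prime_factors n)" and ?\<alpha> = "\<lambda>i. multiplicity (f i) n"
  have mem: "f i \<in> prime_factors n" if "i < ?r" for i using bij_betwE[OF f] that by simp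
  have img: "f ` {..<?r} = prime_factors n" using f by (simp add: bij_betw_def)
  have dvd: "int n dvd a \<longleftrightarrow> (\<forall>i<?r. int (f i ^ multiplicity (f i) n) dvd a)" for a
  proof -
    have "(\<forall>p\<in>f ` {..<?r}. int (p ^ multiplicity p n) dvd a) \<longleftrightarrow> (\<forall>i<?r. int (f i ^ multiplicity (f i) n) dvd a)"
      by auto
    then show ?thesis unfolding img dvd_if_prime_powers_dvd[OF assms] .
  qed
  have "prime_power_decomposition (integer_mod_group n) ?r f ?\<alpha>"
  proof (rule prime_power_decompositionI[where z = "\<lambda>_. False"])
    show "prime (f i) \<and> 0 < multiplicity (f i) n" if "i < ?r" for i
      using mem[OF that] by (simp add: prime_factors_multiplicity)
    have "(\<Prod>i<?r. f i ^ ?\<alpha> i) = (\<Prod>p\<in>prime_factors n. p ^ multiplicity p n)"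
      by (rule prod.reindex_bij_betw[OF f])
    also have "\<dots> = n" by (rule prime_factorization_nat[OF assms, symmetric])
    finally show "card (carrier (integer_mod_group n)) = (\<Prod>i<?r. f i ^ ?\<alpha> i)"
      using assms by (simp add: carrier_integer_mod_group)
    show "zmod n 1 a b \<longleftrightarrow> (\<forall>i<?r. int (f i ^ ?\<alpha> i) dvd (if False then b else a))" for a b
      using dvd[of a] by (simp add: zmod_def)
  qed
  then have "K1_star (integer_mod_group n) = (\<Sum>i<?r. geo (f i) (?\<alpha> i))"
    by (intro K1_star_eq) simp_all
  also have "\<dots> = Kstar n" unfolding Kstar_def by (rule sum.reindex_bij_betw[OF f])
  finally show ?thesis .
qed

lemma K1_star_pair:
  assumes "n > 0" "prime q"
  shows "K1_star (integer_mod_group n \<times>\<times> integer_mod_group q) = Kstar n + 1"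
proof -
  have q: "q > 0" using assms(2) prime_gt_0_nat by blast
  let ?G = "integer_mod_group n \<times>\<times> integer_mod_group q"
  interpret modelled_group ?G fst snd n q
    by (rule integer_mod_group_pair_modelled[OF assms(1) q])
  obtain f where f: "bij_betw f {..<card (prime_factors n)} (prime_factors n)"
    by (rule prime_factors_enumeration)
  let ?r = "card (prime_factors n)"
  \<comment> \<open>The index \<open>?r\<close> belongs to the extra summand of order
    \<open>q\<close>, which contributes \<open>geo q 1 = 1\<close>.\<close>
  let ?p = "\<lambda>i. if i < ?r then f i else q" and ?\<alpha> = "\<lambda>i. if i < ?r then multiplicity (f i) n else 1"
  have mem: "f i \<in> prime_factors n" if "i < ?r" for i using bij_betwE[OF f] that by simp
  have img: "f ` {..<?r} = prime_factors n" using f by (simp add: bij_betw_def)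
  have dvd: "int n dvd a \<longleftrightarrow> (\<forall>i<?r. int (f i ^ multiplicity (f i) n) dvd a)" for a
  proof -
    have "(\<forall>p\<in>f ` {..<?r}. int (p ^ multiplicity p n) dvd a) \<longleftrightarrow> (\<forall>i<?r. int (f i ^ multiplicity (f i) n) dvd a)"
      by auto
    then show ?thesis unfolding img dvd_if_prime_powers_dvd[OF assms(1)] .
  qed
  have "prime_power_decomposition ?G (Suc ?r) ?p ?\<alpha>"
  proof (rule prime_power_decompositionI[where z = "\<lambda>i. i = ?r"])
    show "prime (?p i) \<and> 0 < ?\<alpha> i" if "i < Suc ?r" for i
      using mem[of i] assms(2) by (simp add: prime_factors_multiplicity)
    have "(\<Prod>i<?r. f i ^ multiplicity (f i) n) = (\<Prod>p\<in>prime_factors n. p ^ multiplicity p n)"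
      by (rule prod.reindex_bij_betw[OF f])
    also have "\<dots> = n" by (rule prime_factorization_nat[OF assms(1), symmetric])
    finally have "(\<Prod>i<Suc ?r. ?p i ^ ?\<alpha> i) = n * q" by simp
    moreover have "card (carrier ?G) = n * q"
      using assms q by (simp add: carrier_integer_mod_group card_cartesian_product)
    ultimately show "card (carrier ?G) = (\<Prod>i<Suc ?r. ?p i ^ ?\<alpha> i)" by (simp only:)
    show "zmod n q a b \<longleftrightarrow> (\<forall>i<Suc ?r. int (?p i ^ ?\<alpha> i) dvd (if i = ?r then b else a))" for a b
      using dvd[of a] by (auto simp: zmod_def less_Suc_eq)
  qed
  then have "K1_star ?G = (\<Sum>i<Suc ?r. geo (?p i) (?\<alpha> i))"
    by (intro K1_star_eq) simp_all
  also have "\<dots> = (\<Sum>i<?r. geo (f i) (multiplicity (f i) n)) + 1" by (simp add: geo_def)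
  also have "(\<Sum>i<?r. geo (f i) (multiplicity (f i) n)) = Kstar n"
    unfolding Kstar_def by (rule sum.reindex_bij_betw[OF f])
  finally show ?thesis .
qed

text \<open>Both cases become a count of larger primes, which does not change when smaller primes
  are removed in the induction.\<close>

lemma at_most_one_larger_prime_factor:
  assumes "largest_prime_factor n q \<or> second_largest_prime_factor n q"
  shows "q \<in> prime_factors n" "card {r \<in> prime_factors n. q < r} \<le> 1"
proof -
  show "q \<in> prime_factors n"
    using assms by (auto simp: largest_prime_factor_def second_largest_prime_factor_def)
  let ?M = "Max (prime_factors n)"
  have "r = ?M" if r: "r \<in> prime_factors n" "q < r" for r
  proof (rule ccontr)
    assume "r \<noteq> ?M"
    then have "r \<le> Max (prime_factors n - {?M})" using r by (intro Max_ge) auto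
    moreover have "r \<le> ?M" using r by (intro Max_ge) auto
    ultimately show False
      using assms r(2) unfolding largest_prime_factor_def second_largest_prime_factor_def by linarith
  qed
  then have "{r \<in> prime_factors n. q < r} \<subseteq> {?M}" by blast
  then show "card {r \<in> prime_factors n. q < r} \<le> 1"
    using card_mono[of "{?M}" "{r \<in> prime_factors n. q < r}"] by simp
qed

theorem corollary18:
  fixes n :: nat
  assumes "two_wide n"
  shows "K1 (integer_mod_group n) = K1_star (integer_mod_group n) \<and>
         (\<forall>q. largest_prime_factor n q \<or> second_largest_prime_factor n q \<longrightarrow>
            K1 (integer_mod_group n \<times>\<times> integer_mod_group q) =
            K1_star (integer_mod_group n \<times>\<times> integer_mod_group q))"
proof (intro conjI allI impI)
  have n: "n > 0" using assms by (simp add: two_wide_def)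
  interpret C: modelled_group "integer_mod_group n" "\<lambda>u. u" "\<lambda>_. 0" n 1
    by (rule integer_mod_group_modelled[OF n])
  show "K1 (integer_mod_group n) = K1_star (integer_mod_group n)"
    unfolding K1_star_cyclic[OF n]
    using attained_Kstar[OF _ attained_trivial n] by (intro C.K1_eq two_wide_cross_bd(1)[OF assms]) simp
  fix q assume "largest_prime_factor n q \<or> second_largest_prime_factor n q"
  note q = at_most_one_larger_prime_factor[OF this]
  have pr: "prime q" and q0: "q > 0" using q(1) prime_gt_0_nat by auto
  interpret P: modelled_group "integer_mod_group n \<times>\<times> integer_mod_group q" fst snd n q
    by (rule integer_mod_group_pair_modelled[OF n q0])
  show "K1 (integer_mod_group n \<times>\<times> integer_mod_group q) = K1_star (integer_mod_group n \<times>\<times> integer_mod_group q)"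
    unfolding K1_star_pair[OF n pr]
    by (rule P.K1_eq[OF two_wide_cross_bd(2)[OF assms q] attained_Kstar[OF q0 attained_prime[OF pr] n]])
qed

end
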